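(* Let $V$ and $W$ be analytic discs attached to the unit sphere, with embedding maps $f$ and $g$ respectively. If $\mathcal{M}_f$ and $\mathcal{M}_g$ are isomorphic as algebras, then there exists an automorphism $\mu$ of the unit disc $\mathbb{D}$ such that $\mathcal{M}_f = \mathcal{M}_{g\circ\mu}$ with equivalent norms.
   Context: Notation: $\mathbb{D}$ is the open unit disc, $\mathbb{B}_d$ the open Euclidean unit ball of $\mathbb{C}^d$, with $\langle z,w\rangle=\sum_j z_j\overline{w_j}$. The Drury-Arveson space $H^2_d$ is the reproducing kernel Hilbert space (RKHS) on $\mathbb{B}_d$ with kernel $\kappa_w(z)=\frac{1}{1-\langle z,w\rangle}$; $\mathcal{M}_d=\operatorname{Mult}(H^2_d)$ is its multiplier algebra. A variety in $\mathbb{B}_d$ is a set of the form $\{z\in\mathbb{B}_d:\varphi(z)=0\ \text{for all}\ \varphi\in E\}$ with $E\subset\mathcal{M}_d$. An analytic disc attached to the unit sphere is a variety $V\subset\mathbb{B}_d$, $d<\infty$, for which there exists an injective analytic map $f:\mathbb{D}\to\mathbb{B}_d$ with $f'(z)\neq 0$ for $z\in\mathbb{D}$, such that $V=f(\mathbb{D})$, $f$ extends to be $C^2$ up to $\overline{\mathbb{D}}$, and for $x\in\overline{\mathbb{D}}$, $\|f(x)\|=1\iff|x|=1$. Such an $f$ is called an embedding map of $V$. If $g$ is an embedding map of $W$ and $\mu$ is a disc automorphism, then $g\circ\mu$ is also an embedding map of $W$. For a variety $V$, $\mathcal{H}_V$ is the closed linear span of $\{\kappa_\lambda:\lambda\in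 V\}$ in $H^2_d$, regarded as an RKHS of functions on $V$, and $\mathcal{M}_V=\{\varphi|_V:\varphi\in\mathcal{M}_d\}$, which equals $\operatorname{Mult}(\mathcal{H}_V)$ and carries the multiplier norm. If $f$ is an embedding map of $V$, then $\mathcal{M}_f=\{\varphi:\mathbb{D}\to\mathbb{C}:\ \varphi\circ f^{-1}\in\mathcal{M}_V\}$ with $\|\varphi\|_{\mathcal{M}_f}=\|\varphi\circ f^{-1}\|_{\mathcal{M}_V}$. Equality such as $\mathcal{M}_f=\mathcal{M}_{g\circ\mu}$ means equality as sets of functions on $\mathbb{D}$. *)

theory Defs
  imports "HOL-Complex_Analysis.Complex_Analysis"
begin

text \<open>
  A function on a set \<open>X\<close> is represented by a function on the ambient type that vanishes
  off \<open>X\<close>. Sums, products and scalar multiples of such functions are then pointwise.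
\<close>

definition fun_on :: "'a set \<Rightarrow> ('a \<Rightarrow> complex) \<Rightarrow> bool" where
  "fun_on X h \<longleftrightarrow> (\<forall>x. x \<notin> X \<longrightarrow> h x = 0)"

definition restr :: "'a set \<Rightarrow> ('a \<Rightarrow> complex) \<Rightarrow> 'a \<Rightarrow> complex" where
  "restr X h = (\<lambda>x. if x \<in> X then h x else 0)"

record 'a fun_space =
  fns :: "('a \<Rightarrow> complex) set"
  ip :: "('a \<Rightarrow> complex) \<Rightarrow> ('a \<Rightarrow> complex) \<Rightarrow> complex"

definition nrm :: "'a fun_space \<Rightarrow> ('a \<Rightarrow> complex) \<Rightarrow> real" where
  "nrm H h = sqrt (Re (ip H h h))"

definition inner_product_fun_space :: "'a set \<Rightarrow> 'a fun_space \<Rightarrow> bool" where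
  "inner_product_fun_space X H \<longleftrightarrow>
     (\<forall>h\<in>fns H. fun_on X h) \<and>
     (\<lambda>x. 0) \<in> fns H \<and>
     (\<forall>h\<in>fns H. \<forall>k\<in>fns H. (\<lambda>x. h x + k x) \<in> fns H) \<and>
     (\<forall>c. \<forall>h\<in>fns H. (\<lambda>x. c * h x) \<in> fns H) \<and>
     (\<forall>h\<in>fns H. \<forall>k\<in>fns H. \<forall>l\<in>fns H. ip H (\<lambda>x. h x + k x) l = ip H h l + ip H k l) \<and>
     (\<forall>c. \<forall>h\<in>fns H. \<forall>k\<in>fns H. ip H (\<lambda>x. c * h x) k = c * ip H h k) \<and>
     (\<forall>h\<in>fns H. \<forall>k\<in>fns H. ip H k h = cnj (ip H h k)) \<and>
     (\<forall>h\<in>fns H. h \<noteq> (\<lambda>x. 0) \<longrightarrow> Re (ip H h h) > 0)"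

definition complete_fun_space :: "'a fun_space \<Rightarrow> bool" where
  "complete_fun_space H \<longleftrightarrow>
     (\<forall>s. (\<forall>n::nat. s n \<in> fns H) \<and>
          (\<forall>e>0. \<exists>N. \<forall>m\<ge>N. \<forall>n\<ge>N. nrm H (\<lambda>x. s m x - s n x) < e) \<longrightarrow>
          (\<exists>h\<in>fns H. (\<lambda>n. nrm H (\<lambda>x. s n x - h x)) \<longlonglongrightarrow> 0))"

text \<open>
  In \<open>is_rkhs X K H\<close> the function \<open>K w\<close> is the kernel function at \<open>w\<close>. The last clause only
  fixes the junk values of the inner product, so that \<open>H\<close> is uniquely determined by \<open>X\<close> and
  \<open>K\<close> (Moore-Aronszajn) and \<open>rkhs\<close> may use a definite description.
\<close>

definition is_rkhs :: "'a set \<Rightarrow> ('a \<Rightarrow> 'a \<Rightarrow> complex) \<Rightarrow> 'a fun_space \<Rightarrow> bool" where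
  "is_rkhs X K H \<longleftrightarrow>
     inner_product_fun_space X H \<and> complete_fun_space H \<and>
     (\<forall>w\<in>X. K w \<in> fns H \<and> (\<forall>h\<in>fns H. ip H h (K w) = h w)) \<and>
     (\<forall>h k. h \<notin> fns H \<or> k \<notin> fns H \<longrightarrow> ip H h k = 0)"

definition rkhs :: "'a set \<Rightarrow> ('a \<Rightarrow> 'a \<Rightarrow> complex) \<Rightarrow> 'a fun_space" where
  "rkhs X K = (THE H. is_rkhs X K H)"

definition Mult :: "'a set \<Rightarrow> 'a fun_space \<Rightarrow> ('a \<Rightarrow> complex) set" where
  "Mult X H = {\<phi>. fun_on X \<phi> \<and> (\<forall>h\<in>fns H. (\<lambda>x. \<phi> x * h x) \<in> fns H)}"

text \<open>The operator norm of \<open>h \<mapsto> \<phi> h\<close>, which is finite for multipliers by the closed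
  graph theorem.\<close>

definition mult_norm :: "'a fun_space \<Rightarrow> ('a \<Rightarrow> complex) \<Rightarrow> real" where
  "mult_norm H \<phi> = Sup {nrm H (\<lambda>x. \<phi> x * h x) | h. h \<in> fns H \<and> nrm H h \<le> 1}"

definition herm :: "complex ^ 'n \<Rightarrow> complex ^ 'n \<Rightarrow> complex" where
  "herm z w = (\<Sum>j\<in>UNIV. z $ j * cnj (w $ j))"

definition da_kernel :: "complex ^ 'n \<Rightarrow> complex ^ 'n \<Rightarrow> complex" where
  "da_kernel w = restr (ball 0 1) (\<lambda>z. 1 / (1 - herm z w))"

definition drury_arveson :: "(complex ^ 'n) fun_space" where
  "drury_arveson = rkhs (ball 0 1) da_kernel"

definition da_mult :: "(complex ^ 'n \<Rightarrow> complex) set" where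
  "da_mult = Mult (ball 0 1) drury_arveson"

definition variety :: "(complex ^ 'n) set \<Rightarrow> bool" where
  "variety V \<longleftrightarrow> (\<exists>E \<subseteq> da_mult. V = {z \<in> ball 0 1. \<forall>\<phi>\<in>E. \<phi> z = 0})"

definition kernel_span :: "(complex ^ 'n) set \<Rightarrow> (complex ^ 'n \<Rightarrow> complex) set" where
  "kernel_span V =
     {h. \<exists>S c. finite S \<and> S \<subseteq> V \<and> h = (\<lambda>z. \<Sum>w\<in>S. c w * da_kernel w z)}"

definition closed_kernel_span :: "(complex ^ 'n) set \<Rightarrow> (complex ^ 'n \<Rightarrow> complex) set" where
  "closed_kernel_span V =
     {h \<in> fns drury_arveson.
        \<forall>e>0. \<exists>k\<in>kernel_span V. nrm drury_arveson (\<lambda>z. h z - k z) < e}"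

text \<open>
  An element of \<open>closed_kernel_span V\<close> is determined by its restriction to \<open>V\<close>, so the inner
  product of the Drury-Arveson space can be carried over to these restrictions.
\<close>

definition H_var :: "(complex ^ 'n) set \<Rightarrow> (complex ^ 'n) fun_space" where
  "H_var V =
     (let ext = the_inv_into (closed_kernel_span V) (restr V)
      in \<lparr>fns = restr V ` closed_kernel_span V,
          ip = (\<lambda>h k. ip drury_arveson (ext h) (ext k))\<rparr>)"

definition M_var :: "(complex ^ 'n) set \<Rightarrow> (complex ^ 'n \<Rightarrow> complex) set" where
  "M_var V = restr V ` da_mult"

definition M_var_norm :: "(complex ^ 'n) set \<Rightarrow> (complex ^ 'n \<Rightarrow> complex) \<Rightarrow> real" where
  "M_var_norm V \<phi> = mult_norm (H_var V) \<phi>"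

text \<open>
  For an analytic map, being \<open>C\<^sup>2\<close> up to the closed disc means that its complex derivatives of
  order at most two extend continuously to the closed disc. The boundary values in the last
  clause are those of the continuous extension \<open>F\<close>; the values of \<open>f\<close> off the open disc are
  irrelevant.
\<close>

definition disc_embedding :: "(complex \<Rightarrow> complex ^ 'n) \<Rightarrow> (complex ^ 'n) set \<Rightarrow> bool" where
  "disc_embedding f V \<longleftrightarrow>
     f ` ball 0 1 \<subseteq> ball 0 1 \<and> inj_on f (ball 0 1) \<and> V = f ` ball 0 1 \<and>
     (\<forall>i. (\<lambda>z. f z $ i) holomorphic_on ball 0 1) \<and>
     (\<forall>z\<in>ball 0 1. (\<chi> i. deriv (\<lambda>z. f z $ i) z) \<noteq> 0) \<and>
     (\<forall>i. \<forall>k\<le>2. \<exists>G. continuous_on (cball 0 1) G \<and>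
        (\<forall>z\<in>ball 0 1. G z = (deriv ^^ k) (\<lambda>z. f z $ i) z)) \<and>
     (\<exists>F. continuous_on (cball 0 1) F \<and> (\<forall>z\<in>ball 0 1. F z = f z) \<and>
        (\<forall>x\<in>cball 0 1. norm (F x) = 1 \<longleftrightarrow> norm x = 1))"

definition attached_disc :: "(complex ^ 'n) set \<Rightarrow> bool" where
  "attached_disc V \<longleftrightarrow> variety V \<and> (\<exists>f. disc_embedding f V)"

text \<open>The function \<open>\<phi> \<circ> f\<^sup>-\<^sup>1\<close> on the image of the disc under \<open>f\<close>.\<close>

definition push :: "(complex \<Rightarrow> complex ^ 'n) \<Rightarrow> (complex \<Rightarrow> complex) \<Rightarrow> complex ^ 'n \<Rightarrow> complex" where
  "push f \<phi> = restr (f ` ball 0 1) (\<phi> \<circ> the_inv_into (ball 0 1) f)"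

definition M_emb :: "(complex \<Rightarrow> complex ^ 'n) \<Rightarrow> (complex \<Rightarrow> complex) set" where
  "M_emb f = {\<phi>. fun_on (ball 0 1) \<phi> \<and> push f \<phi> \<in> M_var (f ` ball 0 1)}"

definition M_emb_norm :: "(complex \<Rightarrow> complex ^ 'n) \<Rightarrow> (complex \<Rightarrow> complex) \<Rightarrow> real" where
  "M_emb_norm f \<phi> = M_var_norm (f ` ball 0 1) (push f \<phi>)"

definition disc_automorphism :: "(complex \<Rightarrow> complex) \<Rightarrow> bool" where
  "disc_automorphism \<mu> \<longleftrightarrow>
     \<mu> holomorphic_on ball 0 1 \<and> \<mu> ` ball 0 1 \<subseteq> ball 0 1 \<and>
     (\<exists>\<nu>. \<nu> holomorphic_on ball 0 1 \<and> \<nu> ` ball 0 1 \<subseteq> ball 0 1 \<and>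
        (\<forall>z\<in>ball 0 1. \<nu> (\<mu> z) = z \<and> \<mu> (\<nu> z) = z))"

definition algebra_isomorphic :: "('a \<Rightarrow> complex) set \<Rightarrow> ('b \<Rightarrow> complex) set \<Rightarrow> bool" where
  "algebra_isomorphic A B \<longleftrightarrow>
     (\<exists>\<Phi>. bij_betw \<Phi> A B \<and>
        (\<forall>\<phi>\<in>A. \<forall>\<psi>\<in>A. \<Phi> (\<lambda>x. \<phi> x + \<psi> x) = (\<lambda>y. \<Phi> \<phi> y + \<Phi> \<psi> y)) \<and>
        (\<forall>c. \<forall>\<phi>\<in>A. \<Phi> (\<lambda>x. c * \<phi> x) = (\<lambda>y. c * \<Phi> \<phi> y)) \<and>
        (\<forall>\<phi>\<in>A. \<forall>\<psi>\<in>A. \<Phi> (\<lambda>x. \<phi> x * \<psi> x) = (\<lambda>y. \<Phi> \<phi> y * \<Phi> \<psi> y)))"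

definition equivalent_norms :: "'a set \<Rightarrow> ('a \<Rightarrow> real) \<Rightarrow> ('a \<Rightarrow> real) \<Rightarrow> bool" where
  "equivalent_norms A N1 N2 \<longleftrightarrow>
     (\<exists>c>0. \<exists>C>0. \<forall>x\<in>A. c * N1 x \<le> N2 x \<and> N2 x \<le> C * N1 x)"

end

theory Submission
  imports Defs
begin

text \<open>
  An algebra isomorphism \<open>\<Phi>\<close> from \<open>M_emb f\<close> to \<open>M_emb g\<close> turns every point \<open>z\<close> of the disc into a
  character of the Drury-Arveson multiplier algebra: pull a multiplier \<open>\<Psi>\<close> back along \<open>f\<close>, apply
  \<open>\<Phi>\<close> and evaluate at \<open>z\<close>. Let \<open>h z\<close> be the point whose coordinates are the values of this character
  on the coordinate functions. The whole theorem rests on knowing such characters.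

  A character takes the coordinates to a point of the closed ball, because \<open>1 - \<langle>\<cdot>, a\<rangle>\<close> is invertible
  in the multiplier algebra for \<open>|a| < 1\<close>, with inverse the kernel function at \<open>a\<close>. If this point
  lies in the open ball, the character is the evaluation there (\<open>da_character.eval\<close>): every
  multiplier \<open>\<phi>\<close> with \<open>\<phi> l = 0\<close> is a combination of the \<open>z\<^sub>j - l\<^sub>j\<close> with multipliers as coefficients
  (\<open>Gleason_factorization\<close>).

  The map \<open>h\<close> is holomorphic. If it touched the sphere it would be constant by the maximum principle,
  \<open>\<Phi>\<close> would send the components of \<open>f\<close> to constants, and \<open>f\<close> would be constant. So \<open>h\<close> maps into
  the open ball, and \<open>\<Phi>\<close> is composition with \<open>h\<close> on pullbacks. The multipliers that define the
  variety \<open>V\<close> pull back to \<open>0\<close>, hence vanish at \<open>h z\<close>, and \<open>h\<close> maps into \<open>V\<close>. Since \<open>f\<close> is a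
  homeomorphism onto \<open>V\<close> (it extends continuously and sends the circle to the sphere) with
  nonvanishing derivative, \<open>f\<^sup>-\<^sup>1 \<circ> h\<close> is holomorphic. The same argument for the inverse of \<open>\<Phi>\<close> gives
  its inverse, so both are automorphisms of the disc, and \<open>\<mu>\<close> is the one belonging to the inverse
  of \<open>\<Phi>\<close> (\<open>isomorphism_is_composition\<close>). Equality of the algebras follows, and equivalence of the
  norms is then automatic: both are Banach algebra norms on one algebra of functions, compared by the
  uniform boundedness principle (\<open>mult_norm_dominated\<close>).

  The functional-analytic input is Leech's theorem for the Drury-Arveson kernel
  (\<open>Leech_factorization\<close>): if \<open>(\<Sum>\<^sub>j \<alpha>\<^sub>j(z) cnj (\<alpha>\<^sub>j(w)) - \<theta>(z) cnj (\<theta>(w))) / (1 - \<langle>z, w\<rangle>)\<close> is positive on a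
  subset of the ball, then \<open>\<theta> = \<Sum>\<^sub>j \<alpha>\<^sub>j \<psi>\<^sub>j\<close> there with contractive multipliers \<open>\<psi>\<^sub>j\<close> of the whole ball.
  With \<open>\<alpha>\<close> constant it is the Nevanlinna-Pick property (\<open>Pick_extension\<close>), which identifies the
  restrictions of multipliers to \<open>V\<close> with the multipliers of the restricted kernel. With \<open>\<alpha>\<close> the components
  of a ball automorphism sending \<open>l\<close> to \<open>0\<close>, up to an isometry, it gives the Gleason factorization.
\<close>

section \<open>Inner product spaces of functions\<close>

locale inner_fun_space =
  fixes X :: "'a set" and H :: "'a fun_space"
  assumes inner_product: "inner_product_fun_space X H"
begin

lemma
  shows zero_mem: "(\<lambda>x. 0) \<in> fns H"
    and fns_fun_on: "h \<in> fns H \<Longrightarrow> fun_on X h"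
    and add_mem: "h \<in> fns H \<Longrightarrow> k \<in> fns H \<Longrightarrow> (\<lambda>x. h x + k x) \<in> fns H"
    and scale_mem: "h \<in> fns H \<Longrightarrow> (\<lambda>x. c * h x) \<in> fns H"
    and ip_add_left: "h \<in> fns H \<Longrightarrow> k \<in> fns H \<Longrightarrow> l \<in> fns H \<Longrightarrow>
          ip H (\<lambda>x. h x + k x) l = ip H h l + ip H k l"
    and ip_scale_left: "h \<in> fns H \<Longrightarrow> k \<in> fns H \<Longrightarrow> ip H (\<lambda>x. c * h x) k = c * ip H h k"
    and ip_cnj: "h \<in> fns H \<Longrightarrow> k \<in> fns H \<Longrightarrow> ip H k h = cnj (ip H h k)"
    and ip_pos: "h \<in> fns H \<Longrightarrow> h \<noteq> (\<lambda>x. 0) \<Longrightarrow> Re (ip H h h) > 0"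
  using inner_product unfolding inner_product_fun_space_def by - (blast+)

lemma diff_mem:
  assumes "h \<in> fns H" "k \<in> fns H"
  shows "(\<lambda>x. h x - k x) \<in> fns H"
  using add_mem[OF assms(1) scale_mem[OF assms(2), of "-1"]] by simp

lemma ip_zero_left: "k \<in> fns H \<Longrightarrow> ip H (\<lambda>x. 0) k = 0"
  using ip_scale_left[OF zero_mem, of k 0] by simp

lemma ip_add_right:
  assumes "h \<in> fns H" "k \<in> fns H" "l \<in> fns H"
  shows "ip H l (\<lambda>x. h x + k x) = ip H l h + ip H l k"
  by (simp only: ip_cnj[OF add_mem[OF assms(1,2)] assms(3)] ip_add_left[OF assms]
      ip_cnj[OF assms(1,3)] ip_cnj[OF assms(2,3)] complex_cnj_add)

lemma ip_scale_right:
  assumes "h \<in> fns H" "k \<in> fns H"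
  shows "ip H h (\<lambda>x. c * k x) = cnj c * ip H h k"
  by (simp only: ip_cnj[OF scale_mem[OF assms(2)] assms(1)] ip_scale_left[OF assms(2,1)]
      ip_cnj[OF assms(2,1)] complex_cnj_mult)

lemma ip_diff_left:
  assumes "h \<in> fns H" "k \<in> fns H" "l \<in> fns H"
  shows "ip H (\<lambda>x. h x - k x) l = ip H h l - ip H k l"
  using ip_add_left[OF assms(1) scale_mem[OF assms(2), of "-1"] assms(3)]
    ip_scale_left[OF assms(2,3), of "-1"] by simp

lemma sum_mem:
  assumes "\<And>i. i \<in> I \<Longrightarrow> h i \<in> fns H"
  shows "(\<lambda>x. \<Sum>i\<in>I. c i * h i x) \<in> fns H"
  using assms
  by (induction I rule: infinite_finite_induct) (auto simp: zero_mem add_mem scale_mem)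

lemma ip_sum_left:
  assumes "\<And>i. i \<in> I \<Longrightarrow> h i \<in> fns H" "k \<in> fns H"
  shows "ip H (\<lambda>x. \<Sum>i\<in>I. c i * h i x) k = (\<Sum>i\<in>I. c i * ip H (h i) k)"
  using assms
proof (induction I rule: infinite_finite_induct)
  case (insert i I)
  then have "ip H (\<lambda>x. c i * h i x + (\<Sum>j\<in>I. c j * h j x)) k
      = c i * ip H (h i) k + (\<Sum>j\<in>I. c j * ip H (h j) k)"
    by (subst ip_add_left) (auto simp: scale_mem sum_mem ip_scale_left)
  with insert show ?case by simp
qed (auto simp: ip_zero_left)

lemma ip_sum_right:
  assumes "\<And>i. i \<in> I \<Longrightarrow> h i \<in> fns H" "k \<in> fns H"
  shows "ip H k (\<lambda>x. \<Sum>i\<in>I. c i * h i x) = (\<Sum>i\<in>I. cnj (c i) * ip H k (h i))"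
proof -
  have "ip H k (\<lambda>x. \<Sum>i\<in>I. c i * h i x) = cnj (ip H (\<lambda>x. \<Sum>i\<in>I. c i * h i x) k)"
    by (rule ip_cnj) (use assms in \<open>auto intro: sum_mem\<close>)
  also have "\<dots> = (\<Sum>i\<in>I. cnj (c i) * cnj (ip H (h i) k))"
    using assms by (simp add: ip_sum_left)
  also have "\<dots> = (\<Sum>i\<in>I. cnj (c i) * ip H k (h i))"
    by (intro sum.cong refl) (metis assms ip_cnj)
  finally show ?thesis .
qed

lemma ip_self_ge_0: "h \<in> fns H \<Longrightarrow> Re (ip H h h) \<ge> 0"
  using ip_pos[of h] ip_zero_left[OF zero_mem] by (cases "h = (\<lambda>x. 0)") auto

lemma nrm_power2: "h \<in> fns H \<Longrightarrow> (nrm H h)\<^sup>2 = Re (ip H h h)"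
  by (simp add: nrm_def ip_self_ge_0)

lemma nrm_ge_0: "h \<in> fns H \<Longrightarrow> nrm H h \<ge> 0"
  by (simp add: nrm_def ip_self_ge_0)

lemma ip_self: "h \<in> fns H \<Longrightarrow> ip H h h = of_real ((nrm H h)\<^sup>2)"
proof -
  assume h: "h \<in> fns H"
  have "Im (ip H h h) = Im (cnj (ip H h h))" using ip_cnj[OF h h] by (rule arg_cong)
  then show ?thesis by (simp add: nrm_power2[OF h] complex_eq_iff)
qed

lemma nrm_zero: "nrm H (\<lambda>x. 0) = 0"
  by (simp add: nrm_def ip_zero_left zero_mem)

lemma nrm_eq_0D: "h \<in> fns H \<Longrightarrow> nrm H h = 0 \<Longrightarrow> h = (\<lambda>x. 0)"
  using ip_pos[of h] nrm_power2[of h] by (auto simp: fun_eq_iff)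

lemma nrm_scale: "h \<in> fns H \<Longrightarrow> nrm H (\<lambda>x. c * h x) = cmod c * nrm H h"
proof -
  assume h: "h \<in> fns H"
  have "ip H (\<lambda>x. c * h x) (\<lambda>x. c * h x) = (c * cnj c) * ip H h h"
    using h by (simp add: ip_scale_left ip_scale_right scale_mem)
  then have "(nrm H (\<lambda>x. c * h x))\<^sup>2 = (cmod c * nrm H h)\<^sup>2"
    using h by (simp add: nrm_power2 scale_mem complex_mult_cnj cmod_power2 power_mult_distrib)
  then show ?thesis using h by (simp add: nrm_ge_0 scale_mem power2_eq_iff_nonneg)
qed

lemma nrm_add_power2:
  assumes "h \<in> fns H" "k \<in> fns H"
  shows "(nrm H (\<lambda>x. h x + k x))\<^sup>2 = (nrm H h)\<^sup>2 + 2 * Re (ip H h k) + (nrm H k)\<^sup>2"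
  using assms ip_cnj[OF assms] by (simp add: nrm_power2 add_mem ip_add_left ip_add_right)

lemma nrm_diff_power2:
  assumes "h \<in> fns H" "k \<in> fns H"
  shows "(nrm H (\<lambda>x. h x - k x))\<^sup>2 = (nrm H h)\<^sup>2 - 2 * Re (ip H h k) + (nrm H k)\<^sup>2"
  using nrm_add_power2[OF assms(1) scale_mem[OF assms(2), of "-1"]]
    ip_scale_right[OF assms, of "-1"] nrm_scale[OF assms(2), of "-1"] by simp

lemma parallelogram:
  assumes "h \<in> fns H" "k \<in> fns H"
  shows "(nrm H (\<lambda>x. h x + k x))\<^sup>2 + (nrm H (\<lambda>x. h x - k x))\<^sup>2
           = 2 * (nrm H h)\<^sup>2 + 2 * (nrm H k)\<^sup>2"
  using assms by (simp add: nrm_add_power2 nrm_diff_power2)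

lemma Cauchy_Schwarz:
  assumes h: "h \<in> fns H" and k: "k \<in> fns H"
  shows "cmod (ip H h k) \<le> nrm H h * nrm H k"
proof (cases "nrm H k = 0")
  case True
  then have "ip H h k = cnj (ip H (\<lambda>x. 0) h)" using nrm_eq_0D[OF k] ip_cnj[OF k h] by simp
  then show ?thesis using True by (simp add: ip_zero_left h)
next
  case False
  define t where "t = ip H h k / of_real ((nrm H k)\<^sup>2)"
  have n: "(nrm H k)\<^sup>2 > 0" using False by simp
  have "cnj t * ip H h k = of_real ((cmod (ip H h k))\<^sup>2 / (nrm H k)\<^sup>2)"
    using complex_norm_square[of "ip H h k"] by (simp add: t_def mult.commute)
  moreover have "(cmod t * nrm H k)\<^sup>2 = (cmod (ip H h k))\<^sup>2 / (nrm H k)\<^sup>2"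
  proof -
    have "cmod t = cmod (ip H h k) / (nrm H k)\<^sup>2" by (simp add: t_def norm_divide norm_power)
    then show ?thesis using n by (simp add: power2_eq_square)
  qed
  ultimately have "(nrm H (\<lambda>x. h x - t * k x))\<^sup>2 = (nrm H h)\<^sup>2 - (cmod (ip H h k))\<^sup>2 / (nrm H k)\<^sup>2"
    using nrm_diff_power2[OF h scale_mem[OF k, of t]] by (simp add: ip_scale_right h k nrm_scale)
  then have "(cmod (ip H h k))\<^sup>2 \<le> (nrm H h * nrm H k)\<^sup>2"
    using n zero_le_power2[of "nrm H (\<lambda>x. h x - t * k x)"]
    by (simp add: power_mult_distrib pos_divide_le_eq)
  then show ?thesis
    by (rule power2_le_imp_le) (simp add: nrm_ge_0 h k)
qed

lemma nrm_triangle: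
  assumes "h \<in> fns H" "k \<in> fns H"
  shows "nrm H (\<lambda>x. h x + k x) \<le> nrm H h + nrm H k"
proof (rule power2_le_imp_le)
  have "Re (ip H h k) \<le> nrm H h * nrm H k"
    using Cauchy_Schwarz[OF assms] complex_Re_le_cmod order_trans by blast
  then show "(nrm H (\<lambda>x. h x + k x))\<^sup>2 \<le> (nrm H h + nrm H k)\<^sup>2"
    by (simp add: nrm_add_power2 assms power2_sum)
qed (simp add: nrm_ge_0 assms)

lemma nrm_minus_commute:
  assumes "h \<in> fns H" "k \<in> fns H"
  shows "nrm H (\<lambda>x. h x - k x) = nrm H (\<lambda>x. k x - h x)"
  using nrm_scale[OF diff_mem[OF assms], of "-1"] by simp

lemma nrm_triangle_diff:
  assumes "h \<in> fns H" "k \<in> fns H" "l \<in> fns H"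
  shows "nrm H (\<lambda>x. h x - l x) \<le> nrm H (\<lambda>x. h x - k x) + nrm H (\<lambda>x. k x - l x)"
  using nrm_triangle[OF diff_mem[OF assms(1,2)] diff_mem[OF assms(2,3)]] by simp

lemma nrm_abs_diff:
  assumes "h \<in> fns H" "k \<in> fns H"
  shows "\<bar>nrm H h - nrm H k\<bar> \<le> nrm H (\<lambda>x. h x - k x)"
  using nrm_triangle[OF diff_mem[OF assms] assms(2)] nrm_triangle[OF diff_mem[OF assms(2,1)] assms(1)]
    nrm_minus_commute[OF assms] by simp

end

text \<open>
  Polarization: the real part of \<open>ip h k\<close> is read off from \<open>nrm (h + k)\<close>, and the imaginary part
  is the real part for \<open>-\<i> h\<close>.
\<close>

lemma ip_eq_if_nrm_eq:
  assumes A: "inner_fun_space X A" and B: "inner_fun_space X B" and fns: "fns A = fns B"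
    and nrm: "\<And>h. h \<in> fns A \<Longrightarrow> nrm A h = nrm B h" and h: "h \<in> fns A" and k: "k \<in> fns A"
  shows "ip A h k = ip B h k"
proof -
  interpret A: inner_fun_space X A by fact
  interpret B: inner_fun_space X B by fact
  have re: "Re (ip A h k) = Re (ip B h k)" if "h \<in> fns A" "k \<in> fns A" for h k
    using A.nrm_add_power2[OF that] B.nrm_add_power2[of h k] that
    by (simp add: nrm A.add_mem fns[symmetric])
  have "Re (- \<i> * ip A h k) = Re (- \<i> * ip B h k)"
    using re[OF A.scale_mem[OF h, of "-\<i>"] k]
      A.ip_scale_left[OF h k, of "-\<i>"] B.ip_scale_left[of h k "-\<i>"] h k
    by (simp add: fns[symmetric])
  with re[OF h k] show ?thesis by (simp add: complex_eq_iff)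
qed

section \<open>Norms that satisfy the parallelogram law\<close>

text \<open>
  Subtracting \<open>t * \<phi> 1\<close> leaves an additive function of period 1, which is bounded on the whole line;
  a bounded additive function vanishes.
\<close>

lemma additive_bounded_imp_linear:
  fixes \<phi> :: "real \<Rightarrow> real"
  assumes add: "\<And>s t. \<phi> (s + t) = \<phi> s + \<phi> t"
    and bounded: "\<And>t. \<bar>t\<bar> \<le> 1 \<Longrightarrow> \<bar>\<phi> t\<bar> \<le> M"
  shows "\<phi> t = t * \<phi> 1"
proof -
  define \<psi> where "\<psi> t = \<phi> t - t * \<phi> 1" for t
  have \<psi>_add: "\<psi> (s + t) = \<psi> s + \<psi> t" for s t
    by (simp add: \<psi>_def add algebra_simps)
  have \<psi>_nat: "\<psi> (of_nat n * t) = of_nat n * \<psi> t" for n t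
    by (induction n) (use \<psi>_add[of 0 0] in \<open>auto simp: \<psi>_add distrib_right\<close>)
  have "\<psi> 1 = 0" by (simp add: \<psi>_def)
  then have nat0: "\<psi> (of_nat n) = 0" for n using \<psi>_nat[of n 1] by simp
  have minus: "\<psi> (- t) = - \<psi> t" for t using \<psi>_add[of t "-t"] \<psi>_add[of 0 0] by simp
  have int0: "\<psi> (of_int i) = 0" for i
    by (cases i rule: int_cases2) (auto simp: nat0 minus)
  have bnd: "\<bar>\<psi> t\<bar> \<le> 2 * M" for t
  proof -
    have "\<psi> t = \<psi> (frac t)"
      using \<psi>_add[of "of_int \<lfloor>t\<rfloor>" "frac t"] int0[of "\<lfloor>t\<rfloor>"] by (simp add: frac_def)
    also have "\<bar>\<dots>\<bar> \<le> \<bar>\<phi> (frac t)\<bar> + \<bar>frac t\<bar> * \<bar>\<phi> 1\<bar>"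
      unfolding \<psi>_def abs_mult[symmetric] by (rule abs_triangle_ineq4)
    also have "\<dots> \<le> M + 1 * M"
      using frac_ge_0[of t] frac_lt_1[of t] bounded[of "frac t"] bounded[of 1]
      by (intro add_mono mult_mono) auto
    finally show ?thesis by simp
  qed
  have "\<psi> t = 0"
  proof (rule ccontr)
    assume "\<psi> t \<noteq> 0"
    then obtain n where "2 * M < of_nat n * \<bar>\<psi> t\<bar>"
      using reals_Archimedean3[of "\<bar>\<psi> t\<bar>"] by auto
    with bnd[of "of_nat n * t"] show False by (simp add: \<psi>_nat abs_mult)
  qed
  then show ?thesis by (simp add: \<psi>_def)
qed

definition polarization :: "(('a \<Rightarrow> complex) \<Rightarrow> real) \<Rightarrow> ('a \<Rightarrow> complex) \<Rightarrow> ('a \<Rightarrow> complex) \<Rightarrow> complex" where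
  "polarization N f g =
     (let r = (\<lambda>g. (N (\<lambda>x. f x + g x) - N (\<lambda>x. f x - g x)) / 4)
      in Complex (r g) (r (\<lambda>x. \<i> * g x)))"

text \<open>
  Here \<open>N\<close> is the square of a norm. Additivity is algebra with the parallelogram law; homogeneity
  over the reals then follows because \<open>t \<mapsto> r (t f) g\<close> is additive and bounded near \<open>0\<close>.
\<close>

lemma Jordan_von_Neumann:
  assumes zero: "(\<lambda>x. 0) \<in> F"
    and add: "\<And>f g. f \<in> F \<Longrightarrow> g \<in> F \<Longrightarrow> (\<lambda>x. f x + g x) \<in> F"
    and scale: "\<And>c f. f \<in> F \<Longrightarrow> (\<lambda>x. c * f x) \<in> F"
    and par: "\<And>f g. f \<in> F \<Longrightarrow> g \<in> F \<Longrightarrow>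
               N (\<lambda>x. f x + g x) + N (\<lambda>x. f x - g x) = 2 * N f + 2 * (N g :: real)"
    and hom: "\<And>c f. f \<in> F \<Longrightarrow> N (\<lambda>x. c * f x) = (cmod c)\<^sup>2 * N f"
    and pos: "\<And>f. f \<in> F \<Longrightarrow> 0 \<le> N f"
  shows "\<And>f g h. f \<in> F \<Longrightarrow> g \<in> F \<Longrightarrow> h \<in> F \<Longrightarrow>
           polarization N (\<lambda>x. f x + g x) h = polarization N f h + polarization N g h"
    and "\<And>c f g. f \<in> F \<Longrightarrow> g \<in> F \<Longrightarrow>
           polarization N (\<lambda>x. c * f x) g = c * polarization N f g"
    and "\<And>f g. f \<in> F \<Longrightarrow> g \<in> F \<Longrightarrow> polarization N g f = cnj (polarization N f g)"
    and "\<And>f. f \<in> F \<Longrightarrow> polarization N f f = of_real (N f)"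
proof -
  define r where "r f g = (N (\<lambda>x. f x + g x) - N (\<lambda>x. f x - g x)) / 4" for f g
  have pol: "polarization N f g = Complex (r f g) (r f (\<lambda>x. \<i> * g x))" for f g
    by (simp add: polarization_def r_def)
  have diff: "(\<lambda>x. f x - g x) \<in> F" if "f \<in> F" "g \<in> F" for f g
    using add[OF that(1) scale[OF that(2), of "-1"]] by simp
  have N_minus: "N (\<lambda>x. f x - g x) = N (\<lambda>x. g x - f x)" if "f \<in> F" "g \<in> F" for f g
    using hom[OF diff[OF that], of "-1"] by simp
  have r_sym: "r f g = r g f" if "f \<in> F" "g \<in> F" for f g
    using N_minus[OF that] by (simp add: r_def add.commute)
  have r_half: "r f g + r f' g = r (\<lambda>x. f x + f' x) (\<lambda>x. 2 * g x) / 2"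
    if "f \<in> F" "f' \<in> F" "g \<in> F" for f f' g
  proof -
    have "N (\<lambda>x. f x + f' x + 2 * g x) + N (\<lambda>x. f x - f' x)
            = 2 * N (\<lambda>x. f x + g x) + 2 * N (\<lambda>x. f' x + g x)"
      using par[OF add[OF that(1,3)] add[OF that(2,3)]] by (simp add: algebra_simps)
    moreover have "N (\<lambda>x. f x + f' x - 2 * g x) + N (\<lambda>x. f x - f' x)
            = 2 * N (\<lambda>x. f x - g x) + 2 * N (\<lambda>x. f' x - g x)"
      using par[OF diff[OF that(1,3)] diff[OF that(2,3)]] by (simp add: algebra_simps)
    moreover have "(A - B) / 4 + (C - D) / 4 = (P - Q) / 4 / 2"
      if "P + E = 2 * A + 2 * C" "Q + E = 2 * B + 2 * D" for A B C D E P Q :: real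
      using that by argo
    ultimately show ?thesis unfolding r_def by blast
  qed
  have r0: "r (\<lambda>x. 0) g = 0" if "g \<in> F" for g
    using N_minus[OF zero that] by (simp add: r_def)
  have r_add: "r (\<lambda>x. f x + f' x) g = r f g + r f' g"
    if "f \<in> F" "f' \<in> F" "g \<in> F" for f f' g
    using r_half[OF that] r_half[OF add[OF that(1,2)] zero that(3)] r0[OF that(3)] by simp
  have r_real: "r (\<lambda>x. of_real t * f x) g = t * r f g" if f: "f \<in> F" and g: "g \<in> F" for t f g
  proof -
    define \<phi> where "\<phi> t = r (\<lambda>x. of_real t * f x) g" for t
    have "\<phi> t = t * \<phi> 1"
    proof (rule additive_bounded_imp_linear)
      show "\<phi> (s + t) = \<phi> s + \<phi> t" for s t
        using r_add[OF scale[OF f, of "of_real s"] scale[OF f, of "of_real t"] g]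
        by (simp add: \<phi>_def distrib_right)
      fix t :: real assume "\<bar>t\<bar> \<le> 1"
      let ?p = "N (\<lambda>x. of_real t * f x + g x)" and ?m = "N (\<lambda>x. of_real t * f x - g x)"
      have "\<bar>\<phi> t\<bar> \<le> (?p + ?m) / 4"
        using pos[OF add[OF scale[OF f, of "of_real t"] g]]
          pos[OF diff[OF scale[OF f, of "of_real t"] g]] by (simp add: \<phi>_def r_def)
      also have "?p + ?m = 2 * (\<bar>t\<bar>\<^sup>2 * N f) + 2 * N g"
        using par[OF scale[OF f, of "of_real t"] g] hom[OF f, of "of_real t"] by simp
      also have "\<bar>t\<bar>\<^sup>2 * N f \<le> 1 * N f"
        using \<open>\<bar>t\<bar> \<le> 1\<close> pos[OF f] by (intro mult_right_mono) (auto simp: power_le_one abs_le_square_iff abs_square_le_1)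
      finally show "\<bar>\<phi> t\<bar> \<le> (2 * N f + 2 * N g) / 4" by simp
    qed
    then show ?thesis by (simp add: \<phi>_def)
  qed
  have r_i: "r (\<lambda>x. \<i> * f x) g = - r f (\<lambda>x. \<i> * g x)" if f: "f \<in> F" and g: "g \<in> F" for f g
  proof -
    have 1: "N (\<lambda>x. \<i> * f x + g x) = N (\<lambda>x. f x - \<i> * g x)"
      using hom[OF diff[OF f scale[OF g, of \<i>]], of \<i>] by (simp add: algebra_simps)
    have 2: "N (\<lambda>x. \<i> * f x - g x) = N (\<lambda>x. f x + \<i> * g x)"
      using hom[OF add[OF f scale[OF g, of \<i>]], of \<i>] by (simp add: algebra_simps)
    show ?thesis by (simp add: r_def 1 2 minus_divide_left)
  qed
  have r_ii: "r (\<lambda>x. \<i> * f x) (\<lambda>x. \<i> * g x) = r f g" if f: "f \<in> F" and g: "g \<in> F" for f g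
    using hom[OF add[OF f g], of \<i>] hom[OF diff[OF f g], of \<i>] by (simp add: r_def algebra_simps)
  show pol_add: "polarization N (\<lambda>x. f x + g x) h = polarization N f h + polarization N g h"
    if "f \<in> F" "g \<in> F" "h \<in> F" for f g h
    using that by (simp add: pol r_add scale complex_eq_iff)
  show "polarization N (\<lambda>x. c * f x) g = c * polarization N f g" if f: "f \<in> F" and g: "g \<in> F" for c f g
  proof -
    have i: "polarization N (\<lambda>x. \<i> * f x) g = \<i> * polarization N f g"
      using r_i[OF f g] r_ii[OF f g] by (simp add: pol complex_eq_iff)
    have real: "polarization N (\<lambda>x. of_real t * f x) g = of_real t * polarization N f g"
      if "f \<in> F" for t f
      using that g by (simp add: pol complex_eq_iff r_real scale)
    have eq: "(\<lambda>x. c * f x) = (\<lambda>x. of_real (Re c) * f x + of_real (Im c) * (\<i> * f x))"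
      by (auto simp: fun_eq_iff complex_eq_iff)
    have "polarization N (\<lambda>x. c * f x) g
        = of_real (Re c) * polarization N f g + of_real (Im c) * (\<i> * polarization N f g)"
      unfolding eq by (simp only: pol_add scale f g real i)
    also have "\<dots> = c * polarization N f g" by (simp add: complex_eq_iff)
    finally show ?thesis .
  qed
  show "polarization N g f = cnj (polarization N f g)" if "f \<in> F" "g \<in> F" for f g
    using that r_sym[of g f] r_sym[of g "\<lambda>x. \<i> * f x"] r_i[of f g]
    by (simp add: pol scale complex_eq_iff)
  show "polarization N f f = of_real (N f)" if f: "f \<in> F" for f
  proof -
    have N0: "N (\<lambda>x. 0) = 0" using hom[OF zero, of 0] by simp
    have "N (\<lambda>x. 2 * f x) = 4 * N f" using hom[OF f, of 2] by simp
    then have "r f f = N f" by (simp add: r_def N0)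
    moreover have "r f (\<lambda>x. \<i> * f x) = 0"
      using r_i[OF f f] r_sym[OF f scale[OF f, of \<i>]] by simp
    ultimately show ?thesis by (simp add: pol complex_eq_iff)
  qed
qed

section \<open>The Hilbert space of a positive kernel\<close>

text \<open>
  In any Hilbert space with reproducing kernel \<open>K\<close>, this is the squared norm of \<open>\<Sum>w\<in>S. c w * K w\<close>.
\<close>

definition quad :: "('a \<Rightarrow> 'a \<Rightarrow> complex) \<Rightarrow> 'a set \<Rightarrow> ('a \<Rightarrow> complex) \<Rightarrow> complex" where
  "quad K S c = (\<Sum>w\<in>S. \<Sum>v\<in>S. c w * cnj (c v) * K w v)"

definition psd :: "'a set \<Rightarrow> ('a \<Rightarrow> 'a \<Rightarrow> complex) \<Rightarrow> bool" where
  "psd X K \<longleftrightarrow> (\<forall>w\<in>X. \<forall>v\<in>X. K v w = cnj (K w v)) \<and>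
     (\<forall>S c. finite S \<longrightarrow> S \<subseteq> X \<longrightarrow> 0 \<le> Re (quad K S c))"

text \<open>
  The inner product of \<open>h\<close> with \<open>\<Sum>w\<in>S. c w * K w\<close> in any space with reproducing kernel \<open>K\<close>.
\<close>

definition pair :: "'a set \<Rightarrow> ('a \<Rightarrow> complex) \<Rightarrow> ('a \<Rightarrow> complex) \<Rightarrow> complex" where
  "pair S c h = (\<Sum>w\<in>S. cnj (c w) * h w)"

lemma quad_scale: "quad K S (\<lambda>w. t * c w) = of_real ((cmod t)\<^sup>2) * quad K S c"
  unfolding complex_norm_square by (simp add: quad_def sum_distrib_left mult_ac)

lemma quad_parallelogram:
  "quad K S (\<lambda>w. c w + d w) + quad K S (\<lambda>w. c w - d w) = 2 * quad K S c + 2 * quad K S d"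
  unfolding quad_def sum_distrib_left sum.distrib[symmetric]
  by (intro sum.cong refl) (simp add: algebra_simps)

lemma pair_scale: "pair S (\<lambda>w. t * c w) h = cnj t * pair S c h"
  by (simp add: pair_def sum_distrib_left mult_ac)

lemma sum_zero_extend:
  assumes "finite T" "S \<subseteq> T"
  shows "(\<Sum>w\<in>T. if w \<in> S then f w else 0) = (\<Sum>w\<in>S. f w :: 'b :: comm_monoid_add)"
  using assms by (simp add: sum.inter_restrict[symmetric] Int_absorb1)

lemma quad_zero_extend:
  assumes "finite T" "S \<subseteq> T"
  shows "quad K T (\<lambda>w. if w \<in> S then c w else 0) = quad K S c"
proof -
  have "quad K T (\<lambda>w. if w \<in> S then c w else 0)
      = (\<Sum>w\<in>T. if w \<in> S then (\<Sum>v\<in>T. if v \<in> S then c w * cnj (c v) * K w v else 0) else 0)"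
    unfolding quad_def by (intro sum.cong refl) (auto intro!: sum.cong sum.neutral)
  also have "\<dots> = quad K S c"
    using assms by (simp add: sum_zero_extend quad_def)
  finally show ?thesis .
qed

lemma pair_zero_extend:
  assumes "finite T" "S \<subseteq> T"
  shows "pair T (\<lambda>w. if w \<in> S then c w else 0) h = pair S c h"
proof -
  have "pair T (\<lambda>w. if w \<in> S then c w else 0) h = (\<Sum>w\<in>T. if w \<in> S then cnj (c w) * h w else 0)"
    unfolding pair_def by (intro sum.cong) auto
  with sum_zero_extend[OF assms] show ?thesis by (simp add: pair_def)
qed

lemma psd_cnj: "psd X K \<Longrightarrow> w \<in> X \<Longrightarrow> v \<in> X \<Longrightarrow> cnj (K w v) = K v w"
  unfolding psd_def by metis

lemma psd_quad_ge_0: "psd X K \<Longrightarrow> finite S \<Longrightarrow> S \<subseteq> X \<Longrightarrow> 0 \<le> Re (quad K S c)"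
  unfolding psd_def by blast

text \<open>
  With \<open>k = \<Sum>w\<in>S. c w * K w\<close> this is \<open>\<parallel>h\<parallel>\<^sup>2 - \<parallel>h - k\<parallel>\<^sup>2\<close>. Its supremum over all \<open>S\<close> and \<open>c\<close> is therefore
  the squared norm of \<open>h\<close>, and it can be formed without knowing the space. This is the reason for
  the definitions below: they give the Hilbert space of a kernel as a set of functions at once,
  with no completion and no quotient.
\<close>

definition dual_value :: "('a \<Rightarrow> 'a \<Rightarrow> complex) \<Rightarrow> 'a set \<Rightarrow> ('a \<Rightarrow> complex) \<Rightarrow> ('a \<Rightarrow> complex) \<Rightarrow> real" where
  "dual_value K S c h = 2 * Re (pair S c h) - Re (quad K S c)"

definition dual_values :: "'a set \<Rightarrow> ('a \<Rightarrow> 'a \<Rightarrow> complex) \<Rightarrow> ('a \<Rightarrow> complex) \<Rightarrow> real set" where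
  "dual_values X K h = {dual_value K S c h | S c. finite S \<and> S \<subseteq> X}"

definition kernel_sq :: "'a set \<Rightarrow> ('a \<Rightarrow> 'a \<Rightarrow> complex) \<Rightarrow> ('a \<Rightarrow> complex) \<Rightarrow> real" where
  "kernel_sq X K h = Sup (dual_values X K h)"

definition kernel_fns :: "'a set \<Rightarrow> ('a \<Rightarrow> 'a \<Rightarrow> complex) \<Rightarrow> ('a \<Rightarrow> complex) set" where
  "kernel_fns X K = {h. fun_on X h \<and> bdd_above (dual_values X K h)}"

lemma dual_value_le_kernel_sq:
  assumes "h \<in> kernel_fns X K" "finite S" "S \<subseteq> X"
  shows "dual_value K S c h \<le> kernel_sq X K h"
  unfolding kernel_sq_def using assms by (intro cSup_upper) (auto simp: dual_values_def kernel_fns_def)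

lemma kernel_fnsI:
  assumes "fun_on X h" "\<And>S c. finite S \<Longrightarrow> S \<subseteq> X \<Longrightarrow> dual_value K S c h \<le> B"
  shows "h \<in> kernel_fns X K" "kernel_sq X K h \<le> B"
proof -
  show "h \<in> kernel_fns X K" using assms by (auto simp: kernel_fns_def dual_values_def intro!: bdd_aboveI[of _ B])
  have "dual_value K {} (\<lambda>_. 0) h \<in> dual_values X K h" unfolding dual_values_def by blast
  then show "kernel_sq X K h \<le> B"
    unfolding kernel_sq_def using assms(2) by (intro cSup_least) (auto simp: dual_values_def)
qed

lemma kernel_sq_ge_0: "h \<in> kernel_fns X K \<Longrightarrow> 0 \<le> kernel_sq X K h"
  using dual_value_le_kernel_sq[of h X K "{}"] by (simp add: dual_value_def pair_def quad_def)

text \<open>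
  Optimize the coefficients over all complex multiples of a given \<open>c\<close>.
\<close>

lemma pair_bound_if_dual_value_bound:
  assumes psd: "psd X K" and S: "finite S" "S \<subseteq> X"
    and bound: "\<And>c. dual_value K S c h \<le> B"
  shows "(cmod (pair S c h))\<^sup>2 \<le> B * Re (quad K S c)"
proof -
  define a q where "a = pair S c h" and "q = Re (quad K S c)"
  have q: "q \<ge> 0" using psd S by (auto simp: psd_def q_def)
  have key: "2 * s * cmod a - s\<^sup>2 * q \<le> B" for s :: real
  proof -
    have "dual_value K S (\<lambda>w. (of_real s * sgn a) * c w) h \<le> B" by (rule bound)
    moreover have sgn_a: "cnj (sgn a) * a = of_real (cmod a)"
    proof (cases "a = 0")
      case False
      have "cnj (sgn a) * a = of_real ((cmod a)\<^sup>2) / of_real (cmod a)"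
        unfolding complex_norm_square by (simp add: sgn_eq mult.commute)
      then show ?thesis using False by (simp add: power2_eq_square)
    qed simp
    have "pair S (\<lambda>w. (of_real s * sgn a) * c w) h = of_real (s * cmod a)"
      unfolding pair_scale a_def[symmetric] by (simp add: sgn_a mult.assoc)
    moreover have "Re (quad K S (\<lambda>w. (of_real s * sgn a) * c w)) \<le> s\<^sup>2 * q"
      unfolding quad_scale using q
      by (cases "a = 0") (auto simp: norm_mult norm_sgn power_mult_distrib q_def)
    ultimately show ?thesis by (simp add: dual_value_def)
  qed
  show ?thesis
  proof (cases "q = 0")
    case True
    have "cmod a = 0"
    proof (rule ccontr)
      assume "cmod a \<noteq> 0"
      then have "B < 2 * ((\<bar>B\<bar> + 1) / (2 * cmod a)) * cmod a" by simp
      with key[of "(\<bar>B\<bar> + 1) / (2 * cmod a)"] True show False by simp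
    qed
    with True show ?thesis by (simp add: a_def q_def)
  next
    case False
    with key[of "cmod a / q"] have "(cmod a)\<^sup>2 / q \<le> B"
      by (simp add: power2_eq_square)
    with False q show ?thesis by (simp add: a_def q_def pos_divide_le_eq)
  qed
qed

locale psd_kernel =
  fixes X :: "'a set" and K :: "'a \<Rightarrow> 'a \<Rightarrow> complex"
  assumes psd: "psd X K" and kernel_fun_on: "\<And>w. w \<in> X \<Longrightarrow> fun_on X (K w)"
begin

lemma dual_value_scale:
  assumes "t \<noteq> 0"
  shows "dual_value K S c (\<lambda>x. t * h x) = (cmod t)\<^sup>2 * dual_value K S (\<lambda>w. inverse t * c w) h"
proof -
  have "pair S c (\<lambda>x. t * h x) = of_real ((cmod t)\<^sup>2) * pair S (\<lambda>w. inverse t * c w) h"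
    unfolding pair_scale complex_norm_square using assms
    by (simp add: pair_def sum_distrib_left field_simps)
  moreover have "quad K S c = of_real ((cmod t)\<^sup>2) * quad K S (\<lambda>w. inverse t * c w)"
  proof -
    have "(\<lambda>w. t * (inverse t * c w)) = c" using assms by (simp add: fun_eq_iff mult.assoc[symmetric])
    then show ?thesis unfolding quad_scale[symmetric] by simp
  qed
  ultimately show ?thesis by (simp add: dual_value_def right_diff_distrib)
qed

lemma kernel_fns_scale:
  assumes "h \<in> kernel_fns X K"
  shows "(\<lambda>x. t * h x) \<in> kernel_fns X K" "kernel_sq X K (\<lambda>x. t * h x) = (cmod t)\<^sup>2 * kernel_sq X K h"
proof -
  have le: "(\<lambda>x. t * h x) \<in> kernel_fns X K \<and> kernel_sq X K (\<lambda>x. t * h x) \<le> (cmod t)\<^sup>2 * kernel_sq X K h"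
    if "h \<in> kernel_fns X K" "t \<noteq> 0" for t h
    using that kernel_fnsI[of X "\<lambda>x. t * h x" K "(cmod t)\<^sup>2 * kernel_sq X K h"]
    by (auto simp: dual_value_scale dual_value_le_kernel_sq kernel_fns_def fun_on_def)
  have zero: "(\<lambda>x. 0) \<in> kernel_fns X K" "kernel_sq X K (\<lambda>x. 0) \<le> 0"
    using kernel_fnsI[of X "\<lambda>x. 0" K 0] psd by (auto simp: dual_value_def pair_def fun_on_def psd_def)
  show 1: "(\<lambda>x. t * h x) \<in> kernel_fns X K"
    using le[OF assms] zero by (cases "t = 0") auto
  show "kernel_sq X K (\<lambda>x. t * h x) = (cmod t)\<^sup>2 * kernel_sq X K h"
  proof (cases "t = 0")
    case True
    then show ?thesis using zero kernel_sq_ge_0[OF zero(1)] by simp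
  next
    case False
    then have "kernel_sq X K (\<lambda>x. inverse t * (t * h x)) \<le> (cmod (inverse t))\<^sup>2 * kernel_sq X K (\<lambda>x. t * h x)"
      using le[OF 1, of "inverse t"] by simp
    moreover have "(\<lambda>x. inverse t * (t * h x)) = h"
      using False by (simp add: fun_eq_iff mult.assoc[symmetric])
    ultimately have "(cmod t)\<^sup>2 * kernel_sq X K h \<le> kernel_sq X K (\<lambda>x. t * h x)"
      using False by (simp add: norm_inverse norm_divide power_divide power_inverse field_simps)
    with le[OF assms False] show ?thesis by simp
  qed
qed

text \<open>
  The change of variables \<open>p = (c + d) / 2\<close>, \<open>q = (c - d) / 2\<close> in the two suprema, combined with the
  parallelogram law for the quadratic form \<open>quad K\<close>.
\<close>

lemma dual_value_add_diff:
  assumes f: "f \<in> kernel_fns X K" and g: "g \<in> kernel_fns X K"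
    and S: "finite S" "S \<subseteq> X" and T: "finite T" "T \<subseteq> X"
  shows "dual_value K S c (\<lambda>x. f x + g x) + dual_value K T d (\<lambda>x. f x - g x) \<le> 2 * kernel_sq X K f + 2 * kernel_sq X K g"
proof -
  define U where "U = S \<union> T"
  define c' where "c' = (\<lambda>w. if w \<in> S then c w else 0)"
  define d' where "d' = (\<lambda>w. if w \<in> T then d w else 0)"
  define p where "p = (\<lambda>w. (c' w + d' w) / 2)"
  define q where "q = (\<lambda>w. (c' w - d' w) / 2)"
  have U: "finite U" "U \<subseteq> X" "S \<subseteq> U" "T \<subseteq> U" using S T by (auto simp: U_def)
  have ext: "dual_value K S c h = dual_value K U c' h" "dual_value K T d h = dual_value K U d' h" for h
    using U by (simp_all add: dual_value_def c'_def d'_def quad_zero_extend pair_zero_extend)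
  have c': "c' = (\<lambda>w. p w + q w)" and d': "d' = (\<lambda>w. p w - q w)"
    by (auto simp: p_def q_def field_simps)
  have "pair U c' (\<lambda>x. f x + g x) + pair U d' (\<lambda>x. f x - g x) = 2 * pair U p f + 2 * pair U q g"
    unfolding c' d' pair_def sum_distrib_left sum.distrib[symmetric]
    by (intro sum.cong refl) (simp add: algebra_simps)
  moreover have "quad K U c' + quad K U d' = 2 * quad K U p + 2 * quad K U q"
    unfolding c' d' by (rule quad_parallelogram)
  ultimately have "dual_value K U c' (\<lambda>x. f x + g x) + dual_value K U d' (\<lambda>x. f x - g x)
       = 2 * dual_value K U p f + 2 * dual_value K U q g"
    by (simp add: dual_value_def complex_eq_iff)
  with dual_value_le_kernel_sq[OF f U(1,2), of p] dual_value_le_kernel_sq[OF g U(1,2), of q]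
  show ?thesis by (simp add: ext)
qed

lemma kernel_fns_add:
  assumes "f \<in> kernel_fns X K" "g \<in> kernel_fns X K"
  shows "(\<lambda>x. f x + g x) \<in> kernel_fns X K"
proof (rule kernel_fnsI)
  show "fun_on X (\<lambda>x. f x + g x)" using assms by (auto simp: kernel_fns_def fun_on_def)
  show "dual_value K S c (\<lambda>x. f x + g x) \<le> 2 * kernel_sq X K f + 2 * kernel_sq X K g" if "finite S" "S \<subseteq> X" for S c
    using dual_value_add_diff[OF assms that, of "{}" c c] by (simp add: dual_value_def pair_def quad_def)
qed

lemma kernel_fns_diff:
  assumes "f \<in> kernel_fns X K" "g \<in> kernel_fns X K"
  shows "(\<lambda>x. f x - g x) \<in> kernel_fns X K"
  using kernel_fns_add[OF assms(1) kernel_fns_scale(1)[OF assms(2), of "-1"]] by simp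

lemma kernel_sq_add_diff_le:
  assumes f: "f \<in> kernel_fns X K" and g: "g \<in> kernel_fns X K"
  shows "kernel_sq X K (\<lambda>x. f x + g x) + kernel_sq X K (\<lambda>x. f x - g x) \<le> 2 * kernel_sq X K f + 2 * kernel_sq X K g"
proof -
  have "kernel_sq X K (\<lambda>x. f x + g x) \<le> 2 * kernel_sq X K f + 2 * kernel_sq X K g - kernel_sq X K (\<lambda>x. f x - g x)"
  proof (rule kernel_fnsI(2))
    fix S :: "'a set" and c assume S: "finite S" "S \<subseteq> X"
    have "kernel_sq X K (\<lambda>x. f x - g x) \<le> 2 * kernel_sq X K f + 2 * kernel_sq X K g - dual_value K S c (\<lambda>x. f x + g x)"
    proof (rule kernel_fnsI(2))
      fix T :: "'a set" and d assume T: "finite T" "T \<subseteq> X"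
      show "dual_value K T d (\<lambda>x. f x - g x) \<le> 2 * kernel_sq X K f + 2 * kernel_sq X K g - dual_value K S c (\<lambda>x. f x + g x)"
        using dual_value_add_diff[OF f g S T, of c d] by simp
    qed (use kernel_fns_diff[OF f g] in \<open>simp add: kernel_fns_def\<close>)
    then show "dual_value K S c (\<lambda>x. f x + g x) \<le> 2 * kernel_sq X K f + 2 * kernel_sq X K g - kernel_sq X K (\<lambda>x. f x - g x)"
      by simp
  qed (use kernel_fns_add[OF f g] in \<open>simp add: kernel_fns_def\<close>)
  then show ?thesis by simp
qed

text \<open>
  One inequality is \<open>kernel_sq_add_diff_le\<close>; the other is the same inequality for \<open>f + g\<close> and \<open>f - g\<close>.
\<close>

lemma kernel_sq_parallelogram:
  assumes f: "f \<in> kernel_fns X K" and g: "g \<in> kernel_fns X K"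
  shows "kernel_sq X K (\<lambda>x. f x + g x) + kernel_sq X K (\<lambda>x. f x - g x) = 2 * kernel_sq X K f + 2 * kernel_sq X K g"
proof (rule antisym[OF kernel_sq_add_diff_le[OF f g]])
  have "kernel_sq X K (\<lambda>x. 2 * f x) + kernel_sq X K (\<lambda>x. 2 * g x)
        \<le> 2 * kernel_sq X K (\<lambda>x. f x + g x) + 2 * kernel_sq X K (\<lambda>x. f x - g x)"
    using kernel_sq_add_diff_le[OF kernel_fns_add[OF f g] kernel_fns_diff[OF f g]] by (simp add: algebra_simps)
  then show "2 * kernel_sq X K f + 2 * kernel_sq X K g \<le> kernel_sq X K (\<lambda>x. f x + g x) + kernel_sq X K (\<lambda>x. f x - g x)"
    using kernel_fns_scale(2)[OF f, of 2] kernel_fns_scale(2)[OF g, of 2] by simp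
qed

lemma zero_kernel_fns: "(\<lambda>x. 0) \<in> kernel_fns X K" "kernel_sq X K (\<lambda>x. 0) = 0"
proof -
  show "(\<lambda>x. 0) \<in> kernel_fns X K"
    using kernel_fnsI(1)[of X "\<lambda>x. 0" K 0] psd by (auto simp: dual_value_def pair_def fun_on_def psd_def)
  then show "kernel_sq X K (\<lambda>x. 0) = 0" using kernel_fns_scale(2)[of "\<lambda>x. 0" 0] by simp
qed

text \<open>
  Completing the square: adding \<open>t * K w\<close> to \<open>h\<close> has the effect of lowering the coefficient at \<open>w\<close>
  by \<open>t\<close>.
\<close>

lemma dual_value_add_kernel:
  assumes S: "finite S" "S \<subseteq> X" and w: "w \<in> X"
  obtains T d where "finite T" "T \<subseteq> X"
    "dual_value K S c (\<lambda>x. h x + t * K w x) = dual_value K T d h + 2 * Re (cnj t * h w) + (cmod t)\<^sup>2 * Re (K w w)"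
proof
  define T where "T = insert w S"
  define c' where "c' = (\<lambda>x. if x \<in> S then c x else 0)"
  define e where "e = (\<lambda>x. if x = w then t else 0)"
  define d where "d = (\<lambda>x. c' x - e x)"
  show T: "finite T" "T \<subseteq> X" using S w by (auto simp: T_def)
  have wT: "w \<in> T" by (simp add: T_def)
  have ext: "dual_value K S c h = dual_value K T c' h" for h
    using T S by (simp add: dual_value_def c'_def quad_zero_extend pair_zero_extend T_def subset_insertI)
  define p where "p = pair T c' (K w)"
  have pair1: "pair T c' (\<lambda>x. h x + t * K w x) = pair T c' h + t * p"
    by (simp add: p_def pair_def distrib_left sum.distrib sum_distrib_left mult_ac)
  have "pair T d h = pair T c' h - (\<Sum>x\<in>T. cnj (e x) * h x)"
    by (simp add: pair_def d_def left_diff_distrib sum_subtractf)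
  also have "(\<Sum>x\<in>T. cnj (e x) * h x) = (\<Sum>x\<in>T. if x = w then cnj t * h w else 0)"
    by (intro sum.cong) (auto simp: e_def)
  also have "\<dots> = cnj t * h w" using T wT by simp
  finally have pair2: "pair T d h = pair T c' h - cnj t * h w" .
  have "quad K T d = quad K T c' - (\<Sum>x\<in>T. \<Sum>y\<in>T. c' x * cnj (e y) * K x y)
      - (\<Sum>x\<in>T. \<Sum>y\<in>T. e x * cnj (c' y) * K x y) + (\<Sum>x\<in>T. \<Sum>y\<in>T. e x * cnj (e y) * K x y)"
    unfolding quad_def sum_subtractf[symmetric] sum.distrib[symmetric]
    by (intro sum.cong refl) (simp add: d_def algebra_simps)
  also have "(\<Sum>x\<in>T. \<Sum>y\<in>T. c' x * cnj (e y) * K x y) = (\<Sum>x\<in>T. \<Sum>y\<in>T. if y = w then c' x * cnj t * K x w else 0)"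
    by (intro sum.cong refl) (auto simp: e_def)
  also have "\<dots> = (\<Sum>x\<in>T. c' x * cnj t * K x w)" using T wT by simp
  also have "\<dots> = (\<Sum>x\<in>T. c' x * cnj t * cnj (K w x))"
    using T w by (intro sum.cong refl) (simp add: psd_cnj[OF psd] subset_iff)
  also have "\<dots> = cnj (t * p)"
    by (simp add: p_def pair_def sum_distrib_left mult_ac)
  also have "(\<Sum>x\<in>T. \<Sum>y\<in>T. e x * cnj (c' y) * K x y) = (\<Sum>x\<in>T. if x = w then (\<Sum>y\<in>T. t * cnj (c' y) * K w y) else 0)"
    by (intro sum.cong refl) (auto simp: e_def)
  also have "\<dots> = t * p" using T wT by (simp add: p_def pair_def sum_distrib_left mult_ac)
  also have "(\<Sum>x\<in>T. \<Sum>y\<in>T. e x * cnj (e y) * K x y) = (\<Sum>x\<in>T. if x = w then (\<Sum>y\<in>T. if y = w then t * cnj t * K w w else 0) else 0)"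
    by (intro sum.cong refl) (auto simp: e_def intro!: sum.cong)
  also have "\<dots> = of_real ((cmod t)\<^sup>2) * K w w"
    unfolding complex_norm_square using T wT by simp
  finally have "Re (quad K T d) = Re (quad K T c') - 2 * Re (t * p) + (cmod t)\<^sup>2 * Re (K w w)"
    by (simp flip: of_real_power)
  then show "dual_value K S c (\<lambda>x. h x + t * K w x)
      = dual_value K T d h + 2 * Re (cnj t * h w) + (cmod t)\<^sup>2 * Re (K w w)"
    unfolding ext by (simp add: dual_value_def pair1 pair2)
qed

text \<open>
  This formula contains the reproducing property, by polarization.
\<close>

lemma kernel_fns_add_kernel:
  assumes h: "h \<in> kernel_fns X K" and w: "w \<in> X"
  shows "(\<lambda>x. h x + t * K w x) \<in> kernel_fns X K"
    and "kernel_sq X K (\<lambda>x. h x + t * K w x) = kernel_sq X K h + 2 * Re (cnj t * h w) + (cmod t)\<^sup>2 * Re (K w w)"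
proof -
  have le: "(\<lambda>x. h x + t * K w x) \<in> kernel_fns X K \<and>
    kernel_sq X K (\<lambda>x. h x + t * K w x) \<le> kernel_sq X K h + 2 * Re (cnj t * h w) + (cmod t)\<^sup>2 * Re (K w w)"
    if h: "h \<in> kernel_fns X K" for h t
  proof -
    have a: "fun_on X (\<lambda>x. h x + t * K w x)"
      using h kernel_fun_on[OF w] by (auto simp: kernel_fns_def fun_on_def)
    have b: "dual_value K S c (\<lambda>x. h x + t * K w x) \<le> kernel_sq X K h + 2 * Re (cnj t * h w) + (cmod t)\<^sup>2 * Re (K w w)"
      if S: "finite S" "S \<subseteq> X" for S c
      using dual_value_add_kernel[OF S w, of c h t] dual_value_le_kernel_sq[OF h]
      by (metis (no_types, lifting) add_le_cancel_right)
    show ?thesis using kernel_fnsI[OF a b] by blast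
  qed
  show mem: "(\<lambda>x. h x + t * K w x) \<in> kernel_fns X K" using le[OF h] by blast
  have "(\<lambda>x. (h x + t * K w x) + (- t) * K w x) = h" by (simp add: fun_eq_iff)
  with le[OF mem, of "-t"]
  have "kernel_sq X K h \<le> kernel_sq X K (\<lambda>x. h x + t * K w x) - 2 * Re (cnj t * (h w + t * K w w)) + (cmod t)\<^sup>2 * Re (K w w)"
    by simp
  moreover have "cnj t * (h w + t * K w w) = cnj t * h w + of_real ((cmod t)\<^sup>2) * K w w"
    unfolding complex_norm_square by (simp add: algebra_simps)
  then have "Re (cnj t * (h w + t * K w w)) = Re (cnj t * h w) + (cmod t)\<^sup>2 * Re (K w w)"
    by (simp del: of_real_power)
  ultimately show "kernel_sq X K (\<lambda>x. h x + t * K w x) = kernel_sq X K h + 2 * Re (cnj t * h w) + (cmod t)\<^sup>2 * Re (K w w)"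
    using le[OF h, of t] by simp
qed

lemma kernel_kernel_fns: "w \<in> X \<Longrightarrow> K w \<in> kernel_fns X K"
  using kernel_fns_add_kernel(1)[OF zero_kernel_fns(1), of w 1] by simp

lemma kernel_sq_eval_bound:
  assumes "h \<in> kernel_fns X K" "w \<in> X"
  shows "(cmod (h w))\<^sup>2 \<le> kernel_sq X K h * Re (K w w)"
  using pair_bound_if_dual_value_bound[OF psd, of "{w}" h "kernel_sq X K h" "\<lambda>_. 1"] dual_value_le_kernel_sq[OF assms(1)] assms(2)
  by (simp add: pair_def quad_def)

definition model :: "'a fun_space" where
  "model = \<lparr>fns = kernel_fns X K,
     ip = (\<lambda>h k. if h \<in> kernel_fns X K \<and> k \<in> kernel_fns X K then polarization (kernel_sq X K) h k else 0)\<rparr>"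

lemma fns_model: "fns model = kernel_fns X K"
  by (simp add: model_def)

lemmas model_JvN = Jordan_von_Neumann[of "kernel_fns X K" "kernel_sq X K",
    OF zero_kernel_fns(1) kernel_fns_add kernel_fns_scale(1) kernel_sq_parallelogram kernel_fns_scale(2) kernel_sq_ge_0]

lemma ip_model: "h \<in> kernel_fns X K \<Longrightarrow> k \<in> kernel_fns X K \<Longrightarrow> ip model h k = polarization (kernel_sq X K) h k"
  by (simp add: model_def)

lemma nrm_model: "h \<in> kernel_fns X K \<Longrightarrow> (nrm model h)\<^sup>2 = kernel_sq X K h"
  by (simp add: nrm_def ip_model model_JvN(4) kernel_sq_ge_0)

lemma inner_product_model: "inner_product_fun_space X model"
proof -
  have "kernel_sq X K h > 0" if h: "h \<in> kernel_fns X K" and "h \<noteq> (\<lambda>x. 0)" for h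
  proof (rule ccontr)
    assume "\<not> kernel_sq X K h > 0"
    then have "kernel_sq X K h = 0" using kernel_sq_ge_0[OF h] by simp
    then have "h w = 0" for w
      using kernel_sq_eval_bound[OF h, of w] h by (cases "w \<in> X") (auto simp: kernel_fns_def fun_on_def)
    with \<open>h \<noteq> (\<lambda>x. 0)\<close> show False by blast
  qed
  then show ?thesis
    unfolding inner_product_fun_space_def fns_model
    apply (intro conjI allI ballI impI)
    subgoal by (simp add: kernel_fns_def)
    subgoal by (rule zero_kernel_fns)
    subgoal by (rule kernel_fns_add)
    subgoal by (rule kernel_fns_scale)
    subgoal by (simp add: ip_model kernel_fns_add model_JvN(1))
    subgoal by (simp add: ip_model kernel_fns_scale(1) model_JvN(2))
    subgoal by (simp only: ip_model) (rule model_JvN(3))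
    subgoal by (simp add: ip_model model_JvN(4))
    done
qed

text \<open>
  A Cauchy sequence converges pointwise, and bounds on the norm pass to pointwise limits because
  the norm is a supremum of functions of finitely many values.
\<close>

lemma complete_model: "complete_fun_space model"
  unfolding complete_fun_space_def fns_model
proof (intro allI impI, elim conjE)
  fix s :: "nat \<Rightarrow> 'a \<Rightarrow> complex"
  assume "\<forall>n. s n \<in> kernel_fns X K"
    and C: "\<forall>e>0. \<exists>N. \<forall>m\<ge>N. \<forall>n\<ge>N. nrm model (\<lambda>x. s m x - s n x) < e"
  then have s: "s n \<in> kernel_fns X K" for n by blast
  interpret M: inner_fun_space X model by unfold_locales (rule inner_product_model)
  have small: "\<exists>N. \<forall>m\<ge>N. \<forall>n\<ge>N. kernel_sq X K (\<lambda>x. s m x - s n x) \<le> e\<^sup>2" if "e > 0" for e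
  proof -
    from C that obtain N where N: "\<forall>m\<ge>N. \<forall>n\<ge>N. nrm model (\<lambda>x. s m x - s n x) < e" by blast
    have "kernel_sq X K (\<lambda>x. s m x - s n x) \<le> e\<^sup>2" if "m \<ge> N" "n \<ge> N" for m n
      unfolding nrm_model[OF kernel_fns_diff[OF s s], symmetric]
      using N that by (intro power_mono) (auto simp: less_imp_le M.nrm_ge_0 fns_model kernel_fns_diff s)
    then show ?thesis by blast
  qed
  have "\<exists>l. (\<lambda>n. s n w) \<longlonglongrightarrow> l" if w: "w \<in> X" for w
  proof -
    have "Cauchy (\<lambda>n. s n w)"
    proof (rule CauchyI)
      fix e :: real assume e: "e > 0"
      define M where "M = Re (K w w) + 1"
      have K0: "Re (K w w) \<ge> 0"
        using psd_quad_ge_0[OF psd, of "{w}" "\<lambda>_. 1"] w by (simp add: quad_def)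
      then have M: "M > 0" by (simp add: M_def)
      obtain N where N: "\<And>m n. m \<ge> N \<Longrightarrow> n \<ge> N \<Longrightarrow> kernel_sq X K (\<lambda>x. s m x - s n x) \<le> (e / sqrt M / 2)\<^sup>2"
        using small[of "e / sqrt M / 2"] e M by auto
      have "cmod (s m w - s n w) < e" if "m \<ge> N" "n \<ge> N" for m n
      proof -
        have "(cmod (s m w - s n w))\<^sup>2 \<le> kernel_sq X K (\<lambda>x. s m x - s n x) * Re (K w w)"
          by (rule kernel_sq_eval_bound[OF kernel_fns_diff[OF s s] w])
        also have "\<dots> \<le> (e / sqrt M / 2)\<^sup>2 * M"
          using N[OF that] K0 by (intro mult_mono) (auto simp: M_def)
        also have "\<dots> = (e / 2)\<^sup>2" using M by (simp add: power_divide)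
        finally have "cmod (s m w - s n w) \<le> e / 2" by (rule power2_le_imp_le) (use e in simp)
        with e show ?thesis by simp
      qed
      then show "\<exists>N. \<forall>m\<ge>N. \<forall>n\<ge>N. cmod (s m w - s n w) < e" by blast
    qed
    then show ?thesis by (simp add: Cauchy_convergent_iff convergent_def)
  qed
  then obtain l where l: "\<And>w. w \<in> X \<Longrightarrow> (\<lambda>n. s n w) \<longlonglongrightarrow> l w" by metis
  define h where "h w = (if w \<in> X then l w else 0)" for w
  have h_lim: "(\<lambda>n. s n w) \<longlonglongrightarrow> h w" if "w \<in> X" for w using l that by (simp add: h_def)
  have h: "fun_on X h" by (simp add: fun_on_def h_def)
  have lim: "(\<lambda>x. s n x - h x) \<in> kernel_fns X K \<and> kernel_sq X K (\<lambda>x. s n x - h x) \<le> B"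
    if B: "\<And>m. m \<ge> N \<Longrightarrow> kernel_sq X K (\<lambda>x. s n x - s m x) \<le> B" for n N B
  proof -
    have a: "fun_on X (\<lambda>x. s n x - h x)" using s[of n] h by (auto simp: kernel_fns_def fun_on_def)
    have b: "dual_value K S c (\<lambda>x. s n x - h x) \<le> B" if S: "finite S" "S \<subseteq> X" for S c
    proof (rule Lim_bounded)
      show "(\<lambda>m. dual_value K S c (\<lambda>x. s n x - s m x)) \<longlonglongrightarrow> dual_value K S c (\<lambda>x. s n x - h x)"
        unfolding dual_value_def pair_def using S by (intro tendsto_intros h_lim) auto
      show "\<forall>m\<ge>N. dual_value K S c (\<lambda>x. s n x - s m x) \<le> B"
        using dual_value_le_kernel_sq[OF kernel_fns_diff[OF s s] S] B by (meson order_trans)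
    qed
    show ?thesis using kernel_fnsI[OF a b] by blast
  qed
  have small_lim: "\<exists>N. \<forall>n\<ge>N. (\<lambda>x. s n x - h x) \<in> kernel_fns X K \<and> kernel_sq X K (\<lambda>x. s n x - h x) \<le> e\<^sup>2" if e0: "e > 0" for e
  proof -
    obtain N where N: "\<And>m n. m \<ge> N \<Longrightarrow> n \<ge> N \<Longrightarrow> kernel_sq X K (\<lambda>x. s m x - s n x) \<le> e\<^sup>2"
      using small[OF e0] by blast
    show ?thesis using lim[of N, OF N] by blast
  qed
  obtain n where n: "(\<lambda>x. s n x - h x) \<in> kernel_fns X K" using small_lim[of 1] by auto
  have hk: "h \<in> kernel_fns X K" using kernel_fns_diff[OF s n, of n] by simp
  have "(\<lambda>n. nrm model (\<lambda>x. s n x - h x)) \<longlonglongrightarrow> 0"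
  proof (rule LIMSEQ_I)
    fix e :: real assume e: "e > 0"
    obtain N where N: "\<And>n. n \<ge> N \<Longrightarrow> kernel_sq X K (\<lambda>x. s n x - h x) \<le> (e / 2)\<^sup>2"
      using small_lim[of "e / 2"] e by auto
    have "norm (nrm model (\<lambda>x. s n x - h x) - 0) < e" if "n \<ge> N" for n
    proof -
      have "(nrm model (\<lambda>x. s n x - h x))\<^sup>2 \<le> (e / 2)\<^sup>2"
        using N[OF that] by (simp add: nrm_model kernel_fns_diff s hk)
      then have "nrm model (\<lambda>x. s n x - h x) \<le> e / 2" by (rule power2_le_imp_le) (use e in simp)
      moreover have "0 \<le> nrm model (\<lambda>x. s n x - h x)"
        by (intro M.nrm_ge_0) (simp add: fns_model kernel_fns_diff s hk)
      ultimately show ?thesis using e by simp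
    qed
    then show "\<exists>N. \<forall>n\<ge>N. norm (nrm model (\<lambda>x. s n x - h x) - 0) < e" by blast
  qed
  with hk show "\<exists>h\<in>kernel_fns X K. (\<lambda>n. nrm model (\<lambda>x. s n x - h x)) \<longlonglongrightarrow> 0" by blast
qed

lemma model_reproducing:
  assumes h: "h \<in> kernel_fns X K" and w: "w \<in> X"
  shows "ip model h (K w) = h w"
proof -
  have r: "(kernel_sq X K (\<lambda>x. h x + t * K w x) - kernel_sq X K (\<lambda>x. h x - t * K w x)) / 4 = Re (cnj t * h w)" for t
    using kernel_fns_add_kernel(2)[OF h w, of t] kernel_fns_add_kernel(2)[OF h w, of "-t"] by simp
  from r[of 1] r[of \<i>] show ?thesis
    by (simp add: ip_model[OF h kernel_kernel_fns[OF w]] polarization_def Let_def complex_eq_iff)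
qed

lemma is_rkhs_model: "is_rkhs X K model"
  unfolding is_rkhs_def
  using inner_product_model complete_model kernel_kernel_fns model_reproducing
  by (auto simp: fns_model) (auto simp: model_def)

end

section \<open>Density of the kernel functions and uniqueness\<close>

definition comb :: "('a \<Rightarrow> 'a \<Rightarrow> complex) \<Rightarrow> 'a set \<Rightarrow> ('a \<Rightarrow> complex) \<Rightarrow> 'a \<Rightarrow> complex" where
  "comb K S c = (\<lambda>z. \<Sum>w\<in>S. c w * K w z)"

lemma comb_zero_extend:
  assumes "finite T" "S \<subseteq> T"
  shows "comb K T (\<lambda>w. if w \<in> S then c w else 0) = comb K S c"
proof
  fix z
  have "comb K T (\<lambda>w. if w \<in> S then c w else 0) z = (\<Sum>w\<in>T. if w \<in> S then c w * K w z else 0)"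
    unfolding comb_def by (intro sum.cong) auto
  with sum_zero_extend[OF assms] show "comb K T (\<lambda>w. if w \<in> S then c w else 0) z = comb K S c z"
    by (simp add: comb_def)
qed

definition combs :: "'a set \<Rightarrow> ('a \<Rightarrow> 'a \<Rightarrow> complex) \<Rightarrow> ('a \<Rightarrow> complex) set" where
  "combs X K = {comb K S c | S c. finite S \<and> S \<subseteq> X}"

lemma combsI: "finite S \<Longrightarrow> S \<subseteq> X \<Longrightarrow> comb K S c \<in> combs X K"
  by (auto simp: combs_def)

lemma combs_add:
  assumes "h \<in> combs X K" "k \<in> combs X K"
  shows "(\<lambda>x. h x + k x) \<in> combs X K"
proof -
  from assms obtain S c T d where h: "h = comb K S c" and k: "k = comb K T d"
    and fin: "finite S" "S \<subseteq> X" "finite T" "T \<subseteq> X" by (auto simp: combs_def)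
  let ?c = "\<lambda>w. (if w \<in> S then c w else 0) + (if w \<in> T then d w else 0)"
  have "(\<lambda>x. h x + k x) = comb K (S \<union> T) ?c"
    using fin comb_zero_extend[of "S \<union> T" S K c] comb_zero_extend[of "S \<union> T" T K d]
    by (simp add: h k fun_eq_iff comb_def distrib_right sum.distrib)
  then show ?thesis using fin by (auto intro: combsI)
qed

lemma combs_scale:
  assumes "h \<in> combs X K"
  shows "(\<lambda>x. t * h x) \<in> combs X K"
proof -
  from assms obtain S c where h: "h = comb K S c" "finite S" "S \<subseteq> X" by (auto simp: combs_def)
  then have "(\<lambda>x. t * h x) = comb K S (\<lambda>w. t * c w)"
    by (simp add: comb_def sum_distrib_left mult.assoc)
  then show ?thesis using h by (auto intro: combsI)
qed

locale rkhs_space =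
  fixes X :: "'a set" and K :: "'a \<Rightarrow> 'a \<Rightarrow> complex" and H :: "'a fun_space"
  assumes is_rkhs: "is_rkhs X K H"

sublocale rkhs_space \<subseteq> inner_fun_space X H
  by unfold_locales (use is_rkhs in \<open>simp add: is_rkhs_def\<close>)

context rkhs_space
begin

lemma kernel_mem: "w \<in> X \<Longrightarrow> K w \<in> fns H"
  using is_rkhs by (simp add: is_rkhs_def)

lemma reproducing: "h \<in> fns H \<Longrightarrow> w \<in> X \<Longrightarrow> ip H h (K w) = h w"
  using is_rkhs by (simp add: is_rkhs_def)

lemma ip_junk: "h \<notin> fns H \<or> k \<notin> fns H \<Longrightarrow> ip H h k = 0"
  using is_rkhs by (simp add: is_rkhs_def)

lemma Cauchy_limit:
  assumes "\<And>n. s n \<in> fns H"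
    and "\<And>e. e > 0 \<Longrightarrow> \<exists>N. \<forall>m\<ge>N. \<forall>n\<ge>N. nrm H (\<lambda>x. s m x - s n x) < e"
  shows "\<exists>h\<in>fns H. (\<lambda>n. nrm H (\<lambda>x. s n x - h x)) \<longlonglongrightarrow> 0"
  using is_rkhs assms unfolding is_rkhs_def complete_fun_space_def by blast

lemma comb_mem: "S \<subseteq> X \<Longrightarrow> comb K S c \<in> fns H"
  unfolding comb_def by (rule sum_mem) (auto simp: kernel_mem)

lemma combs_mem: "h \<in> combs X K \<Longrightarrow> h \<in> fns H"
  by (auto simp: combs_def comb_mem)

lemma ip_comb: "h \<in> fns H \<Longrightarrow> S \<subseteq> X \<Longrightarrow> ip H h (comb K S c) = pair S c h"
  unfolding comb_def pair_def
  by (subst ip_sum_right) (auto simp: kernel_mem reproducing subset_iff intro!: sum.cong)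

lemma ip_comb_comb:
  assumes "S \<subseteq> X"
  shows "ip H (comb K S c) (comb K S c) = quad K S c"
proof -
  have "ip H (comb K S c) (comb K S c) = (\<Sum>w\<in>S. \<Sum>v\<in>S. c v * cnj (c w) * K v w)"
    using assms by (simp add: ip_comb comb_mem) (simp add: pair_def comb_def sum_distrib_left mult_ac)
  also have "\<dots> = quad K S c" unfolding quad_def by (rule sum.swap)
  finally show ?thesis .
qed

lemma nrm_comb: "S \<subseteq> X \<Longrightarrow> (nrm H (comb K S c))\<^sup>2 = Re (quad K S c)"
  by (simp add: nrm_power2 comb_mem ip_comb_comb)

lemma psd_kernel: "psd_kernel X K"
proof
  show "fun_on X (K w)" if "w \<in> X" for w using fns_fun_on kernel_mem that by blast
  have "K v w = cnj (K w v)" if "w \<in> X" "v \<in> X" for w v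
    using ip_cnj[OF kernel_mem kernel_mem, of w v] that by (simp add: reproducing kernel_mem)
  moreover have "0 \<le> Re (quad K S c)" if "S \<subseteq> X" for S c
    using nrm_comb[OF that, of c] zero_le_power2[of "nrm H (comb K S c)"] by simp
  ultimately show "psd X K" unfolding psd_def by blast
qed

lemma eval_bound: "h \<in> fns H \<Longrightarrow> w \<in> X \<Longrightarrow> cmod (h w) \<le> nrm H h * nrm H (K w)"
  using Cauchy_Schwarz[of h "K w"] by (simp add: reproducing kernel_mem)

lemma tendsto_pointwise:
  assumes "\<And>n. s n \<in> fns H" "h \<in> fns H" "(\<lambda>n. nrm H (\<lambda>x. s n x - h x)) \<longlonglongrightarrow> 0"
  shows "(\<lambda>n. s n w) \<longlonglongrightarrow> h w"
proof (cases "w \<in> X")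
  case True
  have "(\<lambda>n. s n w - h w) \<longlonglongrightarrow> 0"
  proof (rule Lim_null_comparison)
    show "\<forall>\<^sub>F n in sequentially. norm (s n w - h w) \<le> nrm H (\<lambda>x. s n x - h x) * nrm H (K w)"
      using eval_bound[OF diff_mem[OF assms(1,2)] True] by simp
    show "(\<lambda>n. nrm H (\<lambda>x. s n x - h x) * nrm H (K w)) \<longlonglongrightarrow> 0"
      using tendsto_mult_left_zero[OF assms(3)] .
  qed
  then show ?thesis by (simp add: LIM_zero_iff)
next
  case False
  then have "s n w = 0" "h w = 0" for n
    using fns_fun_on[OF assms(1)] fns_fun_on[OF assms(2)] by (auto simp: fun_on_def)
  then show ?thesis by simp
qed

lemma tendsto_nrm:
  assumes "\<And>n. s n \<in> fns H" "h \<in> fns H" "(\<lambda>n. nrm H (\<lambda>x. s n x - h x)) \<longlonglongrightarrow> 0"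
  shows "(\<lambda>n. nrm H (s n)) \<longlonglongrightarrow> nrm H h"
proof -
  have "(\<lambda>n. nrm H (s n) - nrm H h) \<longlonglongrightarrow> 0"
    by (rule Lim_null_comparison[OF _ assms(3)]) (use nrm_abs_diff assms in auto)
  then show ?thesis by (simp add: LIM_zero_iff)
qed

lemma convergent_imp_Cauchy:
  assumes "\<And>n. s n \<in> fns H" "h \<in> fns H" "(\<lambda>n. nrm H (\<lambda>x. s n x - h x)) \<longlonglongrightarrow> 0" "e > 0"
  shows "\<exists>N. \<forall>m\<ge>N. \<forall>n\<ge>N. nrm H (\<lambda>x. s m x - s n x) < e"
proof -
  from LIMSEQ_D[OF assms(3), of "e/2"] assms(4) obtain N
    where N: "\<And>n. n \<ge> N \<Longrightarrow> nrm H (\<lambda>x. s n x - h x) < e / 2" by fastforce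
  have "nrm H (\<lambda>x. s m x - s n x) < e" if "m \<ge> N" "n \<ge> N" for m n
    using nrm_triangle_diff[OF assms(1,2,1), of m n] N[OF that(1)] N[OF that(2)]
      nrm_minus_commute[OF assms(2,1), of n] by simp
  then show ?thesis by blast
qed

text \<open>
  A minimizing sequence for the distance to \<open>P\<close> is Cauchy by the parallelogram law. Its limit \<open>p\<close> need
  not lie in \<open>P\<close>, only in its closure.
\<close>

lemma projection:
  assumes P: "P \<subseteq> fns H" and zero: "(\<lambda>x. 0) \<in> P"
    and P_add: "\<And>p q. p \<in> P \<Longrightarrow> q \<in> P \<Longrightarrow> (\<lambda>x. p x + q x) \<in> P"
    and P_scale: "\<And>c p. p \<in> P \<Longrightarrow> (\<lambda>x. c * p x) \<in> P"
    and h: "h \<in> fns H"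
  shows "\<exists>p s. p \<in> fns H \<and> (\<forall>n::nat. s n \<in> P) \<and> (\<lambda>n. nrm H (\<lambda>x. s n x - p x)) \<longlonglongrightarrow> 0 \<and>
    (\<forall>q\<in>P. ip H (\<lambda>x. h x - p x) q = 0)"
proof -
  define D where "D = (\<lambda>p. nrm H (\<lambda>x. h x - p x)) ` P"
  define \<delta> where "\<delta> = Inf D"
  have PD: "p \<in> fns H" if "p \<in> P" for p using P that by blast
  have D0: "D \<noteq> {}" using zero by (auto simp: D_def)
  have D_ge: "0 \<le> d" if "d \<in> D" for d using that by (auto simp: D_def nrm_ge_0 diff_mem h PD)
  have \<delta>_le: "\<delta> \<le> nrm H (\<lambda>x. h x - p x)" if "p \<in> P" for p
    unfolding \<delta>_def using that D_ge by (intro cInf_lower) (auto simp: D_def intro!: bdd_belowI[of _ 0])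
  have \<delta>_ge: "\<delta> \<ge> 0" unfolding \<delta>_def using D0 D_ge by (intro cInf_greatest)
  have "\<exists>p\<in>P. nrm H (\<lambda>x. h x - p x) < \<delta> + 1 / real (Suc n)" for n
  proof -
    have "\<exists>d\<in>D. d < \<delta> + 1 / real (Suc n)"
      using D0 D_ge by (subst cInf_less_iff[symmetric]) (auto simp: \<delta>_def intro!: bdd_belowI[of _ 0])
    then show ?thesis by (auto simp: D_def)
  qed
  then obtain s where sP: "\<And>n. s n \<in> P"
    and s_le: "\<And>n. nrm H (\<lambda>x. h x - s n x) < \<delta> + 1 / real (Suc n)" by metis
  note s = PD[OF sP]
  have close: "(nrm H (\<lambda>x. s m x - s n x))\<^sup>2 \<le> 8 * \<delta> * (1 / real (Suc N)) + 4 * (1 / real (Suc N))\<^sup>2"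
    if "m \<ge> N" "n \<ge> N" for m n N
  proof -
    define r where "r = 1 / real (Suc N)"
    have r: "r \<ge> 0" by (simp add: r_def)
    have le: "(nrm H (\<lambda>x. h x - s k x))\<^sup>2 \<le> (\<delta> + r)\<^sup>2" if "k \<ge> N" for k
    proof (rule power_mono)
      have "1 / real (Suc k) \<le> r" using that unfolding r_def by (intro divide_left_mono) auto
      then show "nrm H (\<lambda>x. h x - s k x) \<le> \<delta> + r" using s_le[of k] by simp
    qed (simp add: nrm_ge_0 diff_mem h s)
    \<comment> \<open>The midpoint of \<open>s m\<close> and \<open>s n\<close> is at distance at least \<open>\<delta>\<close> from \<open>h\<close>.\<close>
    define p where "p = (\<lambda>x. (1/2) * (s m x + s n x))"
    have p: "p \<in> P" unfolding p_def by (intro P_scale P_add sP)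
    have "(\<lambda>x. (h x - s m x) + (h x - s n x)) = (\<lambda>x. 2 * (h x - p x))"
      by (simp add: p_def fun_eq_iff field_simps)
    moreover have "(\<lambda>x. (h x - s m x) - (h x - s n x)) = (\<lambda>x. s n x - s m x)"
      by (simp add: fun_eq_iff)
    ultimately have "(2 * nrm H (\<lambda>x. h x - p x))\<^sup>2 + (nrm H (\<lambda>x. s m x - s n x))\<^sup>2
        = 2 * (nrm H (\<lambda>x. h x - s m x))\<^sup>2 + 2 * (nrm H (\<lambda>x. h x - s n x))\<^sup>2"
      using parallelogram[OF diff_mem[OF h s] diff_mem[OF h s], of m n]
        nrm_scale[OF diff_mem[OF h PD[OF p]], of 2] nrm_minus_commute[OF s s, of m n] by simp
    moreover have "(2 * \<delta>)\<^sup>2 \<le> (2 * nrm H (\<lambda>x. h x - p x))\<^sup>2"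
      using \<delta>_le[OF p] \<delta>_ge by (intro power_mono) auto
    ultimately have "(nrm H (\<lambda>x. s m x - s n x))\<^sup>2 \<le> 4 * (\<delta> + r)\<^sup>2 - (2 * \<delta>)\<^sup>2"
      using le[OF that(1)] le[OF that(2)] by simp
    then show ?thesis unfolding r_def[symmetric] by (simp add: power2_eq_square algebra_simps)
  qed
  have lim0: "(\<lambda>N. 8 * \<delta> * (1 / real (Suc N)) + 4 * (1 / real (Suc N))\<^sup>2) \<longlonglongrightarrow> 0"
  proof -
    have "(\<lambda>N. 8 * \<delta> * (1 / real (Suc N)) + 4 * (1 / real (Suc N))\<^sup>2) \<longlonglongrightarrow> 8 * \<delta> * 0 + 4 * 0\<^sup>2"
      by (intro tendsto_intros LIMSEQ_Suc[OF lim_1_over_n])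
    then show ?thesis by simp
  qed
  have "\<exists>p\<in>fns H. (\<lambda>n. nrm H (\<lambda>x. s n x - p x)) \<longlonglongrightarrow> 0"
  proof (rule Cauchy_limit[OF s])
    fix e :: real assume e: "e > 0"
    then have "0 < e\<^sup>2" by simp
    from LIMSEQ_D[OF lim0 this] obtain N where
      "norm (8 * \<delta> * (1 / real (Suc N)) + 4 * (1 / real (Suc N))\<^sup>2 - 0) < e\<^sup>2" by blast
    then have N: "8 * \<delta> * (1 / real (Suc N)) + 4 * (1 / real (Suc N))\<^sup>2 < e\<^sup>2"
      unfolding real_norm_def by linarith
    have "nrm H (\<lambda>x. s m x - s n x) < e" if "m \<ge> N" "n \<ge> N" for m n
      by (rule power2_less_imp_less[OF le_less_trans[OF close[OF that] N]]) (use e in simp)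
    then show "\<exists>N. \<forall>m\<ge>N. \<forall>n\<ge>N. nrm H (\<lambda>x. s m x - s n x) < e" by blast
  qed
  then obtain p where p: "p \<in> fns H" and lim: "(\<lambda>n. nrm H (\<lambda>x. s n x - p x)) \<longlonglongrightarrow> 0"
    by blast
  have limh: "(\<lambda>n. nrm H (\<lambda>x. (h x - s n x) - (h x - p x))) \<longlonglongrightarrow> 0"
    using lim nrm_minus_commute[OF s p] by simp
  have hp_le: "nrm H (\<lambda>x. h x - p x) \<le> \<delta>"
  proof (rule LIMSEQ_le)
    show "(\<lambda>n. nrm H (\<lambda>x. h x - s n x)) \<longlonglongrightarrow> nrm H (\<lambda>x. h x - p x)"
      by (rule tendsto_nrm[OF diff_mem[OF h s] diff_mem[OF h p] limh])
    have "(\<lambda>n. \<delta> + 1 / real (Suc n)) \<longlonglongrightarrow> \<delta> + 0"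
      by (intro tendsto_intros LIMSEQ_Suc[OF lim_1_over_n])
    then show "(\<lambda>n. \<delta> + 1 / real (Suc n)) \<longlonglongrightarrow> \<delta>" by simp
    show "\<exists>N. \<forall>n\<ge>N. nrm H (\<lambda>x. h x - s n x) \<le> \<delta> + 1 / real (Suc n)"
      using s_le by (auto simp: less_imp_le)
  qed
  have ge: "\<delta> \<le> nrm H (\<lambda>x. (h x - p x) - q x)" if q: "q \<in> P" for q
  proof -
    have "(\<lambda>n. nrm H (\<lambda>x. (h x - s n x) - q x)) \<longlonglongrightarrow> nrm H (\<lambda>x. (h x - p x) - q x)"
      using limh by (intro tendsto_nrm diff_mem h s p PD[OF q]) simp
    moreover have "\<delta> \<le> nrm H (\<lambda>x. (h x - s n x) - q x)" for n
      using \<delta>_le[OF P_add[OF sP q]] by (simp add: diff_diff_eq)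
    ultimately show ?thesis by (intro LIMSEQ_le_const) auto
  qed
  have orth: "ip H (\<lambda>x. h x - p x) q = 0" if q: "q \<in> P" for q
  proof -
    define a where "a = ip H (\<lambda>x. h x - p x) q"
    define t where "t = 1 / ((nrm H q)\<^sup>2 + 1)"
    have t: "t > 0" "t * (nrm H q)\<^sup>2 < 1"
      using zero_le_power2[of "nrm H q"] by (auto simp: t_def add_nonneg_pos divide_less_eq)
    \<comment> \<open>Unless \<open>a = 0\<close>, the point \<open>p + t a q\<close> would be closer to \<open>h\<close> than \<open>p\<close>.\<close>
    define tq where "tq = (\<lambda>x. (of_real t * a) * q x)"
    have hp: "(\<lambda>x. h x - p x) \<in> fns H" by (rule diff_mem[OF h p])
    have tq: "tq \<in> P" unfolding tq_def by (rule P_scale[OF q])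
    have "(nrm H (\<lambda>x. h x - p x))\<^sup>2 \<le> (nrm H (\<lambda>x. (h x - p x) - tq x))\<^sup>2"
      using hp_le ge[OF tq] by (intro power_mono) (auto simp: nrm_ge_0 hp)
    then have "2 * Re (ip H (\<lambda>x. h x - p x) tq) \<le> (nrm H tq)\<^sup>2"
      unfolding nrm_diff_power2[OF hp PD[OF tq]] by simp
    moreover have "ip H (\<lambda>x. h x - p x) tq = of_real (t * (cmod a)\<^sup>2)"
      unfolding tq_def ip_scale_right[OF hp PD[OF q]] a_def[symmetric] of_real_mult complex_norm_square
      by simp
    moreover have "(nrm H tq)\<^sup>2 = t * (cmod a)\<^sup>2 * (t * (nrm H q)\<^sup>2)"
      unfolding tq_def nrm_scale[OF PD[OF q]] using t
      by (simp add: norm_mult power_mult_distrib) (simp add: power2_eq_square)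
    ultimately have *: "2 * (t * (cmod a)\<^sup>2) \<le> t * (cmod a)\<^sup>2 * (t * (nrm H q)\<^sup>2)" by simp
    have "t * (cmod a)\<^sup>2 * (t * (nrm H q)\<^sup>2) \<le> t * (cmod a)\<^sup>2 * 1"
      using t by (intro mult_left_mono) auto
    with * have "t * (cmod a)\<^sup>2 \<le> 0" by simp
    with t have "a = 0" by (simp add: mult_le_0_iff)
    then show ?thesis by (simp add: a_def)
  qed
  show ?thesis using p sP lim orth by blast
qed

text \<open>
  A function orthogonal to all kernel functions vanishes, by the reproducing property.
\<close>

lemma combs_dense:
  assumes h: "h \<in> fns H"
  shows "\<exists>s. (\<forall>n::nat. s n \<in> combs X K) \<and> (\<lambda>n. nrm H (\<lambda>x. s n x - h x)) \<longlonglongrightarrow> 0"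
proof -
  have "(\<lambda>x. 0) \<in> combs X K" using combsI[of "{}" X K] by (simp add: comb_def)
  then obtain p s where p: "p \<in> fns H" and s: "\<And>n::nat. s n \<in> combs X K"
    and lim: "(\<lambda>n. nrm H (\<lambda>x. s n x - p x)) \<longlonglongrightarrow> 0"
    and orth: "\<And>q. q \<in> combs X K \<Longrightarrow> ip H (\<lambda>x. h x - p x) q = 0"
    using projection[of "combs X K" h, OF _ _ combs_add combs_scale h] combs_mem by blast
  have "h w - p w = 0" for w
  proof (cases "w \<in> X")
    case True
    have "K w = comb K {w} (\<lambda>_. 1)" by (simp add: comb_def)
    then have "K w \<in> combs X K" using True combsI[of "{w}" X K] by simp
    from orth[OF this] show ?thesis by (simp add: reproducing[OF diff_mem[OF h p] True])
  next
    case False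
    then show ?thesis using fns_fun_on[OF h] fns_fun_on[OF p] by (simp add: fun_on_def)
  qed
  then have "p = h" by (simp add: fun_eq_iff)
  with s lim show ?thesis by blast
qed

end

lemma combs_nrm_eq:
  assumes A: "is_rkhs X K A" and B: "is_rkhs X K B" and h: "h \<in> combs X K"
  shows "nrm A h = nrm B h"
proof -
  interpret A: rkhs_space X K A by unfold_locales fact
  interpret B: rkhs_space X K B by unfold_locales fact
  show ?thesis using h by (auto simp: combs_def nrm_def A.ip_comb_comb B.ip_comb_comb)
qed

text \<open>
  Convergence is transported along an isometry that is only known on a sequence. It is used to
  compare two spaces with one kernel, and to compare a closed span of kernel functions with the space
  of the restricted kernel.
\<close>

lemma isometric_limit:
  assumes A: "is_rkhs X K A" and B: "is_rkhs Y L B"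
    and s: "\<And>n::nat. s n \<in> fns A" and t: "\<And>n. t n \<in> fns B" and h: "h \<in> fns A"
    and lim: "(\<lambda>n. nrm A (\<lambda>x. s n x - h x)) \<longlonglongrightarrow> 0"
    and iso: "\<And>m n. nrm B (\<lambda>x. t m x - t n x) = nrm A (\<lambda>x. s m x - s n x)"
      "\<And>n. nrm B (t n) = nrm A (s n)"
    and agree: "\<And>n z. z \<in> Z \<Longrightarrow> t n z = s n z"
  shows "\<exists>k\<in>fns B. (\<lambda>n. nrm B (\<lambda>x. t n x - k x)) \<longlonglongrightarrow> 0 \<and> nrm B k = nrm A h \<and> (\<forall>z\<in>Z. k z = h z)"
proof -
  interpret A: rkhs_space X K A by unfold_locales fact
  interpret B: rkhs_space Y L B by unfold_locales fact
  have "\<exists>N. \<forall>m\<ge>N. \<forall>n\<ge>N. nrm B (\<lambda>x. t m x - t n x) < e" if "e > 0" for e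
    using A.convergent_imp_Cauchy[of s, OF s h lim that] unfolding iso .
  then obtain k where k: "k \<in> fns B" and lim': "(\<lambda>n. nrm B (\<lambda>x. t n x - k x)) \<longlonglongrightarrow> 0"
    using B.Cauchy_limit[of t, OF t] by blast
  have "(\<lambda>n. nrm B (t n)) \<longlonglongrightarrow> nrm A h" unfolding iso(2) by (rule A.tendsto_nrm[OF s h lim])
  from LIMSEQ_unique[OF B.tendsto_nrm[OF t k lim'] this] have "nrm B k = nrm A h" .
  moreover have "k z = h z" if "z \<in> Z" for z
  proof (rule LIMSEQ_unique)
    show "(\<lambda>n. s n z) \<longlonglongrightarrow> k z" using B.tendsto_pointwise[OF t k lim', of z] by (simp add: agree that)
    show "(\<lambda>n. s n z) \<longlonglongrightarrow> h z" by (rule A.tendsto_pointwise[OF s h lim])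
  qed
  ultimately show ?thesis using k lim' by blast
qed

lemma combs_diff: "s \<in> combs X K \<Longrightarrow> t \<in> combs X K \<Longrightarrow> (\<lambda>x. s x - t x) \<in> combs X K"
  using combs_add[OF _ combs_scale[of t X K "-1"], of s] by simp

lemma rkhs_fns_subset:
  assumes A: "is_rkhs X K A" and B: "is_rkhs X K B" and h: "h \<in> fns A"
  shows "h \<in> fns B \<and> nrm A h = nrm B h"
proof -
  interpret A: rkhs_space X K A by unfold_locales fact
  interpret B: rkhs_space X K B by unfold_locales fact
  obtain s where s: "\<And>n::nat. s n \<in> combs X K" and lim: "(\<lambda>n. nrm A (\<lambda>x. s n x - h x)) \<longlonglongrightarrow> 0"
    using A.combs_dense[OF h] by blast
  obtain k where "k \<in> fns B" "nrm B k = nrm A h" "\<forall>z\<in>UNIV. k z = h z"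
    using isometric_limit[OF A B A.combs_mem[OF s] B.combs_mem[OF s] h lim
        combs_nrm_eq[OF B A combs_diff[OF s s]] combs_nrm_eq[OF B A s], of UNIV] by auto
  moreover from this(3) have "k = h" by (simp add: fun_eq_iff)
  ultimately show ?thesis by simp
qed

lemma is_rkhs_unique:
  assumes A: "is_rkhs X K A" and B: "is_rkhs X K B"
  shows "A = B"
proof -
  interpret A: rkhs_space X K A by unfold_locales fact
  interpret B: rkhs_space X K B by unfold_locales fact
  have fns: "fns A = fns B" using rkhs_fns_subset[OF A B] rkhs_fns_subset[OF B A] by blast
  have "ip A h k = ip B h k" for h k
  proof (cases "h \<in> fns A \<and> k \<in> fns A")
    case True
    then show ?thesis
      using ip_eq_if_nrm_eq[OF A.inner_fun_space_axioms B.inner_fun_space_axioms fns] rkhs_fns_subset[OF A B]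
      by blast
  next
    case False
    then show ?thesis using A.ip_junk B.ip_junk fns by metis
  qed
  with fns show ?thesis by (cases A, cases B) (auto simp: fun_eq_iff)
qed

lemma is_rkhs_rkhs:
  assumes "psd_kernel X K"
  shows "is_rkhs X K (rkhs X K)"
proof -
  interpret psd_kernel X K by fact
  show ?thesis unfolding rkhs_def
    by (rule theI[of _ model]) (auto intro: is_rkhs_model is_rkhs_unique)
qed

text \<open>
  The Riesz representation theorem in the form used throughout: a function belongs to the
  space as soon as it defines a bounded functional on the kernel functions.
\<close>

lemma (in rkhs_space) mem_iff_pair_bound:
  assumes B: "B \<ge> 0"
  shows "h \<in> fns H \<and> nrm H h \<le> B \<longleftrightarrow>
    fun_on X h \<and> (\<forall>S c. finite S \<longrightarrow> S \<subseteq> X \<longrightarrow> cmod (pair S c h) \<le> B * nrm H (comb K S c))"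
proof safe
  assume h: "h \<in> fns H" "nrm H h \<le> B"
  show "fun_on X h" by (rule fns_fun_on[OF h(1)])
  fix S :: "'a set" and c assume "finite S" and S: "S \<subseteq> X"
  show "cmod (pair S c h) \<le> B * nrm H (comb K S c)"
    using Cauchy_Schwarz[OF h(1) comb_mem[OF S, of c]]
      mult_right_mono[OF h(2) nrm_ge_0[OF comb_mem[OF S, of c]]] by (simp add: ip_comb[OF h(1) S])
next
  assume h: "fun_on X h"
    and bound: "\<forall>S c. finite S \<longrightarrow> S \<subseteq> X \<longrightarrow> cmod (pair S c h) \<le> B * nrm H (comb K S c)"
  interpret psd_kernel X K by (rule psd_kernel)
  have H: "H = model" by (rule is_rkhs_unique[OF is_rkhs is_rkhs_model])
  have "dual_value K S c h \<le> B\<^sup>2" if S: "finite S" "S \<subseteq> X" for S c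
  proof -
    define q where "q = nrm H (comb K S c)"
    have "Re (pair S c h) \<le> B * q"
      using bound S complex_Re_le_cmod[of "pair S c h"] unfolding q_def by (meson order_trans)
    moreover have "Re (quad K S c) = q\<^sup>2" by (simp add: q_def nrm_comb S)
    moreover have "0 \<le> (B - q)\<^sup>2" by simp
    ultimately show ?thesis by (simp add: dual_value_def power2_diff)
  qed
  from kernel_fnsI[OF h this] have "h \<in> kernel_fns X K" "kernel_sq X K h \<le> B\<^sup>2" by auto
  then show "h \<in> fns H" "nrm H h \<le> B"
    using B power2_le_imp_le[of "nrm H h" B] by (auto simp: H fns_model nrm_model)
qed

section \<open>Uniform boundedness and fixed points in Banach spaces of functions\<close>

locale banach_fns =
  fixes A :: "('a \<Rightarrow> complex) set" and N :: "('a \<Rightarrow> complex) \<Rightarrow> real"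
  assumes zero_in: "(\<lambda>x. 0) \<in> A"
    and add_in: "\<And>f g. f \<in> A \<Longrightarrow> g \<in> A \<Longrightarrow> (\<lambda>x. f x + g x) \<in> A"
    and scale_in: "\<And>c f. f \<in> A \<Longrightarrow> (\<lambda>x. c * f x) \<in> A"
    and N_ge_0: "\<And>f. f \<in> A \<Longrightarrow> 0 \<le> N f"
    and N_add: "\<And>f g. f \<in> A \<Longrightarrow> g \<in> A \<Longrightarrow> N (\<lambda>x. f x + g x) \<le> N f + N g"
    and N_scale: "\<And>c f. f \<in> A \<Longrightarrow> N (\<lambda>x. c * f x) = cmod c * N f"
    and N_complete: "\<And>s. (\<And>n::nat. s n \<in> A) \<Longrightarrow>
        (\<And>e. e > 0 \<Longrightarrow> \<exists>M. \<forall>m\<ge>M. \<forall>n\<ge>M. N (\<lambda>x. s m x - s n x) < e) \<Longrightarrow>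
        \<exists>h\<in>A. (\<lambda>n. N (\<lambda>x. s n x - h x)) \<longlonglongrightarrow> 0"

definition seminorm_on :: "('a \<Rightarrow> complex) set \<Rightarrow> (('a \<Rightarrow> complex) \<Rightarrow> real) \<Rightarrow> bool" where
  "seminorm_on A p \<longleftrightarrow> (\<forall>f\<in>A. 0 \<le> p f) \<and> (\<forall>f\<in>A. \<forall>g\<in>A. p (\<lambda>x. f x + g x) \<le> p f + p g) \<and>
     (\<forall>c. \<forall>f\<in>A. p (\<lambda>x. c * f x) = cmod c * p f)"

lemma seminorm_scale: "seminorm_on A p \<Longrightarrow> f \<in> A \<Longrightarrow> p (\<lambda>x. c * f x) = cmod c * p f"
  unfolding seminorm_on_def by blast

context banach_fns
begin

lemma diff_in:
  assumes "f \<in> A" "g \<in> A"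
  shows "(\<lambda>x. f x - g x) \<in> A"
  using add_in[OF assms(1) scale_in[OF assms(2), of "-1"]] by simp

lemma N_diff_commute:
  assumes "f \<in> A" "g \<in> A"
  shows "N (\<lambda>x. f x - g x) = N (\<lambda>x. g x - f x)"
  using N_scale[OF diff_in[OF assms], of "-1"] by simp

lemma N_triangle:
  assumes "f \<in> A" "g \<in> A" "h \<in> A"
  shows "N (\<lambda>x. f x - h x) \<le> N (\<lambda>x. f x - g x) + N (\<lambda>x. g x - h x)"
  using N_add[OF diff_in[OF assms(1,2)] diff_in[OF assms(2,3)]] by simp

lemma geometric_limit:
  assumes x: "\<And>n. x n \<in> A" and step: "\<And>n. N (\<lambda>t. x (Suc n) t - x n t) \<le> C * r ^ n"
    and r: "0 \<le> r" "r < 1"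
  shows "\<exists>y\<in>A. \<forall>n. N (\<lambda>t. x n t - y t) \<le> C / (1 - r) * r ^ n"
proof -
  define D where "D = C / (1 - r)"
  have C: "C = D * (1 - r)" using r by (simp add: D_def)
  have "C \<ge> 0" using order_trans[OF N_ge_0[OF diff_in[OF x x]] step[of 0]] by simp
  then have D: "D \<ge> 0" using r by (simp add: D_def)
  have le: "N (\<lambda>t. x (n + j) t - x n t) \<le> D * r ^ n - D * r ^ (n + j)" for n j
  proof (induction j)
    case 0
    then show ?case using N_scale[OF zero_in, of 0] by simp
  next
    case (Suc j)
    have "N (\<lambda>t. x (n + Suc j) t - x n t)
        \<le> N (\<lambda>t. x (Suc (n + j)) t - x (n + j) t) + N (\<lambda>t. x (n + j) t - x n t)"
      using N_triangle[OF x x x] by simp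
    also have "\<dots> \<le> C * r ^ (n + j) + (D * r ^ n - D * r ^ (n + j))"
      by (intro add_mono step Suc)
    also have "\<dots> = D * r ^ n - D * r ^ (n + Suc j)" by (simp add: C algebra_simps)
    finally show ?case .
  qed
  have le': "N (\<lambda>t. x m t - x n t) \<le> D * r ^ n" if "m \<ge> n" for m n
  proof -
    have "0 \<le> D * r ^ m" using D r by simp
    moreover have "N (\<lambda>t. x m t - x n t) \<le> D * r ^ n - D * r ^ m"
      using le[of n "m - n"] that by simp
    ultimately show ?thesis by linarith
  qed
  have lim0: "(\<lambda>n. D * r ^ n) \<longlonglongrightarrow> 0"
    using tendsto_mult_right_zero[OF LIMSEQ_realpow_zero[OF r]] by simp
  have "\<exists>y\<in>A. (\<lambda>n. N (\<lambda>t. x n t - y t)) \<longlonglongrightarrow> 0"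
  proof (rule N_complete[OF x])
    fix e :: real assume e: "e > 0"
    obtain M where M': "\<And>n. n \<ge> M \<Longrightarrow> norm (D * r ^ n - 0) < e"
      using LIMSEQ_D[OF lim0 e] by blast
    have M: "D * r ^ n < e" if "n \<ge> M" for n
      using M'[OF that] unfolding real_norm_def by linarith
    have "N (\<lambda>t. x m t - x n t) < e" if "m \<ge> M" "n \<ge> M" for m n
    proof (cases "m \<ge> n")
      case True
      then show ?thesis using le'[OF True] M[OF that(2)] by simp
    next
      case False
      then show ?thesis using le'[of m n] M[OF that(1)] N_diff_commute[OF x x, of m n] by simp
    qed
    then show "\<exists>M. \<forall>m\<ge>M. \<forall>n\<ge>M. N (\<lambda>t. x m t - x n t) < e" by blast
  qed
  then obtain y where y: "y \<in> A" and lim: "(\<lambda>n. N (\<lambda>t. x n t - y t)) \<longlonglongrightarrow> 0" by blast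
  have "N (\<lambda>t. x n t - y t) \<le> D * r ^ n" for n
  proof (rule LIMSEQ_le_const)
    have "(\<lambda>m. D * r ^ n + N (\<lambda>t. x m t - y t)) \<longlonglongrightarrow> D * r ^ n + 0"
      by (intro tendsto_intros lim)
    then show "(\<lambda>m. D * r ^ n + N (\<lambda>t. x m t - y t)) \<longlonglongrightarrow> D * r ^ n" by simp
    have "N (\<lambda>t. x n t - y t) \<le> D * r ^ n + N (\<lambda>t. x m t - y t)" if "m \<ge> n" for m
      using N_triangle[OF x x y, of n m] le'[OF that] N_diff_commute[OF x x, of m n] by simp
    then show "\<exists>M. \<forall>m\<ge>M. N (\<lambda>t. x n t - y t) \<le> D * r ^ n + N (\<lambda>t. x m t - y t)" by blast
  qed
  with y show ?thesis unfolding D_def by blast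
qed

lemma contraction_fixed_point:
  assumes T: "\<And>f. f \<in> A \<Longrightarrow> T f \<in> A" and r: "0 \<le> r" "r < 1"
    and contr: "\<And>f g. f \<in> A \<Longrightarrow> g \<in> A \<Longrightarrow> N (\<lambda>x. T f x - T g x) \<le> r * N (\<lambda>x. f x - g x)"
  shows "\<exists>u\<in>A. N (\<lambda>x. T u x - u x) = 0"
proof -
  define x where "x n = (T ^^ n) (\<lambda>_. 0)" for n
  have x_Suc: "x (Suc n) = T (x n)" for n by (simp add: x_def)
  have xA: "x n \<in> A" for n by (induction n) (auto simp: x_Suc T, simp add: x_def zero_in)
  have step: "N (\<lambda>t. x (Suc n) t - x n t) \<le> N (\<lambda>t. x 1 t - x 0 t) * r ^ n" for n
  proof (induction n)
    case (Suc n)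
    have "N (\<lambda>t. x (Suc (Suc n)) t - x (Suc n) t) \<le> r * N (\<lambda>t. x (Suc n) t - x n t)"
      using contr[OF xA xA, of "Suc n" n] by (simp add: x_Suc)
    also have "\<dots> \<le> r * (N (\<lambda>t. x 1 t - x 0 t) * r ^ n)" by (intro mult_left_mono Suc r)
    finally show ?case by (simp add: mult_ac)
  qed simp
  obtain u D where u: "u \<in> A" and lim: "\<And>n. N (\<lambda>t. x n t - u t) \<le> D * r ^ n"
    using geometric_limit[of x, OF xA step r] by blast
  have "N (\<lambda>t. T u t - u t) \<le> 2 * D * r * r ^ n" for n
  proof -
    have "N (\<lambda>t. T u t - u t) \<le> N (\<lambda>t. T u t - T (x n) t) + N (\<lambda>t. x (Suc n) t - u t)"
      using N_triangle[OF T[OF u] T[OF xA] u, of n] by (simp add: x_Suc)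
    also have "N (\<lambda>t. T u t - T (x n) t) \<le> r * N (\<lambda>t. x n t - u t)"
      using contr[OF u xA, of n] N_diff_commute[OF u xA, of n] by simp
    also have "\<dots> \<le> r * (D * r ^ n)" by (intro mult_left_mono lim r)
    finally show ?thesis using lim[of "Suc n"] by (simp add: algebra_simps)
  qed
  moreover have "(\<lambda>n. 2 * D * r * r ^ n) \<longlonglongrightarrow> 0"
    using tendsto_mult_right_zero[OF LIMSEQ_realpow_zero[OF r]] by simp
  ultimately have "N (\<lambda>t. T u t - u t) \<le> 0" by (intro LIMSEQ_le_const) auto
  then show ?thesis using u N_ge_0[OF diff_in[OF T[OF u] u]] by (intro bexI[of _ u]) auto
qed

text \<open>
  One of \<open>x + f\<close> and \<open>x - f\<close> serves, since \<open>2 f\<close> is their difference.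
\<close>

lemma seminorm_step:
  assumes p: "seminorm_on A p" and x: "x \<in> A" and f: "f \<in> A"
  shows "\<exists>y\<in>A. N (\<lambda>t. y t - x t) = N f \<and> p f \<le> p y"
proof -
  define u v where "u = (\<lambda>t. x t + f t)" and "v = (\<lambda>t. f t - x t)"
  have uv: "u \<in> A" "v \<in> A" unfolding u_def v_def by (intro add_in diff_in x f)+
  have "p (\<lambda>t. 2 * f t) = 2 * p f" using p f by (simp add: seminorm_on_def)
  moreover have "p (\<lambda>t. u t + v t) \<le> p u + p v" using p uv by (simp add: seminorm_on_def)
  moreover have "(\<lambda>t. u t + v t) = (\<lambda>t. 2 * f t)" by (simp add: u_def v_def fun_eq_iff)
  moreover have "p (\<lambda>t. - 1 * v t) = cmod (-1) * p v" using p uv unfolding seminorm_on_def by blast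
  ultimately have "p f \<le> p u \<or> p f \<le> p (\<lambda>t. - 1 * v t)" by auto
  moreover have "N (\<lambda>t. u t - x t) = N f" by (simp add: u_def)
  moreover have "N (\<lambda>t. - 1 * v t - x t) = N f"
    using N_scale[OF f, of "-1"] by (simp add: v_def)
  moreover have "u \<in> A" "(\<lambda>t. - 1 * v t) \<in> A" by (rule uv(1), rule scale_in[OF uv(2)])
  ultimately show ?thesis by (elim disjE) (rule bexI[of _ u] bexI[of _ "\<lambda>t. - 1 * v t"]; simp)+
qed

text \<open>
  The gliding hump. If the operator norms of the seminorms in \<open>P\<close> were unbounded, pick \<open>p n\<close> of norm at
  least \<open>4 ^ n\<close> and move by steps of length \<open>3 ^ -n\<close>, each making \<open>p n\<close> almost as large as possible; the
  later steps, of total length \<open>3 ^ -n / 2\<close>, cannot undo this, so \<open>p n\<close> is unbounded at the limit.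
\<close>

lemma uniform_boundedness:
  assumes seminorm: "\<And>p. p \<in> P \<Longrightarrow> seminorm_on A p"
    and bounded: "\<And>p. p \<in> P \<Longrightarrow> \<exists>C. \<forall>f\<in>A. p f \<le> C * N f"
    and pointwise: "\<And>f. f \<in> A \<Longrightarrow> \<exists>B. \<forall>p\<in>P. p f \<le> B"
  shows "\<exists>C\<ge>0. \<forall>p\<in>P. \<forall>f\<in>A. p f \<le> C * N f"
proof (rule ccontr)
  assume contra: "\<not> ?thesis"
  define nm where "nm p = Sup {p f | f. f \<in> A \<and> N f \<le> 1}" for p :: "('a \<Rightarrow> complex) \<Rightarrow> real"
  have nm_upper: "p f \<le> nm p" if p: "p \<in> P" and f: "f \<in> A" "N f \<le> 1" for p f
  proof -
    obtain C where C: "\<forall>f\<in>A. p f \<le> C * N f" using bounded[OF p] by blast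
    have "p f \<le> \<bar>C\<bar>" if "f \<in> A" "N f \<le> 1" for f
    proof -
      have "p f \<le> C * N f" using C that by blast
      also have "\<dots> \<le> \<bar>C\<bar> * 1" using that N_ge_0 by (intro mult_mono) auto
      finally show ?thesis by simp
    qed
    then show ?thesis unfolding nm_def using f by (intro cSup_upper) (auto intro!: bdd_aboveI[of _ "\<bar>C\<bar>"])
  qed
  have N0: "N (\<lambda>x. 0) = 0" using N_scale[OF zero_in, of 0] by simp
  have nm_ge_0: "0 \<le> nm p" if p: "p \<in> P" for p
    using nm_upper[OF p zero_in] seminorm[OF p] zero_in N0 unfolding seminorm_on_def by force
  have nm_bound: "p f \<le> nm p * N f" if p: "p \<in> P" and f: "f \<in> A" for p f
  proof (cases "N f = 0")
    case True
    then show ?thesis using bounded[OF p] f by force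
  next
    case False
    then have pos: "N f > 0" using N_ge_0[OF f] by simp
    have "p (\<lambda>x. of_real (1 / N f) * f x) \<le> nm p"
      by (rule nm_upper[OF p scale_in[OF f]])
        (use pos N_scale[OF f, of "of_real (1 / N f)"] in \<open>simp add: norm_divide\<close>)
    moreover have "p (\<lambda>x. of_real (1 / N f) * f x) = (1 / N f) * p f"
      using seminorm_scale[OF seminorm[OF p] f, of "of_real (1 / N f)"] pos by (simp add: norm_divide)
    ultimately show ?thesis using pos by (simp add: divide_le_eq)
  qed
  have "\<exists>p\<in>P. 4 ^ n < nm p" for n :: nat
  proof (rule ccontr)
    assume "\<not> ?thesis"
    then have le: "nm p \<le> 4 ^ n" if "p \<in> P" for p using that by (meson not_le)
    have "p f \<le> 4 ^ n * N f" if "p \<in> P" "f \<in> A" for p f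
      using nm_bound[OF that] mult_right_mono[OF le[OF that(1)] N_ge_0[OF that(2)]] by simp
    then have "\<exists>C\<ge>0. \<forall>p\<in>P. \<forall>f\<in>A. p f \<le> C * N f" by (intro exI[of _ "4 ^ n"]) auto
    with contra show False ..
  qed
  then obtain p where p: "\<And>n. p n \<in> P" and p_large: "\<And>n::nat. 4 ^ n < nm (p n)" by metis
  have step: "\<exists>y\<in>A. N (\<lambda>t. y t - x t) \<le> (1/3) ^ n \<and> 2/3 * (1/3) ^ n * nm (p n) \<le> p n y"
    if x: "x \<in> A" for x n
  proof -
    have pos: "nm (p n) > 0" using p_large[of n] zero_less_power[of "4::real" n] by linarith
    have "\<exists>d\<in>{p n f | f. f \<in> A \<and> N f \<le> 1}. 2/3 * nm (p n) < d"
    proof (rule less_cSupD)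
      show "{p n f | f. f \<in> A \<and> N f \<le> 1} \<noteq> {}" using zero_in N0 by force
      show "2/3 * nm (p n) < Sup {p n f | f. f \<in> A \<and> N f \<le> 1}"
        using pos unfolding nm_def[symmetric] by simp
    qed
    then obtain f where f: "f \<in> A" "N f \<le> 1" "2/3 * nm (p n) < p n f" by blast
    have f': "(\<lambda>t. (1/3) ^ n * f t) \<in> A" by (rule scale_in[OF f(1)])
    have "N (\<lambda>t. (1/3) ^ n * f t) \<le> (1/3) ^ n"
      using f(2) by (simp add: N_scale[OF f(1)] norm_power norm_divide)
    moreover have "p n (\<lambda>t. (1/3) ^ n * f t) = (1/3) ^ n * p n f"
      using seminorm[OF p[of n]] f(1) unfolding seminorm_on_def by (simp add: norm_power norm_divide)
    moreover have "(1/3) ^ n * (2/3 * nm (p n)) \<le> (1/3) ^ n * p n f"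
      using f(3) by (intro mult_left_mono) auto
    moreover obtain y where y: "y \<in> A" "N (\<lambda>t. y t - x t) = N (\<lambda>t. (1/3) ^ n * f t)"
        "p n (\<lambda>t. (1/3) ^ n * f t) \<le> p n y"
      using seminorm_step[OF seminorm[OF p[of n]] x f'] by blast
    ultimately have "N (\<lambda>t. y t - x t) \<le> (1/3) ^ n" "(1/3) ^ n * (2/3 * nm (p n)) \<le> p n y"
      by linarith+
    with y(1) show ?thesis by (auto simp only: mult_ac)
  qed
  define x where "x = rec_nat (\<lambda>t. 0) (\<lambda>n x. SOME y. y \<in> A \<and> N (\<lambda>t. y t - x t) \<le> (1/3) ^ n \<and>
                        2/3 * (1/3) ^ n * nm (p n) \<le> p n y)"
  have x_Suc: "x (Suc n) \<in> A \<and> N (\<lambda>t. x (Suc n) t - x n t) \<le> (1/3) ^ n \<and>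
      2/3 * (1/3) ^ n * nm (p n) \<le> p n (x (Suc n))" if "x n \<in> A" for n
    using someI_ex[OF step[OF that, of n, unfolded Bex_def]] by (simp add: x_def)
  have xA: "x n \<in> A" for n
    by (induction n) (use x_Suc zero_in in \<open>auto simp: x_def\<close>)
  obtain y where y: "y \<in> A" and y_lim: "\<And>n. N (\<lambda>t. x n t - y t) \<le> 3/2 * (1/3) ^ n"
    using geometric_limit[of x 1 "1/3"] xA x_Suc[OF xA] by auto
  obtain B where B: "\<And>q. q \<in> P \<Longrightarrow> q y \<le> B" using pointwise[OF y] by blast
  have large: "1/6 * (4/3) ^ n \<le> B" for n :: nat
  proof -
    have "p n (x (Suc n)) \<le> p n y + p n (\<lambda>t. x (Suc n) t - y t)"
      using seminorm[OF p[of n]] y diff_in[OF xA[of "Suc n"] y] unfolding seminorm_on_def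
      by (elim conjE ballE[of _ _ y] ballE[of _ _ "\<lambda>t. x (Suc n) t - y t"]) auto
    also have "p n (\<lambda>t. x (Suc n) t - y t) \<le> nm (p n) * (1/2 * (1/3) ^ n)"
      using nm_bound[OF p diff_in[OF xA[of "Suc n"] y], of n]
        mult_left_mono[OF y_lim[of "Suc n"] nm_ge_0[OF p[of n]]] by simp
    finally have "2/3 * (1/3) ^ n * nm (p n) \<le> p n y + nm (p n) * (1/2 * (1/3) ^ n)"
      using x_Suc[OF xA, of n] by simp
    then have "1/6 * (1/3) ^ n * nm (p n) \<le> B" using B[OF p[of n]] by (simp add: mult_ac)
    moreover have "1/6 * (1/3) ^ n * 4 ^ n \<le> 1/6 * (1/3) ^ n * nm (p n)"
      using p_large[of n] by (intro mult_left_mono) auto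
    ultimately show ?thesis by (simp add: power_divide)
  qed
  obtain n :: nat where "6 * B < (4/3) ^ n" using real_arch_pow[of "4/3" "6 * B"] by auto
  with large[of n] show False by simp
qed

end

sublocale rkhs_space \<subseteq> banach_fns "fns H" "nrm H"
proof
  show "\<exists>h\<in>fns H. (\<lambda>n. nrm H (\<lambda>x. s n x - h x)) \<longlonglongrightarrow> 0"
    if "\<And>n::nat. s n \<in> fns H"
      and "\<And>e. e > 0 \<Longrightarrow> \<exists>M. \<forall>m\<ge>M. \<forall>n\<ge>M. nrm H (\<lambda>x. s m x - s n x) < e" for s
    using Cauchy_limit[OF that] by blast
qed (auto simp: zero_mem add_mem scale_mem nrm_ge_0 nrm_scale nrm_triangle)

section \<open>Multipliers\<close>

text \<open>
  The adjoint of multiplication by \<open>\<phi>\<close> sends \<open>K w\<close> to \<open>cnj (\<phi> w) * K w\<close>, so this says that the adjoint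
  has norm at most \<open>M\<close>. The condition mentions only values of \<open>K\<close> and \<open>\<phi>\<close> at finitely many points,
  which makes it easy to restrict, to transport and to pass to pointwise limits.
\<close>

definition pick_bound :: "'a set \<Rightarrow> ('a \<Rightarrow> 'a \<Rightarrow> complex) \<Rightarrow> ('a \<Rightarrow> complex) \<Rightarrow> real \<Rightarrow> bool" where
  "pick_bound X K \<phi> M \<longleftrightarrow> (\<forall>S c. finite S \<longrightarrow> S \<subseteq> X \<longrightarrow>
     Re (quad K S (\<lambda>w. cnj (\<phi> w) * c w)) \<le> M\<^sup>2 * Re (quad K S c))"

context rkhs_space
begin

lemma pick_bound_iff:
  assumes "M \<ge> 0"
  shows "pick_bound X K \<phi> M \<longleftrightarrow> (\<forall>S c. finite S \<longrightarrow> S \<subseteq> X \<longrightarrow>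
     nrm H (comb K S (\<lambda>w. cnj (\<phi> w) * c w)) \<le> M * nrm H (comb K S c))"
proof -
  have "Re (quad K S d) \<le> M\<^sup>2 * Re (quad K S c) \<longleftrightarrow> nrm H (comb K S d) \<le> M * nrm H (comb K S c)"
    if "S \<subseteq> X" for S c d
    using that assms by (simp add: nrm_comb[symmetric] power_mult_distrib[symmetric]
        abs_le_square_iff[symmetric] nrm_ge_0 comb_mem)
  then show ?thesis unfolding pick_bound_def by blast
qed

lemma pair_mult: "pair S c (\<lambda>x. \<phi> x * h x) = pair S (\<lambda>w. cnj (\<phi> w) * c w) h"
  by (simp add: pair_def mult_ac)

lemma mult_bounded_if_pick_bound:
  assumes "M \<ge> 0" and pb: "pick_bound X K \<phi> M" and h: "h \<in> fns H"
  shows "(\<lambda>x. \<phi> x * h x) \<in> fns H" "nrm H (\<lambda>x. \<phi> x * h x) \<le> M * nrm H h"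
proof -
  have "(\<lambda>x. \<phi> x * h x) \<in> fns H \<and> nrm H (\<lambda>x. \<phi> x * h x) \<le> M * nrm H h"
    unfolding mem_iff_pair_bound[OF mult_nonneg_nonneg[OF assms(1) nrm_ge_0[OF h]]]
  proof (intro conjI allI impI)
    show "fun_on X (\<lambda>x. \<phi> x * h x)" using fns_fun_on[OF h] by (simp add: fun_on_def)
    fix S :: "'a set" and c assume S: "finite S" "S \<subseteq> X"
    have "cmod (pair S c (\<lambda>x. \<phi> x * h x)) \<le> nrm H h * nrm H (comb K S (\<lambda>w. cnj (\<phi> w) * c w))"
      using Cauchy_Schwarz[OF h comb_mem[OF S(2)]] unfolding ip_comb[OF h S(2)] pair_mult[of S c \<phi> h] .
    also have "\<dots> \<le> nrm H h * (M * nrm H (comb K S c))"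
      using pb S unfolding pick_bound_iff[OF assms(1)] by (intro mult_left_mono nrm_ge_0 h) auto
    finally show "cmod (pair S c (\<lambda>x. \<phi> x * h x)) \<le> M * nrm H h * nrm H (comb K S c)"
      by (simp add: mult_ac)
  qed
  then show "(\<lambda>x. \<phi> x * h x) \<in> fns H" "nrm H (\<lambda>x. \<phi> x * h x) \<le> M * nrm H h" by auto
qed

lemma pick_bound_if_mult_bounded:
  assumes "M \<ge> 0" and mem: "\<And>h. h \<in> fns H \<Longrightarrow> (\<lambda>x. \<phi> x * h x) \<in> fns H"
    and le: "\<And>h. h \<in> fns H \<Longrightarrow> nrm H (\<lambda>x. \<phi> x * h x) \<le> M * nrm H h"
  shows "pick_bound X K \<phi> M"
  unfolding pick_bound_iff[OF assms(1)]
proof (intro allI impI)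
  fix S :: "'a set" and c assume "finite S" and S: "S \<subseteq> X"
  let ?g = "comb K S (\<lambda>w. cnj (\<phi> w) * c w)"
  have g: "?g \<in> fns H" by (rule comb_mem[OF S])
  have "(nrm H ?g)\<^sup>2 = Re (ip H (\<lambda>x. \<phi> x * ?g x) (comb K S c))"
    by (simp add: nrm_power2 g ip_comb mem S pair_mult)
  also have "\<dots> \<le> nrm H (\<lambda>x. \<phi> x * ?g x) * nrm H (comb K S c)"
    using Cauchy_Schwarz[OF mem[OF g] comb_mem[OF S, of c]] complex_Re_le_cmod order_trans by blast
  also have "\<dots> \<le> M * nrm H ?g * nrm H (comb K S c)"
    by (intro mult_right_mono le g nrm_ge_0 comb_mem S)
  finally show "nrm H ?g \<le> M * nrm H (comb K S c)"
    using nrm_ge_0[OF g] assms(1) nrm_ge_0[OF comb_mem[OF S, of c]]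
    by (cases "nrm H ?g = 0") (auto simp: power2_eq_square)
qed

text \<open>
  Multipliers are defined without any bound; the bound is found by uniform boundedness, applied to the
  functionals \<open>h \<mapsto> \<langle>\<phi> h, k\<rangle>\<close> with \<open>k\<close> a normalized combination of kernel functions. Each is bounded
  since the adjoint of the multiplication is defined on \<open>k\<close>.
\<close>

lemma Mult_bounded:
  assumes \<phi>: "\<phi> \<in> Mult X H"
  shows "\<exists>M\<ge>0. pick_bound X K \<phi> M"
proof -
  \<comment> \<open>If the denominator is \<open>0\<close>, so is the numerator, and the value \<open>0\<close> of the quotient loses nothing.\<close>
  define p where "p = (\<lambda>(S, c) h. cmod (pair S c (\<lambda>x. \<phi> x * h x)) / nrm H (comb K S c))"
  define P where "P = p ` {(S, c). finite S \<and> S \<subseteq> X}"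
  have mem: "(\<lambda>x. \<phi> x * h x) \<in> fns H" if "h \<in> fns H" for h using \<phi> that by (simp add: Mult_def)
  have pair_add: "pair S c (\<lambda>x. \<phi> x * (f x + g x)) = pair S c (\<lambda>x. \<phi> x * f x) + pair S c (\<lambda>x. \<phi> x * g x)" for S c f g
    by (simp add: pair_def distrib_left sum.distrib)
  have pair_scale': "pair S c (\<lambda>x. \<phi> x * (t * f x)) = t * pair S c (\<lambda>x. \<phi> x * f x)" for S c f t
    by (simp add: pair_def sum_distrib_left mult_ac)
  have le: "cmod (pair S c (\<lambda>x. \<phi> x * h x)) \<le> nrm H (\<lambda>x. \<phi> x * h x) * nrm H (comb K S c)"
    if "S \<subseteq> X" "h \<in> fns H" for S c h
    using Cauchy_Schwarz[OF mem[OF that(2)] comb_mem[OF that(1)]] by (simp add: ip_comb mem that)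
  have "\<exists>C\<ge>0. \<forall>q\<in>P. \<forall>h\<in>fns H. q h \<le> C * nrm H h"
  proof (rule uniform_boundedness)
    fix q assume "q \<in> P"
    then obtain S c where S: "finite S" "S \<subseteq> X" and q: "q = p (S, c)" by (auto simp: P_def)
    note n = nrm_ge_0[OF comb_mem[OF S(2), of c]]
    show "seminorm_on (fns H) q"
      unfolding seminorm_on_def q p_def prod.case pair_add pair_scale' norm_mult
      using n by (auto simp: add_divide_distrib[symmetric] intro!: divide_right_mono norm_triangle_ineq)
    have "q h \<le> nrm H (comb K S (\<lambda>w. cnj (\<phi> w) * c w)) / nrm H (comb K S c) * nrm H h" if "h \<in> fns H" for h
      using divide_right_mono[OF Cauchy_Schwarz[OF that comb_mem[OF S(2), of "\<lambda>w. cnj (\<phi> w) * c w"]] n]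
      unfolding q p_def prod.case ip_comb[OF that S(2)] pair_mult[of S c \<phi> h] by (simp add: mult.commute)
    then show "\<exists>C. \<forall>h\<in>fns H. q h \<le> C * nrm H h" by blast
  next
    fix h assume h: "h \<in> fns H"
    have "q h \<le> nrm H (\<lambda>x. \<phi> x * h x)" if "q \<in> P" for q
      using that le[OF _ h] nrm_ge_0[OF comb_mem] nrm_ge_0[OF mem[OF h]]
      by (auto simp: P_def p_def divide_le_eq less_le)
    then show "\<exists>B. \<forall>q\<in>P. q h \<le> B" by blast
  qed
  then obtain C where C: "C \<ge> 0" "\<And>q h. q \<in> P \<Longrightarrow> h \<in> fns H \<Longrightarrow> q h \<le> C * nrm H h" by blast
  have "nrm H (\<lambda>x. \<phi> x * h x) \<le> C * nrm H h" if h: "h \<in> fns H" for h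
  proof -
    have bound: "cmod (pair S c (\<lambda>x. \<phi> x * h x)) \<le> C * nrm H h * nrm H (comb K S c)"
      if S: "finite S" "S \<subseteq> X" for S c
    proof (cases "nrm H (comb K S c) = 0")
      case True
      then show ?thesis using le[OF S(2) h, of c] by simp
    next
      case False
      have "p (S, c) \<in> P" using S by (auto simp: P_def)
      from C(2)[OF this h] show ?thesis
        using False nrm_ge_0[OF comb_mem[OF S(2), of c]] by (simp add: p_def divide_le_eq)
    qed
    have "C * nrm H h \<ge> 0" using C(1) nrm_ge_0[OF h] by simp
    from mem_iff_pair_bound[OF this, of "\<lambda>x. \<phi> x * h x"] bound fns_fun_on[OF mem[OF h]]
    show ?thesis by blast
  qed
  with C(1) mem show ?thesis using pick_bound_if_mult_bounded by blast
qed

lemma Mult_iff: "\<phi> \<in> Mult X H \<longleftrightarrow> fun_on X \<phi> \<and> (\<exists>M\<ge>0. pick_bound X K \<phi> M)"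
  using Mult_bounded mult_bounded_if_pick_bound(1) unfolding Mult_def by blast

lemma mult_norm_upper:
  assumes \<phi>: "\<phi> \<in> Mult X H" and h: "h \<in> fns H"
  shows "nrm H (\<lambda>x. \<phi> x * h x) \<le> mult_norm H \<phi> * nrm H h"
proof -
  obtain M where M: "M \<ge> 0" "pick_bound X K \<phi> M" using Mult_bounded[OF \<phi>] by blast
  have bdd: "nrm H (\<lambda>x. \<phi> x * k x) \<le> M" if "k \<in> fns H" "nrm H k \<le> 1" for k
    using mult_bounded_if_pick_bound(2)[OF M that(1)] mult_left_mono[OF that(2) M(1)] by simp
  have upper: "nrm H (\<lambda>x. \<phi> x * k x) \<le> mult_norm H \<phi>" if "k \<in> fns H" "nrm H k \<le> 1" for k
    unfolding mult_norm_def using that bdd by (intro cSup_upper) (auto intro!: bdd_aboveI[of _ M])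
  show ?thesis
  proof (cases "nrm H h = 0")
    case True
    then show ?thesis using mult_bounded_if_pick_bound(2)[OF M h] by simp
  next
    case False
    define q where "q = nrm H h"
    have q: "q > 0" using False nrm_ge_0[OF h] by (simp add: q_def)
    have "nrm H (\<lambda>x. \<phi> x * (of_real (1 / q) * h x)) \<le> mult_norm H \<phi>"
      by (rule upper[OF scale_mem[OF h]]) (use q nrm_scale[OF h, of "of_real (1 / q)"] in \<open>simp add: q_def[symmetric] norm_divide\<close>)
    moreover have "nrm H (\<lambda>x. of_real (1 / q) * (\<phi> x * h x)) = nrm H (\<lambda>x. \<phi> x * h x) / q"
      using q by (subst nrm_scale[OF mult_bounded_if_pick_bound(1)[OF M h]]) (simp add: norm_divide)
    ultimately show ?thesis
      using q by (simp add: mult.left_commute pos_divide_le_eq q_def[symmetric])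
  qed
qed

lemma mult_norm_le:
  assumes "M \<ge> 0" and "\<And>h. h \<in> fns H \<Longrightarrow> nrm H (\<lambda>x. \<phi> x * h x) \<le> M * nrm H h"
  shows "mult_norm H \<phi> \<le> M"
  unfolding mult_norm_def
proof (rule cSup_least)
  show "{nrm H (\<lambda>x. \<phi> x * h x) | h. h \<in> fns H \<and> nrm H h \<le> 1} \<noteq> {}"
    using zero_mem nrm_zero by force
  fix r assume "r \<in> {nrm H (\<lambda>x. \<phi> x * h x) | h. h \<in> fns H \<and> nrm H h \<le> 1}"
  then obtain h where h: "h \<in> fns H" "nrm H h \<le> 1" "r = nrm H (\<lambda>x. \<phi> x * h x)" by blast
  show "r \<le> M" using assms(2)[OF h(1)] mult_left_mono[OF h(2) assms(1)] h(3) by simp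
qed

lemma mult_norm_ge_0:
  assumes "\<phi> \<in> Mult X H"
  shows "mult_norm H \<phi> \<ge> 0"
proof -
  obtain M where M: "M \<ge> 0" "pick_bound X K \<phi> M" using Mult_bounded[OF assms] by blast
  have "nrm H (\<lambda>x. \<phi> x * 0) \<le> mult_norm H \<phi>"
    unfolding mult_norm_def
  proof (rule cSup_upper)
    show "nrm H (\<lambda>x. \<phi> x * 0) \<in> {nrm H (\<lambda>x. \<phi> x * h x) | h. h \<in> fns H \<and> nrm H h \<le> 1}"
      using zero_mem nrm_zero by force
    show "bdd_above {nrm H (\<lambda>x. \<phi> x * h x) | h. h \<in> fns H \<and> nrm H h \<le> 1}"
      using mult_bounded_if_pick_bound(2)[OF M] mult_left_mono[OF _ M(1)]
      by (intro bdd_aboveI[of _ M]) fastforce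
  qed
  then show ?thesis by (simp add: nrm_zero)
qed

lemma mult_norm_le_iff:
  assumes "\<phi> \<in> Mult X H" "M \<ge> 0"
  shows "mult_norm H \<phi> \<le> M \<longleftrightarrow> pick_bound X K \<phi> M"
proof
  assume le: "mult_norm H \<phi> \<le> M"
  show "pick_bound X K \<phi> M"
  proof (rule pick_bound_if_mult_bounded[OF assms(2)])
    show "(\<lambda>x. \<phi> x * h x) \<in> fns H" if "h \<in> fns H" for h
      using assms(1) that by (simp add: Mult_def)
    show "nrm H (\<lambda>x. \<phi> x * h x) \<le> M * nrm H h" if "h \<in> fns H" for h
      using mult_norm_upper[OF assms(1) that] mult_right_mono[OF le nrm_ge_0[OF that]] by simp
  qed
next
  assume "pick_bound X K \<phi> M"
  then show "mult_norm H \<phi> \<le> M"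
    by (intro mult_norm_le mult_bounded_if_pick_bound(2) assms(2))
qed

lemma Mult_add: "\<phi> \<in> Mult X H \<Longrightarrow> \<psi> \<in> Mult X H \<Longrightarrow> (\<lambda>x. \<phi> x + \<psi> x) \<in> Mult X H"
  by (simp add: Mult_def fun_on_def distrib_right add_mem)

lemma Mult_scale: "\<phi> \<in> Mult X H \<Longrightarrow> (\<lambda>x. c * \<phi> x) \<in> Mult X H"
  by (simp add: Mult_def fun_on_def mult.assoc scale_mem)

lemma Mult_mult: "\<phi> \<in> Mult X H \<Longrightarrow> \<psi> \<in> Mult X H \<Longrightarrow> (\<lambda>x. \<phi> x * \<psi> x) \<in> Mult X H"
  by (simp add: Mult_def fun_on_def mult.assoc)

lemma Mult_one: "restr X (\<lambda>x. 1) \<in> Mult X H"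
proof -
  have "(\<lambda>x. restr X (\<lambda>x. 1) x * h x) = h" if "h \<in> fns H" for h
    using fns_fun_on[OF that] by (auto simp: fun_on_def restr_def)
  then show ?thesis by (simp add: Mult_def fun_on_def restr_def)
qed

text \<open>
  Pair \<open>\<phi> * K x\<close> with \<open>K x\<close>.
\<close>

lemma Mult_eval_bound:
  assumes \<phi>: "\<phi> \<in> Mult X H" and x: "x \<in> X" "K x x \<noteq> 0"
  shows "cmod (\<phi> x) \<le> mult_norm H \<phi>"
proof -
  note k = kernel_mem[OF x(1)]
  have \<phi>k: "(\<lambda>y. \<phi> y * K x y) \<in> fns H" using \<phi> k by (simp add: Mult_def)
  have kk: "K x x = of_real ((nrm H (K x))\<^sup>2)" using ip_self[OF k] reproducing[OF k x(1)] by simp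
  then have pos: "0 < (nrm H (K x))\<^sup>2" using x(2) by auto
  have "cmod (\<phi> x) * (nrm H (K x))\<^sup>2 = cmod (ip H (\<lambda>y. \<phi> y * K x y) (K x))"
    using reproducing[OF \<phi>k x(1)] kk by (simp add: norm_mult norm_power)
  also have "\<dots> \<le> nrm H (\<lambda>y. \<phi> y * K x y) * nrm H (K x)" by (rule Cauchy_Schwarz[OF \<phi>k k])
  also have "\<dots> \<le> mult_norm H \<phi> * nrm H (K x) * nrm H (K x)"
    by (intro mult_right_mono mult_norm_upper \<phi> k nrm_ge_0)
  finally have "cmod (\<phi> x) * (nrm H (K x))\<^sup>2 \<le> mult_norm H \<phi> * (nrm H (K x))\<^sup>2"
    by (simp add: power2_eq_square mult.assoc)
  then show ?thesis using pos by (rule mult_right_le_imp_le)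
qed

lemma mult_norm_add:
  assumes "\<phi> \<in> Mult X H" "\<psi> \<in> Mult X H"
  shows "mult_norm H (\<lambda>x. \<phi> x + \<psi> x) \<le> mult_norm H \<phi> + mult_norm H \<psi>"
proof (rule mult_norm_le)
  show "0 \<le> mult_norm H \<phi> + mult_norm H \<psi>" using mult_norm_ge_0 assms by simp
  fix h assume h: "h \<in> fns H"
  have "nrm H (\<lambda>x. (\<phi> x + \<psi> x) * h x) \<le> nrm H (\<lambda>x. \<phi> x * h x) + nrm H (\<lambda>x. \<psi> x * h x)"
    unfolding distrib_right using assms h by (intro nrm_triangle) (auto simp: Mult_def)
  also have "\<dots> \<le> (mult_norm H \<phi> + mult_norm H \<psi>) * nrm H h"
    unfolding distrib_right by (intro add_mono mult_norm_upper assms h)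
  finally show "nrm H (\<lambda>x. (\<phi> x + \<psi> x) * h x) \<le> (mult_norm H \<phi> + mult_norm H \<psi>) * nrm H h" .
qed

lemma mult_norm_scale:
  assumes \<phi>: "\<phi> \<in> Mult X H"
  shows "mult_norm H (\<lambda>x. c * \<phi> x) = cmod c * mult_norm H \<phi>"
proof -
  have le: "mult_norm H (\<lambda>x. c * \<phi> x) \<le> cmod c * mult_norm H \<phi>" if \<phi>: "\<phi> \<in> Mult X H" for c \<phi>
  proof (rule mult_norm_le)
    show "0 \<le> cmod c * mult_norm H \<phi>" using mult_norm_ge_0[OF \<phi>] by simp
    fix h assume h: "h \<in> fns H"
    have "nrm H (\<lambda>x. c * (\<phi> x * h x)) = cmod c * nrm H (\<lambda>x. \<phi> x * h x)"
      using \<phi> h by (intro nrm_scale) (simp add: Mult_def)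
    then show "nrm H (\<lambda>x. c * \<phi> x * h x) \<le> cmod c * mult_norm H \<phi> * nrm H h"
      using mult_left_mono[OF mult_norm_upper[OF \<phi> h], of "cmod c"] by (simp add: mult.assoc)
  qed
  show ?thesis
  proof (cases "c = 0")
    case True
    then show ?thesis using le[OF \<phi>, of c] mult_norm_ge_0[OF Mult_scale[OF \<phi>], of c] by simp
  next
    case False
    then have "(\<lambda>x. inverse c * (c * \<phi> x)) = \<phi>" by (simp add: fun_eq_iff mult.assoc[symmetric])
    then have "mult_norm H \<phi> \<le> inverse (cmod c) * mult_norm H (\<lambda>x. c * \<phi> x)"
      using le[OF Mult_scale[OF \<phi>], of "inverse c" c] by (simp add: norm_inverse)
    then have "cmod c * mult_norm H \<phi> \<le> mult_norm H (\<lambda>x. c * \<phi> x)"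
      using False by (simp add: field_simps)
    with le[OF \<phi>, of c] show ?thesis by simp
  qed
qed

lemma banach_Mult:
  assumes K: "\<And>x. x \<in> X \<Longrightarrow> K x x \<noteq> 0"
  shows "banach_fns (Mult X H) (mult_norm H)"
proof
  show "(\<lambda>x. 0) \<in> Mult X H" by (simp add: Mult_def fun_on_def zero_mem)
  fix s :: "nat \<Rightarrow> 'a \<Rightarrow> complex"
  assume s: "\<And>n. s n \<in> Mult X H"
    and C: "\<And>e. e > 0 \<Longrightarrow> \<exists>M. \<forall>m\<ge>M. \<forall>n\<ge>M. mult_norm H (\<lambda>x. s m x - s n x) < e"
  have sub: "(\<lambda>x. \<phi> x - \<psi> x) \<in> Mult X H" if "\<phi> \<in> Mult X H" "\<psi> \<in> Mult X H" for \<phi> \<psi>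
    using Mult_add[OF that(1) Mult_scale[OF that(2), of "-1"]] by simp
  have "\<exists>l. (\<lambda>n. s n w) \<longlonglongrightarrow> l" if w: "w \<in> X" for w
  proof -
    have "Cauchy (\<lambda>n. s n w)"
    proof (rule CauchyI)
      fix e :: real assume "e > 0"
      from C[OF this] obtain M where M: "\<And>m n. m \<ge> M \<Longrightarrow> n \<ge> M \<Longrightarrow> mult_norm H (\<lambda>x. s m x - s n x) < e"
        by blast
      have "cmod (s m w - s n w) < e" if "m \<ge> M" "n \<ge> M" for m n
        using Mult_eval_bound[OF sub[OF s s] w K[OF w], of m n] M[OF that] by simp
      then show "\<exists>M. \<forall>m\<ge>M. \<forall>n\<ge>M. cmod (s m w - s n w) < e" by blast
    qed
    then show ?thesis by (simp add: Cauchy_convergent_iff convergent_def)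
  qed
  then obtain l where l: "\<And>w. w \<in> X \<Longrightarrow> (\<lambda>n. s n w) \<longlonglongrightarrow> l w" by metis
  define h where "h w = (if w \<in> X then l w else 0)" for w
  have h_lim: "(\<lambda>n. s n w) \<longlonglongrightarrow> h w" if "w \<in> X" for w using l that by (simp add: h_def)
  have lim: "(\<lambda>x. s n x - h x) \<in> Mult X H \<and> mult_norm H (\<lambda>x. s n x - h x) \<le> B"
    if "B \<ge> 0" and B: "\<And>m. m \<ge> M \<Longrightarrow> mult_norm H (\<lambda>x. s n x - s m x) \<le> B" for n M B
  proof -
    have "pick_bound X K (\<lambda>x. s n x - h x) B"
      unfolding pick_bound_def
    proof (intro allI impI)
      fix S :: "'a set" and c assume S: "finite S" "S \<subseteq> X"
      show "Re (quad K S (\<lambda>w. cnj (s n w - h w) * c w)) \<le> B\<^sup>2 * Re (quad K S c)"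
      proof (rule Lim_bounded)
        show "(\<lambda>m. Re (quad K S (\<lambda>w. cnj (s n w - s m w) * c w))) \<longlonglongrightarrow> Re (quad K S (\<lambda>w. cnj (s n w - h w) * c w))"
          unfolding quad_def using S by (intro tendsto_intros h_lim) auto
        have "pick_bound X K (\<lambda>x. s n x - s m x) B" if "m \<ge> M" for m
          using mult_norm_le_iff[OF sub[OF s s] \<open>B \<ge> 0\<close>] B[OF that] by simp
        then show "\<forall>m\<ge>M. Re (quad K S (\<lambda>w. cnj (s n w - s m w) * c w)) \<le> B\<^sup>2 * Re (quad K S c)"
          using S unfolding pick_bound_def by blast
      qed
    qed
    moreover have "fun_on X (\<lambda>x. s n x - h x)" using s[of n] by (simp add: Mult_def fun_on_def h_def)
    ultimately have "(\<lambda>x. s n x - h x) \<in> Mult X H" using \<open>B \<ge> 0\<close> Mult_iff by blast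
    with \<open>pick_bound X K (\<lambda>x. s n x - h x) B\<close> show ?thesis using mult_norm_le_iff \<open>B \<ge> 0\<close> by blast
  qed
  have small: "\<exists>M. \<forall>n\<ge>M. (\<lambda>x. s n x - h x) \<in> Mult X H \<and> mult_norm H (\<lambda>x. s n x - h x) \<le> e" if e: "e > 0" for e
  proof -
    obtain M where M: "\<And>m n. m \<ge> M \<Longrightarrow> n \<ge> M \<Longrightarrow> mult_norm H (\<lambda>x. s m x - s n x) < e"
      using C[OF e] by blast
    show ?thesis using lim[of e M] e M by (meson less_imp_le)
  qed
  obtain n where "(\<lambda>x. s n x - h x) \<in> Mult X H" using small[of 1] by auto
  then have h: "h \<in> Mult X H" using sub[OF s, of "\<lambda>x. s n x - h x" n] by simp
  have "(\<lambda>n. mult_norm H (\<lambda>x. s n x - h x)) \<longlonglongrightarrow> 0"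
  proof (rule LIMSEQ_I)
    fix e :: real assume e: "e > 0"
    then obtain M where M: "\<And>n. n \<ge> M \<Longrightarrow> mult_norm H (\<lambda>x. s n x - h x) \<le> e / 2"
      using small[of "e / 2"] by auto
    have "norm (mult_norm H (\<lambda>x. s n x - h x) - 0) < e" if "n \<ge> M" for n
      using M[OF that] mult_norm_ge_0[OF sub[OF s h], of n] e by simp
    then show "\<exists>M. \<forall>n\<ge>M. norm (mult_norm H (\<lambda>x. s n x - h x) - 0) < e" by blast
  qed
  with h show "\<exists>h\<in>Mult X H. (\<lambda>n. mult_norm H (\<lambda>x. s n x - h x)) \<longlonglongrightarrow> 0" by blast
qed (auto simp: Mult_add Mult_scale mult_norm_ge_0 mult_norm_add mult_norm_scale)

end

text \<open>
  Uniform boundedness on the Banach space of multipliers with the norm of \<open>A\<close>. The norm of \<open>B\<close> is the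
  supremum of seminorms that involve finitely many values of \<open>\<phi>\<close>, and point evaluations are bounded
  in the norm of \<open>A\<close>.
\<close>

lemma mult_norm_dominated:
  assumes A: "is_rkhs X K A" and B: "is_rkhs X L B" and eq: "Mult X A = Mult X B"
    and K: "\<And>x. x \<in> X \<Longrightarrow> K x x \<noteq> 0"
  shows "\<exists>C\<ge>0. \<forall>\<phi>\<in>Mult X A. mult_norm B \<phi> \<le> C * mult_norm A \<phi>"
proof -
  interpret A: rkhs_space X K A by unfold_locales fact
  interpret B: rkhs_space X L B by unfold_locales fact
  interpret banach_fns "Mult X A" "mult_norm A" by (rule A.banach_Mult[OF K])
  define tw where "tw S c \<phi> = comb L S (\<lambda>w. cnj (\<phi> w) * c w)" for S c \<phi>
  define p where "p = (\<lambda>(S, c) \<phi>. nrm B (tw S c \<phi>) / nrm B (comb L S c))"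
  define P where "P = p ` {(S, c). finite S \<and> S \<subseteq> X}"
  have tw_mem: "tw S c \<phi> \<in> fns B" if "S \<subseteq> X" for S c \<phi>
    unfolding tw_def by (rule B.comb_mem[OF that])
  have tw_add: "tw S c (\<lambda>x. \<phi> x + \<psi> x) = (\<lambda>x. tw S c \<phi> x + tw S c \<psi> x)" for S c \<phi> \<psi>
    by (simp add: tw_def comb_def distrib_left distrib_right sum.distrib)
  have tw_scale: "tw S c (\<lambda>x. t * \<phi> x) = (\<lambda>x. cnj t * tw S c \<phi> x)" for S c \<phi> t
    by (simp add: tw_def comb_def sum_distrib_left mult_ac)
  have tw_le: "nrm B (tw S c \<phi>) \<le> mult_norm B \<phi> * nrm B (comb L S c)"
    if "\<phi> \<in> Mult X A" "finite S" "S \<subseteq> X" for S c \<phi>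
    using that B.mult_norm_le_iff[of \<phi> "mult_norm B \<phi>"] B.mult_norm_ge_0[of \<phi>]
      B.pick_bound_iff[of "mult_norm B \<phi>" \<phi>] unfolding eq tw_def by blast
  have "\<exists>C\<ge>0. \<forall>q\<in>P. \<forall>\<phi>\<in>Mult X A. q \<phi> \<le> C * mult_norm A \<phi>"
  proof (rule uniform_boundedness)
    fix q assume "q \<in> P"
    then obtain S c where S: "finite S" "S \<subseteq> X" and q: "q = p (S, c)" by (auto simp: P_def)
    note n = B.nrm_ge_0[OF B.comb_mem[OF S(2), of c]]
    show "seminorm_on (Mult X A) q"
      unfolding seminorm_on_def q p_def prod.case tw_add tw_scale B.nrm_scale[OF tw_mem[OF S(2)]]
      using n by (auto simp: B.nrm_ge_0 tw_mem S add_divide_distrib[symmetric]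
          intro!: divide_right_mono B.nrm_triangle)
    have "q \<phi> \<le> (\<Sum>w\<in>S. cmod (c w) * nrm B (L w)) / nrm B (comb L S c) * mult_norm A \<phi>" if \<phi>: "\<phi> \<in> Mult X A" for \<phi>
    proof -
      have "nrm B (comb L T (\<lambda>w. cnj (\<phi> w) * c w)) \<le> (\<Sum>w\<in>T. cmod (c w) * nrm B (L w)) * mult_norm A \<phi>"
        if "finite T" "T \<subseteq> X" for T
        using that
      proof (induction T)
        case empty
        then show ?case by (simp add: comb_def B.nrm_zero)
      next
        case (insert w T)
        then have w: "w \<in> X" "T \<subseteq> X" by auto
        have "comb L (insert w T) (\<lambda>w. cnj (\<phi> w) * c w)
            = (\<lambda>x. (cnj (\<phi> w) * c w) * L w x + comb L T (\<lambda>w. cnj (\<phi> w) * c w) x)"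
          using insert by (simp add: comb_def)
        then have "nrm B (comb L (insert w T) (\<lambda>w. cnj (\<phi> w) * c w))
            \<le> cmod (cnj (\<phi> w) * c w) * nrm B (L w) + nrm B (comb L T (\<lambda>w. cnj (\<phi> w) * c w))"
          using B.nrm_triangle[OF B.scale_mem[OF B.kernel_mem[OF w(1)]] B.comb_mem[OF w(2)]]
          by (simp add: B.nrm_scale B.kernel_mem w(1))
        also have "cmod (cnj (\<phi> w) * c w) * nrm B (L w) \<le> cmod (c w) * nrm B (L w) * mult_norm A \<phi>"
          using mult_right_mono[OF A.Mult_eval_bound[OF \<phi> w(1) K[OF w(1)]], of "cmod (c w) * nrm B (L w)"]
            B.nrm_ge_0[OF B.kernel_mem[OF w(1)]] by (simp add: norm_mult mult_ac)
        finally show ?case using insert w by (simp add: distrib_right)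
      qed
      from divide_right_mono[OF this[OF S] n] show ?thesis by (simp add: q p_def tw_def)
    qed
    then show "\<exists>C. \<forall>\<phi>\<in>Mult X A. q \<phi> \<le> C * mult_norm A \<phi>" by blast
  next
    fix \<phi> assume \<phi>: "\<phi> \<in> Mult X A"
    have "q \<phi> \<le> mult_norm B \<phi>" if "q \<in> P" for q
      using that tw_le[OF \<phi>] B.nrm_ge_0[OF B.comb_mem] B.mult_norm_ge_0[OF \<phi>[unfolded eq]]
      by (auto simp: P_def p_def divide_le_eq less_le)
    then show "\<exists>B. \<forall>q\<in>P. q \<phi> \<le> B" by blast
  qed
  then obtain C where C: "C \<ge> 0" "\<And>q \<phi>. q \<in> P \<Longrightarrow> \<phi> \<in> Mult X A \<Longrightarrow> q \<phi> \<le> C * mult_norm A \<phi>" by blast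
  have "mult_norm B \<phi> \<le> C * mult_norm A \<phi>" if \<phi>: "\<phi> \<in> Mult X A" for \<phi>
  proof -
    have C0: "0 \<le> C * mult_norm A \<phi>" using C(1) A.mult_norm_ge_0[OF \<phi>] by simp
    have "nrm B (tw S c \<phi>) \<le> C * mult_norm A \<phi> * nrm B (comb L S c)" if S: "finite S" "S \<subseteq> X" for S c
    proof (cases "nrm B (comb L S c) = 0")
      case True
      then show ?thesis using tw_le[OF \<phi> S, of c] by simp
    next
      case False
      have "p (S, c) \<in> P" using S by (auto simp: P_def)
      from C(2)[OF this \<phi>] show ?thesis
        using False B.nrm_ge_0[OF B.comb_mem[OF S(2), of c]] by (simp add: p_def divide_le_eq)
    qed
    then have "pick_bound X L \<phi> (C * mult_norm A \<phi>)"
      unfolding B.pick_bound_iff[OF C0] tw_def by blast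
    then show ?thesis using B.mult_norm_le_iff[OF \<phi>[unfolded eq] C0] by simp
  qed
  with C(1) show ?thesis by blast
qed

section \<open>Positive kernels and the Hermitian form of the ball\<close>

lemma quad_cong:
  assumes "\<And>w z. w \<in> S \<Longrightarrow> z \<in> S \<Longrightarrow> K w z = L w z"
  shows "quad K S c = quad L S c"
  unfolding quad_def using assms by (intro sum.cong) auto

lemma psd_cong:
  assumes "\<And>w z. w \<in> X \<Longrightarrow> z \<in> X \<Longrightarrow> K w z = L w z"
  shows "psd X K \<longleftrightarrow> psd X L"
proof -
  have "psd X L" if "psd X K" and eq: "\<And>w z. w \<in> X \<Longrightarrow> z \<in> X \<Longrightarrow> K w z = L w z" for K L
    unfolding psd_def
  proof (intro conjI ballI allI impI)
    show "L v w = cnj (L w v)" if "w \<in> X" "v \<in> X" for w v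
      using psd_cnj[OF \<open>psd X K\<close> that] eq that by metis
    show "0 \<le> Re (quad L S c)" if "finite S" "S \<subseteq> X" for S c
    proof -
      have "quad K S c = quad L S c" by (rule quad_cong) (use eq that(2) in auto)
      with psd_quad_ge_0[OF \<open>psd X K\<close> that, of c] show ?thesis by simp
    qed
  qed
  from this[of K L] this[of L K] show ?thesis using assms by metis
qed

lemma psd_add:
  assumes "psd X K" "psd X L"
  shows "psd X (\<lambda>w z. K w z + L w z)"
proof -
  have "quad (\<lambda>w z. K w z + L w z) S c = quad K S c + quad L S c" for S c
    by (simp add: quad_def distrib_left sum.distrib)
  moreover have "K v w + L v w = cnj (K w v + L w v)" if "w \<in> X" "v \<in> X" for w v
    unfolding complex_cnj_add psd_cnj[OF assms(1) that] psd_cnj[OF assms(2) that] ..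
  ultimately show ?thesis
    unfolding psd_def using psd_quad_ge_0[OF assms(1)] psd_quad_ge_0[OF assms(2)] by simp
qed

lemma quad_twist: "quad (\<lambda>w z. cnj (p w) * p z * K w z) S c = quad K S (\<lambda>w. cnj (p w) * c w)"
  by (simp add: quad_def mult_ac)

lemma psd_twist:
  assumes "psd X K"
  shows "psd X (\<lambda>w z. cnj (p w) * p z * K w z)"
  unfolding psd_def quad_twist
proof (intro conjI ballI allI impI)
  show "cnj (p v) * p w * K v w = cnj (cnj (p w) * p v * K w v)" if "w \<in> X" "v \<in> X" for w v
    unfolding complex_cnj_mult psd_cnj[OF assms that] by simp
qed (rule psd_quad_ge_0[OF assms])

lemma psd_zero: "psd X (\<lambda>w z. 0)"
  by (simp add: psd_def quad_def)

lemma psd_sum: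
  assumes "\<And>i. i \<in> I \<Longrightarrow> psd X (K i)"
  shows "psd X (\<lambda>w z. \<Sum>i\<in>I. K i w z)"
  using assms by (induction I rule: infinite_finite_induct) (auto intro: psd_zero psd_add)

lemma psd_one: "psd X (\<lambda>w z. 1)"
proof -
  have "quad (\<lambda>w z. 1) S c = of_real ((cmod (\<Sum>w\<in>S. c w))\<^sup>2)" for S and c :: "'a \<Rightarrow> complex"
    unfolding complex_norm_square by (simp add: quad_def sum_product)
  then show ?thesis by (simp add: psd_def del: of_real_power)
qed

lemma psd_limit:
  assumes K: "\<And>n::nat. psd X (K n)"
    and lim: "\<And>w z. w \<in> X \<Longrightarrow> z \<in> X \<Longrightarrow> (\<lambda>n. K n w z) \<longlonglongrightarrow> L w z"
  shows "psd X L"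
  unfolding psd_def
proof (intro conjI ballI allI impI)
  show "L v w = cnj (L w v)" if "w \<in> X" "v \<in> X" for w v
  proof (rule LIMSEQ_unique)
    show "(\<lambda>n. K n v w) \<longlonglongrightarrow> L v w" by (intro lim that)
    have "(\<lambda>n. cnj (K n w v)) \<longlonglongrightarrow> cnj (L w v)" by (intro tendsto_cnj lim that)
    then show "(\<lambda>n. K n v w) \<longlonglongrightarrow> cnj (L w v)" by (simp add: psd_cnj[OF K that])
  qed
  show "0 \<le> Re (quad L S c)" if S: "finite S" "S \<subseteq> X" for S c
  proof (rule LIMSEQ_le_const)
    show "(\<lambda>n. Re (quad (K n) S c)) \<longlonglongrightarrow> Re (quad L S c)"
      unfolding quad_def using S by (intro tendsto_intros lim) auto
    show "\<exists>N. \<forall>n\<ge>N. 0 \<le> Re (quad (K n) S c)" using psd_quad_ge_0[OF K S] by blast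
  qed
qed

lemma (in inner_fun_space) quad_Gram:
  assumes "\<And>z. z \<in> S \<Longrightarrow> h z \<in> fns H"
  shows "quad (\<lambda>z w. ip H (h z) (h w)) S t = of_real ((nrm H (\<lambda>x. \<Sum>z\<in>S. t z * h z x))\<^sup>2)"
  using assms
  by (simp add: ip_self[symmetric] sum_mem ip_sum_left ip_sum_right quad_def sum_distrib_left mult_ac
      del: of_real_power cong: sum.cong)

lemma (in inner_fun_space) psd_Gram:
  assumes "\<And>z. z \<in> Y \<Longrightarrow> h z \<in> fns H"
  shows "psd Y (\<lambda>z w. ip H (h z) (h w))"
proof -
  have "0 \<le> Re (quad (\<lambda>z w. ip H (h z) (h w)) S t)" if "S \<subseteq> Y" for S t
    using assms that by (subst quad_Gram) auto
  moreover have "ip H (h v) (h w) = cnj (ip H (h w) (h v))" if "w \<in> Y" "v \<in> Y" for w v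
    by (rule ip_cnj) (use assms that in auto)
  ultimately show ?thesis unfolding psd_def by blast
qed

lemma herm_cnj: "cnj (herm z w) = herm w z"
  by (simp add: herm_def mult.commute)

lemma herm_mult: "herm x z * t = (\<Sum>i\<in>UNIV. x $ i * (cnj (z $ i) * t))"
  by (simp add: herm_def sum_distrib_right mult.assoc)

lemma cmod_herm_le: "cmod (herm z w) \<le> norm z * norm w"
proof -
  have "cmod (herm z w) \<le> (\<Sum>j\<in>UNIV. \<bar>cmod (z $ j)\<bar> * \<bar>cmod (w $ j)\<bar>)"
    unfolding herm_def by (rule order_trans[OF norm_sum]) (simp add: norm_mult)
  also have "\<dots> \<le> norm z * norm w"
    unfolding norm_vec_def by (rule L2_set_mult_ineq)
  finally show ?thesis .
qed

lemma herm_self: "herm z z = of_real ((norm z)\<^sup>2)"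
  unfolding herm_def norm_vec_def L2_set_def
  by (simp add: sum_nonneg complex_norm_square[symmetric] of_real_sum[symmetric] del: of_real_power of_real_sum)

lemma cmod_herm_less_1:
  assumes "norm z < 1" "norm w \<le> 1"
  shows "cmod (herm z w) < 1"
proof -
  have "norm z * norm w \<le> norm z * 1" using assms by (intro mult_left_mono) auto
  with cmod_herm_le[of z w] assms show ?thesis by linarith
qed

lemma psd_mult_herm:
  assumes "psd X P"
  shows "psd X (\<lambda>w z. P w z * herm (b z) (b w))"
proof -
  have "psd X (\<lambda>w z. \<Sum>j\<in>UNIV. cnj (b w $ j) * (b z $ j) * P w z)"
    by (intro psd_sum psd_twist assms)
  then show ?thesis by (simp add: herm_def sum_distrib_left mult_ac)
qed

text \<open>
  The special case of the Schur product theorem in which one factor is a Drury-Arveson kernel: expand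
  it in a geometric series, where each power of \<open>herm\<close> is a sum of rank one kernels.
\<close>

lemma psd_divide_one_minus_herm:
  assumes P: "psd X P" and b: "\<And>x. x \<in> X \<Longrightarrow> norm (b x) < 1"
  shows "psd X (\<lambda>w z. P w z / (1 - herm (b z) (b w)))"
proof (rule psd_limit)
  have "psd X (\<lambda>w z. P w z * herm (b z) (b w) ^ n)" for n
  proof (induction n)
    case (Suc n)
    from psd_mult_herm[OF this, of b] show ?case by (simp add: mult_ac)
  qed (simp add: P)
  then show "psd X (\<lambda>w z. \<Sum>k<n. P w z * herm (b z) (b w) ^ k)" for n
    by (rule psd_sum)
  fix w z assume "w \<in> X" "z \<in> X"
  then have "cmod (herm (b z) (b w)) < 1" by (intro cmod_herm_less_1) (auto simp: b less_imp_le)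
  then have "(\<lambda>k. P w z * herm (b z) (b w) ^ k) sums (P w z * (1 / (1 - herm (b z) (b w))))"
    by (intro sums_mult geometric_sums)
  then show "(\<lambda>n. \<Sum>k<n. P w z * herm (b z) (b w) ^ k) \<longlonglongrightarrow> P w z / (1 - herm (b z) (b w))"
    by (simp add: sums_def)
qed

lemma one_minus_herm_nonzero:
  assumes "norm z < 1" "norm w \<le> 1"
  shows "1 - herm z w \<noteq> 0"
  using cmod_herm_less_1[OF assms] by auto

lemma da_kernel_eq: "norm z < 1 \<Longrightarrow> da_kernel w z = 1 / (1 - herm z w)"
  by (simp add: da_kernel_def restr_def)

lemma psd_restr: "psd X (\<lambda>w. restr X (K w)) \<longleftrightarrow> psd X K"
  by (rule psd_cong) (simp add: restr_def)

lemma psd_kernel_restr: "psd X K \<Longrightarrow> psd_kernel X (\<lambda>w. restr X (K w))"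
  by unfold_locales (simp add: psd_restr, simp add: fun_on_def restr_def)

lemma psd_kernel_da: "psd_kernel (ball 0 1) (da_kernel :: complex ^ 'n \<Rightarrow> _)"
proof -
  have "psd (ball 0 1) (\<lambda>w z :: complex ^ 'n. 1 / (1 - herm z w))"
    using psd_divide_one_minus_herm[OF psd_one, of "ball 0 1" "\<lambda>x. x"] by simp
  from psd_kernel_restr[OF this] show ?thesis by (simp add: da_kernel_def[abs_def])
qed

section \<open>The Leech factorization theorem\<close>

lemma two_term_Cauchy_Schwarz:
  fixes a b c d :: real
  shows "a * b + c * d \<le> sqrt (a\<^sup>2 + c\<^sup>2) * sqrt (b\<^sup>2 + d\<^sup>2)"
proof -
  have "(a * b + c * d)\<^sup>2 \<le> (a\<^sup>2 + c\<^sup>2) * (b\<^sup>2 + d\<^sup>2)"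
    using zero_le_power2[of "a * d - c * b"] by (simp add: power2_eq_square algebra_simps)
  then show ?thesis unfolding real_sqrt_mult[symmetric] by (rule real_le_rsqrt)
qed

lemma quad_rank_one: "quad (\<lambda>w z. a z * cnj (a w)) S d = of_real ((cmod (pair S d a))\<^sup>2)"
  unfolding complex_norm_square
  by (simp add: quad_def pair_def sum_product mult_ac) (rule sum.swap)

lemma psd_rank_one: "psd X (\<lambda>w z. a z * cnj (a w))"
  using psd_twist[OF psd_one, of X a] by (simp add: mult.commute)

lemma quad_add: "quad (\<lambda>w z. K w z + L w z) S c = quad K S c + quad L S c"
  by (simp add: quad_def distrib_left sum.distrib)

lemma quad_sum: "quad (\<lambda>w z. \<Sum>i\<in>I. K i w z) S c = (\<Sum>i\<in>I. quad (K i) S c)"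
  by (induction I rule: infinite_finite_induct) (simp_all add: quad_add, simp_all add: quad_def)

text \<open>
  The half of the description of the space of a sum of kernels that says which functions it
  contains: if \<open>N = \<Sum>\<^sub>j \<alpha>\<^sub>j \<alpha>\<^sub>j\<^sup>* + \<Sum>\<^sub>i p\<^sub>i p\<^sub>i\<^sup>* L\<close>, then the map
  \<open>(c, v) \<mapsto> \<Sum>\<^sub>j c\<^sub>j \<alpha>\<^sub>j + \<Sum>\<^sub>i p\<^sub>i v\<^sub>i\<close> is a contraction into the space of \<open>N\<close>.
\<close>

lemma sum_kernel_member:
  fixes \<alpha> :: "'j::finite \<Rightarrow> 'a \<Rightarrow> complex" and p :: "'i::finite \<Rightarrow> 'a \<Rightarrow> complex"
    and c :: "'j \<Rightarrow> complex"
  assumes HL: "is_rkhs X L HL" and HN: "is_rkhs X N HN"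
    and N: "\<And>w z. w \<in> X \<Longrightarrow> z \<in> X \<Longrightarrow>
      N w z = (\<Sum>j\<in>UNIV. \<alpha> j z * cnj (\<alpha> j w)) + (\<Sum>i\<in>UNIV. cnj (p i w) * p i z * L w z)"
    and v: "\<And>i. v i \<in> fns HL"
  defines "g \<equiv> restr X (\<lambda>z. (\<Sum>j\<in>UNIV. c j * \<alpha> j z) + (\<Sum>i\<in>UNIV. p i z * v i z))"
  shows "g \<in> fns HN" "(nrm HN g)\<^sup>2 \<le> (\<Sum>j\<in>UNIV. (cmod (c j))\<^sup>2) + (\<Sum>i\<in>UNIV. (nrm HL (v i))\<^sup>2)"
proof -
  interpret L: rkhs_space X L HL by unfold_locales fact
  interpret N: rkhs_space X N HN by unfold_locales fact
  define B where "B = sqrt ((\<Sum>j\<in>UNIV. (cmod (c j))\<^sup>2) + (\<Sum>i\<in>UNIV. (nrm HL (v i))\<^sup>2))"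
  have B2: "B\<^sup>2 = (\<Sum>j\<in>UNIV. (cmod (c j))\<^sup>2) + (\<Sum>i\<in>UNIV. (nrm HL (v i))\<^sup>2)"
    unfolding B_def by (intro real_sqrt_pow2 add_nonneg_nonneg sum_nonneg) auto
  have B0: "B \<ge> 0" unfolding B_def by (intro real_sqrt_ge_zero add_nonneg_nonneg sum_nonneg) auto
  have "g \<in> fns HN \<and> nrm HN g \<le> B"
    unfolding N.mem_iff_pair_bound[OF B0]
  proof (intro conjI allI impI)
    show "fun_on X g" by (simp add: g_def fun_on_def restr_def)
    fix S :: "'a set" and d assume S: "finite S" "S \<subseteq> X"
    define a where "a j = pair S d (\<alpha> j)" for j
    define y where "y i = nrm HL (comb L S (\<lambda>w. cnj (p i w) * d w))" for i
    have "pair S d g = pair S d (\<lambda>z. (\<Sum>j\<in>UNIV. c j * \<alpha> j z) + (\<Sum>i\<in>UNIV. p i z * v i z))"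
      unfolding pair_def using S by (intro sum.cong) (auto simp: g_def restr_def)
    also have "\<dots> = (\<Sum>j\<in>UNIV. c j * a j) + (\<Sum>i\<in>UNIV. pair S d (\<lambda>z. p i z * v i z))"
      unfolding pair_def a_def sum_distrib_left distrib_left sum.distrib
      by (intro arg_cong2[of _ _ _ _ "(+)"]; subst sum.swap) (simp_all add: mult_ac)
    finally have "cmod (pair S d g)
        \<le> (\<Sum>j\<in>UNIV. cmod (c j) * cmod (a j)) + (\<Sum>i\<in>UNIV. cmod (pair S d (\<lambda>z. p i z * v i z)))"
      by (auto intro!: order_trans[OF norm_triangle_ineq] add_mono order_trans[OF norm_sum] simp: norm_mult)
    also have "\<dots> \<le> (\<Sum>j\<in>UNIV. \<bar>cmod (c j)\<bar> * \<bar>cmod (a j)\<bar>) + (\<Sum>i\<in>UNIV. \<bar>nrm HL (v i)\<bar> * \<bar>y i\<bar>)"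
    proof (intro add_mono sum_mono)
      show "cmod (pair S d (\<lambda>z. p i z * v i z)) \<le> \<bar>nrm HL (v i)\<bar> * \<bar>y i\<bar>" for i
        using L.Cauchy_Schwarz[OF v[of i] L.comb_mem[OF S(2), of "\<lambda>w. cnj (p i w) * d w"]]
        unfolding L.ip_comb[OF v S(2)] L.pair_mult[of S d "p i" "v i"] y_def
        by (meson abs_ge_self abs_ge_zero mult_mono order_trans L.nrm_ge_0 L.comb_mem S(2) v)
    qed auto
    also have "\<dots> \<le> L2_set (\<lambda>j. cmod (c j)) UNIV * L2_set (\<lambda>j. cmod (a j)) UNIV
        + L2_set (\<lambda>i. nrm HL (v i)) UNIV * L2_set y UNIV"
      by (intro add_mono L2_set_mult_ineq)
    also have "\<dots> \<le> B * sqrt ((\<Sum>j\<in>UNIV. (cmod (a j))\<^sup>2) + (\<Sum>i\<in>UNIV. (y i)\<^sup>2))"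
      by (rule order_trans[OF two_term_Cauchy_Schwarz]) (simp add: L2_set_def B_def sum_nonneg)
    also have "sqrt ((\<Sum>j\<in>UNIV. (cmod (a j))\<^sup>2) + (\<Sum>i\<in>UNIV. (y i)\<^sup>2)) = nrm HN (comb N S d)"
    proof -
      have "quad N S d = quad (\<lambda>w z. (\<Sum>j\<in>UNIV. \<alpha> j z * cnj (\<alpha> j w)) +
          (\<Sum>i\<in>UNIV. cnj (p i w) * p i z * L w z)) S d"
        using S by (intro quad_cong N) auto
      also have "Re \<dots> = (\<Sum>j\<in>UNIV. (cmod (a j))\<^sup>2) + (\<Sum>i\<in>UNIV. (y i)\<^sup>2)"
        by (simp add: quad_add quad_sum quad_twist quad_rank_one a_def y_def L.nrm_comb S del: of_real_power)
      finally have "(nrm HN (comb N S d))\<^sup>2 = (\<Sum>j\<in>UNIV. (cmod (a j))\<^sup>2) + (\<Sum>i\<in>UNIV. (y i)\<^sup>2)"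
        by (simp add: N.nrm_comb S)
      then show ?thesis using N.nrm_ge_0[OF N.comb_mem[OF S(2)]] by (metis real_sqrt_unique)
    qed
    finally show "cmod (pair S d g) \<le> B * nrm HN (comb N S d)" .
  qed
  then show "g \<in> fns HN" "(nrm HN g)\<^sup>2 \<le> (\<Sum>j\<in>UNIV. (cmod (c j))\<^sup>2) + (\<Sum>i\<in>UNIV. (nrm HL (v i))\<^sup>2)"
    unfolding B2[symmetric] using N.nrm_ge_0 by (auto intro: power_mono)
qed

lemma (in rkhs_space) nrm_power2_le:
  assumes h: "h \<in> fns H"
    and le: "\<And>S c. finite S \<Longrightarrow> S \<subseteq> X \<Longrightarrow> 2 * Re (pair S c h) - (nrm H (comb K S c))\<^sup>2 \<le> B"
  shows "(nrm H h)\<^sup>2 \<le> B"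
proof -
  have B: "B \<ge> 0" using le[of "{}"] by (simp add: pair_def comb_def nrm_zero)
  have "cmod (pair S c h) \<le> sqrt B * nrm H (comb K S c)" if S: "finite S" "S \<subseteq> X" for S c
  proof -
    have "(cmod (pair S c h))\<^sup>2 \<le> B * Re (quad K S c)"
      by (rule pair_bound_if_dual_value_bound[OF psd_kernel.psd[OF psd_kernel] S])
        (use le[OF S] in \<open>simp add: dual_value_def nrm_comb S\<close>)
    then have "(cmod (pair S c h))\<^sup>2 \<le> (sqrt B * nrm H (comb K S c))\<^sup>2"
      using B by (simp add: power_mult_distrib nrm_comb S)
    then show ?thesis by (rule power2_le_imp_le) (simp add: B nrm_ge_0 comb_mem S)
  qed
  then have "nrm H h \<le> sqrt B"
    using mem_iff_pair_bound[of "sqrt B" h] B fns_fun_on[OF h] by simp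
  then have "(nrm H h)\<^sup>2 \<le> (sqrt B)\<^sup>2" by (intro power_mono nrm_ge_0 h)
  then show ?thesis using B by simp
qed

text \<open>
  A lurking isometry argument. With \<open>L\<close> the positive kernel of the hypothesis, the kernel \<open>N\<close> has two
  expressions, \<open>\<theta> \<theta>\<^sup>* + L\<close> and \<open>\<Sum>\<^sub>j \<alpha>\<^sub>j \<alpha>\<^sub>j\<^sup>* + \<langle>z, w\<rangle> L\<close>. The second yields a contraction from
  \<open>\<complex>\<^sup>J \<oplus> (\<complex>\<^sup>n \<otimes> HL)\<close> to \<open>HN\<close>, and the first, by taking adjoints, a contraction from \<open>HN\<close> to \<open>\<complex> \<oplus> HL\<close>.
  Their composition is the system matrix of a contractive transfer function, whose entries are
  the complex conjugates of the required \<open>\<psi>\<^sub>j\<close>.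
\<close>

locale Leech =
  fixes V :: "(complex ^ 'n) set" and \<alpha> :: "'j::finite \<Rightarrow> complex ^ 'n \<Rightarrow> complex"
    and \<theta> :: "complex ^ 'n \<Rightarrow> complex"
  assumes V: "V \<subseteq> ball 0 1"
    and positive: "psd V (\<lambda>w z. ((\<Sum>j\<in>UNIV. \<alpha> j z * cnj (\<alpha> j w)) - \<theta> z * cnj (\<theta> w)) / (1 - herm z w))"
begin

definition L :: "complex ^ 'n \<Rightarrow> complex ^ 'n \<Rightarrow> complex" where
  "L w = restr V (\<lambda>z. ((\<Sum>j\<in>UNIV. \<alpha> j z * cnj (\<alpha> j w)) - \<theta> z * cnj (\<theta> w)) / (1 - herm z w))"

definition N :: "complex ^ 'n \<Rightarrow> complex ^ 'n \<Rightarrow> complex" where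
  "N w = restr V (\<lambda>z. \<theta> z * cnj (\<theta> w) + L w z)"

abbreviation "HL \<equiv> rkhs V L"
abbreviation "HN \<equiv> rkhs V N"

lemma is_rkhs_L: "is_rkhs V L HL"
  unfolding L_def[abs_def] by (intro is_rkhs_rkhs psd_kernel_restr positive)

lemma is_rkhs_N: "is_rkhs V N HN"
proof -
  have "psd V L" using psd_restr[THEN iffD2, OF positive] by (simp add: L_def[abs_def])
  then have "psd V (\<lambda>w z. \<theta> z * cnj (\<theta> w) + L w z)" by (intro psd_add psd_rank_one)
  then show ?thesis unfolding N_def[abs_def] by (intro is_rkhs_rkhs psd_kernel_restr)
qed

sublocale HL: rkhs_space V L HL by unfold_locales (rule is_rkhs_L)
sublocale HN: rkhs_space V N HN by unfold_locales (rule is_rkhs_N)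

lemma N_eq1:
  assumes "w \<in> V" "z \<in> V"
  shows "N w z = (\<Sum>j\<in>(UNIV :: unit set). \<theta> z * cnj (\<theta> w)) + (\<Sum>i\<in>(UNIV :: unit set). cnj 1 * 1 * L w z)"
  using assms by (simp add: N_def restr_def)

lemma N_eq2:
  assumes "w \<in> V" "z \<in> V"
  shows "N w z = (\<Sum>j\<in>UNIV. \<alpha> j z * cnj (\<alpha> j w)) + (\<Sum>i\<in>UNIV. cnj (w $ i) * (z $ i) * L w z)"
proof -
  have "norm z < 1" "norm w < 1" using assms V by auto
  then have "1 - herm z w \<noteq> 0" by (intro one_minus_herm_nonzero) auto
  then have "L w z * (1 - herm z w) = (\<Sum>j\<in>UNIV. \<alpha> j z * cnj (\<alpha> j w)) - \<theta> z * cnj (\<theta> w)"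
    using assms by (simp add: L_def restr_def)
  then have "\<theta> z * cnj (\<theta> w) + L w z = (\<Sum>j\<in>UNIV. \<alpha> j z * cnj (\<alpha> j w)) + herm z w * L w z"
    by (simp add: algebra_simps)
  also have "herm z w * L w z = (\<Sum>i\<in>UNIV. cnj (w $ i) * (z $ i) * L w z)"
    unfolding herm_mult by (intro sum.cong refl) (simp add: mult_ac)
  finally show ?thesis using assms by (simp add: N_def restr_def)
qed

definition \<theta>V :: "complex ^ 'n \<Rightarrow> complex" where "\<theta>V = restr V \<theta>"

lemma theta_add_member:
  assumes v: "v \<in> fns HL"
  shows "(\<lambda>z. t * \<theta>V z + v z) \<in> fns HN" "(nrm HN (\<lambda>z. t * \<theta>V z + v z))\<^sup>2 \<le> (cmod t)\<^sup>2 + (nrm HL v)\<^sup>2"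
proof -
  have eq: "restr V (\<lambda>z. (\<Sum>j\<in>(UNIV :: unit set). t * \<theta> z) + (\<Sum>i\<in>(UNIV :: unit set). 1 * v z)) = (\<lambda>z. t * \<theta>V z + v z)"
    using HL.fns_fun_on[OF v] by (auto simp: fun_eq_iff restr_def \<theta>V_def fun_on_def)
  show "(\<lambda>z. t * \<theta>V z + v z) \<in> fns HN"
    using sum_kernel_member(1)[OF is_rkhs_L is_rkhs_N, where p = "\<lambda>_ _. 1" and \<alpha> = "\<lambda>_. \<theta>",
        OF N_eq1 v, of "\<lambda>_. t"] unfolding eq .
  show "(nrm HN (\<lambda>z. t * \<theta>V z + v z))\<^sup>2 \<le> (cmod t)\<^sup>2 + (nrm HL v)\<^sup>2"
    using sum_kernel_member(2)[OF is_rkhs_L is_rkhs_N, where p = "\<lambda>_ _. 1" and \<alpha> = "\<lambda>_. \<theta>",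
        OF N_eq1 v, of "\<lambda>_. t"] unfolding eq by simp
qed

lemma theta_mem: "\<theta>V \<in> fns HN"
  using theta_add_member(1)[OF HL.zero_mem, of 1] by simp

lemma HL_subset_HN: "v \<in> fns HL \<Longrightarrow> v \<in> fns HN" "v \<in> fns HL \<Longrightarrow> nrm HN v \<le> nrm HL v"
  using theta_add_member[of v 0] by (auto intro: power2_le_imp_le HL.nrm_ge_0)

text \<open>
  The two components of the adjoint of \<open>(t, v) \<mapsto> t \<theta> + v\<close>, written with the help of the
  reproducing property, so that no abstract adjoint has to be constructed.
\<close>

definition scalar_part :: "(complex ^ 'n \<Rightarrow> complex) \<Rightarrow> complex" where
  "scalar_part g = ip HN g \<theta>V"

definition kernel_part :: "(complex ^ 'n \<Rightarrow> complex) \<Rightarrow> complex ^ 'n \<Rightarrow> complex" where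
  "kernel_part g = restr V (\<lambda>x. ip HN g (L x))"

lemma pair_kernel_part:
  assumes g: "g \<in> fns HN" and S: "S \<subseteq> V"
  shows "pair S d (kernel_part g) = ip HN g (comb L S d)"
proof -
  have "pair S d (kernel_part g) = (\<Sum>x\<in>S. cnj (d x) * ip HN g (L x))"
    unfolding pair_def kernel_part_def restr_def using S by (intro sum.cong) auto
  also have "\<dots> = ip HN g (comb L S d)"
    unfolding comb_def using S
    by (subst HN.ip_sum_right) (auto intro!: HL_subset_HN HL.kernel_mem g)
  finally show ?thesis .
qed

lemma kernel_part_mem:
  assumes g: "g \<in> fns HN"
  shows "kernel_part g \<in> fns HL"
proof -
  have "cmod (pair S d (kernel_part g)) \<le> nrm HN g * nrm HL (comb L S d)" if S: "S \<subseteq> V" for S d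
    unfolding pair_kernel_part[OF g S]
    by (rule order_trans[OF HN.Cauchy_Schwarz[OF g HL_subset_HN(1)[OF HL.comb_mem[OF S]]]])
      (intro mult_left_mono HL_subset_HN HL.comb_mem S HN.nrm_ge_0 g)
  then show ?thesis
    using HL.mem_iff_pair_bound[OF HN.nrm_ge_0[OF g], of "kernel_part g"] by (simp add: kernel_part_def fun_on_def restr_def)
qed

text \<open>
  Contractivity of the adjoint. Test \<open>g\<close> against \<open>t \<theta> + k\<close> with \<open>t\<close> the scalar part of \<open>g\<close> itself and \<open>k\<close> an
  arbitrary combination of kernel functions, and use \<open>\<parallel>g - (t \<theta> + k)\<parallel>\<^sup>2 \<ge> 0\<close>.
\<close>

lemma split_bound:
  assumes g: "g \<in> fns HN"
  shows "(cmod (scalar_part g))\<^sup>2 + (nrm HL (kernel_part g))\<^sup>2 \<le> (nrm HN g)\<^sup>2"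
proof -
  have "(nrm HL (kernel_part g))\<^sup>2 \<le> (nrm HN g)\<^sup>2 - (cmod (scalar_part g))\<^sup>2"
  proof (rule HL.nrm_power2_le[OF kernel_part_mem[OF g]])
    fix S :: "(complex ^ 'n) set" and d assume S: "finite S" "S \<subseteq> V"
    define w where "w = (\<lambda>z. scalar_part g * \<theta>V z + comb L S d z)"
    note k = HL.comb_mem[OF S(2), of d]
    have w: "w \<in> fns HN" unfolding w_def by (rule theta_add_member[OF k])
    have w_le: "(nrm HN w)\<^sup>2 \<le> (cmod (scalar_part g))\<^sup>2 + (nrm HL (comb L S d))\<^sup>2"
      unfolding w_def by (rule theta_add_member[OF k])
    have "ip HN g w = cnj (scalar_part g) * scalar_part g + pair S d (kernel_part g)"
      unfolding w_def HN.ip_add_right[OF HN.scale_mem[OF theta_mem] HL_subset_HN(1)[OF k] g]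
        HN.ip_scale_right[OF g theta_mem] pair_kernel_part[OF g S(2)] by (simp add: scalar_part_def)
    also have "cnj (scalar_part g) * scalar_part g = of_real ((cmod (scalar_part g))\<^sup>2)"
      unfolding complex_norm_square by simp
    finally have "Re (ip HN g w) = (cmod (scalar_part g))\<^sup>2 + Re (pair S d (kernel_part g))" by (simp del: of_real_power)
    moreover have "0 \<le> (nrm HN g)\<^sup>2 - 2 * Re (ip HN g w) + (nrm HN w)\<^sup>2"
      unfolding HN.nrm_diff_power2[OF g w, symmetric] by simp
    ultimately show "2 * Re (pair S d (kernel_part g)) - (nrm HL (comb L S d))\<^sup>2 \<le> (nrm HN g)\<^sup>2 - (cmod (scalar_part g))\<^sup>2"
      using w_le by linarith
  qed
  then show ?thesis by simp
qed

text \<open>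
  The image in \<open>HN\<close> of the input \<open>c\<close> and the state \<open>u\<close>, the latter being fed back through the row
  \<open>cnj z\<^sub>1, ..., cnj z\<^sub>n\<close>, which has norm \<open>|z| < 1\<close>.
\<close>

definition feedback :: "complex ^ 'n \<Rightarrow> ('j \<Rightarrow> complex) \<Rightarrow> (complex ^ 'n \<Rightarrow> complex) \<Rightarrow> complex ^ 'n \<Rightarrow> complex" where
  "feedback z c u = restr V (\<lambda>x. (\<Sum>j\<in>UNIV. c j * \<alpha> j x) + herm x z * u x)"

lemma feedback_mem:
  assumes u: "u \<in> fns HL"
  shows "feedback z c u \<in> fns HN"
proof -
  have "feedback z c u = restr V (\<lambda>x. (\<Sum>j\<in>UNIV. c j * \<alpha> j x) + (\<Sum>i\<in>UNIV. x $ i * (cnj (z $ i) * u x)))"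
    by (simp add: feedback_def herm_mult)
  then show ?thesis
    using sum_kernel_member(1)[OF is_rkhs_L is_rkhs_N N_eq2 HL.scale_mem[OF u]] by simp
qed

lemma feedback_diff_bound:
  assumes u: "u \<in> fns HL" and v: "v \<in> fns HL"
  shows "nrm HN (\<lambda>x. feedback z c u x - feedback z c v x) \<le> norm z * nrm HL (\<lambda>x. u x - v x)"
proof (rule power2_le_imp_le)
  note uv = HL.diff_mem[OF u v]
  have eq: "(\<lambda>x. feedback z c u x - feedback z c v x) = restr V (\<lambda>x. (\<Sum>j\<in>UNIV. 0 * \<alpha> j x) + (\<Sum>i\<in>UNIV. x $ i * (cnj (z $ i) * (u x - v x))))"
    by (simp add: feedback_def herm_mult restr_def fun_eq_iff right_diff_distrib sum_subtractf)
  have "(nrm HN (\<lambda>x. feedback z c u x - feedback z c v x))\<^sup>2 \<le> (\<Sum>i\<in>UNIV. (nrm HL (\<lambda>x. cnj (z $ i) * (u x - v x)))\<^sup>2)"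
    unfolding eq using sum_kernel_member(2)[OF is_rkhs_L is_rkhs_N N_eq2 HL.scale_mem[OF uv], of "\<lambda>_. 0"] by simp
  also have "\<dots> = (norm z * nrm HL (\<lambda>x. u x - v x))\<^sup>2"
    unfolding HL.nrm_scale[OF uv]
    by (simp add: power_mult_distrib norm_vec_def L2_set_def sum_nonneg sum_distrib_right)
  finally show "(nrm HN (\<lambda>x. feedback z c u x - feedback z c v x))\<^sup>2 \<le> (norm z * nrm HL (\<lambda>x. u x - v x))\<^sup>2" .
qed (simp add: HL.nrm_ge_0 HL.diff_mem u v)

lemma kernel_part_diff:
  assumes "g \<in> fns HN" "h \<in> fns HN"
  shows "(\<lambda>x. kernel_part g x - kernel_part h x) = kernel_part (\<lambda>x. g x - h x)"
  using assms by (auto simp: kernel_part_def restr_def fun_eq_iff HN.ip_diff_left HL_subset_HN HL.kernel_mem)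

lemma feedback_contraction:
  assumes u: "u \<in> fns HL" and v: "v \<in> fns HL"
  shows "nrm HL (\<lambda>x. kernel_part (feedback z c u) x - kernel_part (feedback z c v) x) \<le> norm z * nrm HL (\<lambda>x. u x - v x)"
proof -
  let ?g = "\<lambda>x. feedback z c u x - feedback z c v x"
  have g: "?g \<in> fns HN" by (intro HN.diff_mem feedback_mem u v)
  have "(nrm HL (kernel_part ?g))\<^sup>2 \<le> (nrm HN ?g)\<^sup>2"
    using split_bound[OF g] zero_le_power2[of "cmod (scalar_part ?g)"] by linarith
  then have "nrm HL (kernel_part ?g) \<le> nrm HN ?g" by (rule power2_le_imp_le) (rule HN.nrm_ge_0[OF g])
  then show ?thesis using feedback_diff_bound[OF u v, of z c] by (simp add: kernel_part_diff feedback_mem u v)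
qed

lemma fixed_point_exists:
  assumes "norm z < 1"
  shows "\<exists>u\<in>fns HL. kernel_part (feedback z c u) = u"
proof -
  have "\<exists>u\<in>fns HL. nrm HL (\<lambda>x. kernel_part (feedback z c u) x - u x) = 0"
    by (rule HL.contraction_fixed_point[where r = "norm z"])
      (use assms in \<open>auto intro: kernel_part_mem feedback_mem feedback_contraction\<close>)
  then obtain u where u: "u \<in> fns HL" and "nrm HL (\<lambda>x. kernel_part (feedback z c u) x - u x) = 0" by blast
  from HL.nrm_eq_0D[OF HL.diff_mem[OF kernel_part_mem[OF feedback_mem[OF u]] u] this(2)]
  show ?thesis using u by (intro bexI[of _ u]) (auto simp: fun_eq_iff)
qed

lemma fixed_point_unique:
  assumes z: "norm z < 1" and u: "u \<in> fns HL" "kernel_part (feedback z c u) = u" and v: "v \<in> fns HL" "kernel_part (feedback z c v) = v"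
  shows "u = v"
proof -
  note uv = HL.diff_mem[OF u(1) v(1)]
  have "nrm HL (\<lambda>x. u x - v x) \<le> norm z * nrm HL (\<lambda>x. u x - v x)"
    using feedback_contraction[OF u(1) v(1), of z c] u(2) v(2) by simp
  then have "(1 - norm z) * nrm HL (\<lambda>x. u x - v x) \<le> 0" by (simp add: algebra_simps)
  then have "nrm HL (\<lambda>x. u x - v x) = 0"
    using z HL.nrm_ge_0[OF uv] by (simp add: mult_le_0_iff)
  from HL.nrm_eq_0D[OF uv this] show ?thesis by (auto simp: fun_eq_iff)
qed

definition basis_vec :: "'j \<Rightarrow> 'j \<Rightarrow> complex" where
  "basis_vec j = (\<lambda>i. if i = j then 1 else 0)"

text \<open>
  The state belonging to the input \<open>j\<close>, as a fixed point of a contraction. In operator terms it is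
  a resolvent applied to the input; the fixed point avoids inverting operators.
\<close>

definition state :: "'j \<Rightarrow> complex ^ 'n \<Rightarrow> complex ^ 'n \<Rightarrow> complex" where
  "state j z = (SOME u. u \<in> fns HL \<and> kernel_part (feedback z (basis_vec j) u) = u)"

lemma state:
  assumes "norm z < 1"
  shows "state j z \<in> fns HL" "kernel_part (feedback z (basis_vec j) (state j z)) = state j z"
  using someI_ex[OF fixed_point_exists[OF assms, unfolded Bex_def], of "basis_vec j"] unfolding state_def by blast+

definition \<psi> :: "'j \<Rightarrow> complex ^ 'n \<Rightarrow> complex" where
  "\<psi> j = restr (ball 0 1) (\<lambda>z. cnj (scalar_part (feedback z (basis_vec j) (state j z))))"

lemma feedback_sum:
  assumes I: "finite I" and u: "\<And>i. i \<in> I \<Longrightarrow> u i \<in> fns HL"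
  shows "(\<lambda>x. \<Sum>i\<in>I. t i * feedback z (c i) (u i) x) = feedback z (\<lambda>j. \<Sum>i\<in>I. t i * c i j) (\<lambda>x. \<Sum>i\<in>I. t i * u i x)"
proof
  fix x
  have "(\<Sum>i\<in>I. t i * ((\<Sum>j\<in>UNIV. c i j * \<alpha> j x) + herm x z * u i x))
     = (\<Sum>j\<in>UNIV. (\<Sum>i\<in>I. t i * c i j) * \<alpha> j x) + herm x z * (\<Sum>i\<in>I. t i * u i x)"
  proof -
    have "(\<Sum>i\<in>I. t i * (\<Sum>j\<in>UNIV. c i j * \<alpha> j x)) = (\<Sum>j\<in>UNIV. (\<Sum>i\<in>I. t i * c i j) * \<alpha> j x)"
      unfolding sum_distrib_left sum_distrib_right by (subst sum.swap) (simp add: mult_ac)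
    then show ?thesis by (simp add: distrib_left sum.distrib sum_distrib_left mult_ac)
  qed
  then show "(\<Sum>i\<in>I. t i * feedback z (c i) (u i) x) = feedback z (\<lambda>j. \<Sum>i\<in>I. t i * c i j) (\<lambda>x. \<Sum>i\<in>I. t i * u i x) x"
    by (simp add: feedback_def restr_def)
qed

lemma scalar_part_sum:
  assumes "\<And>i. i \<in> I \<Longrightarrow> g i \<in> fns HN"
  shows "scalar_part (\<lambda>x. \<Sum>i\<in>I. t i * g i x) = (\<Sum>i\<in>I. t i * scalar_part (g i))"
  unfolding scalar_part_def using assms theta_mem by (rule HN.ip_sum_left)

lemma kernel_part_sum:
  assumes "\<And>i. i \<in> I \<Longrightarrow> g i \<in> fns HN"
  shows "kernel_part (\<lambda>x. \<Sum>i\<in>I. t i * g i x) = (\<lambda>x. \<Sum>i\<in>I. t i * kernel_part (g i) x)"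
proof
  fix x
  show "kernel_part (\<lambda>x. \<Sum>i\<in>I. t i * g i x) x = (\<Sum>i\<in>I. t i * kernel_part (g i) x)"
    using HN.ip_sum_left[of I g "L x" t] assms by (auto simp: kernel_part_def restr_def HL_subset_HN HL.kernel_mem)
qed

text \<open>
  For the input \<open>c\<^sub>j = cnj (\<alpha>\<^sub>j z)\<close> the kernel function \<open>L z\<close> is a fixed point, because then the two
  expressions for \<open>N z\<close> say the same thing. By uniqueness it is the combined state, and the scalar
  part of \<open>N z\<close> is \<open>cnj (\<theta> z)\<close>.
\<close>

lemma factorization:
  assumes z: "z \<in> V"
  shows "\<theta> z = (\<Sum>j\<in>UNIV. \<alpha> j z * \<psi> j z)"
proof -
  have nz: "norm z < 1" using z V by auto
  define c where "c j = cnj (\<alpha> j z)" for j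
  define u where "u = (\<lambda>x. \<Sum>j\<in>UNIV. c j * state j z x)"
  have u: "u \<in> fns HL" unfolding u_def by (intro HL.sum_mem state nz)
  have csum: "(\<lambda>i. \<Sum>j\<in>UNIV. c j * basis_vec j i) = c"
    by (simp add: basis_vec_def fun_eq_iff if_distrib[of "\<lambda>y. _ * y"] cong: if_cong)
  have gu: "feedback z c u = (\<lambda>x. \<Sum>j\<in>UNIV. c j * feedback z (basis_vec j) (state j z) x)"
    using feedback_sum[of UNIV "\<lambda>j. state j z" c z "\<lambda>j. basis_vec j"] state(1)[OF nz] by (simp add: csum u_def)
  have "kernel_part (feedback z c u) = u"
    unfolding gu by (subst kernel_part_sum) (auto simp: feedback_mem state nz u_def)
  moreover have "feedback z c (L z) = N z"
  proof
    fix x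
    show "feedback z c (L z) x = N z x"
    proof (cases "x \<in> V")
      case True
      have "herm x z * L z x = (\<Sum>i\<in>UNIV. cnj (z $ i) * x $ i * L z x)"
        unfolding herm_mult by (intro sum.cong refl) (simp add: mult_ac)
      then show ?thesis using N_eq2[OF z True] True by (simp add: feedback_def restr_def c_def mult.commute)
    qed (simp add: feedback_def N_def restr_def)
  qed
  moreover have "kernel_part (N z) = L z"
  proof
    fix x
    show "kernel_part (N z) x = L z x"
    proof (cases "x \<in> V")
      case True
      have "ip HN (N z) (L x) = cnj (ip HN (L x) (N z))"
        by (rule HN.ip_cnj) (auto intro: HL_subset_HN HL.kernel_mem HN.kernel_mem True z)
      also have "\<dots> = cnj (L x z)"
        by (simp add: HN.reproducing HL_subset_HN HL.kernel_mem True z)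
      also have "\<dots> = L z x"
        by (rule psd_cnj[OF psd_kernel.psd[OF HL.psd_kernel] True z])
      finally show ?thesis using True by (simp add: kernel_part_def restr_def)
    qed (simp add: kernel_part_def L_def restr_def)
  qed
  ultimately have "u = L z"
    using fixed_point_unique[OF nz u _ HL.kernel_mem[OF z], of c] by simp
  with \<open>feedback z c (L z) = N z\<close> gu have "scalar_part (N z) = (\<Sum>j\<in>UNIV. c j * scalar_part (feedback z (basis_vec j) (state j z)))"
    using scalar_part_sum[of UNIV "\<lambda>j. feedback z (basis_vec j) (state j z)" c] by (simp add: feedback_mem state nz)
  moreover have "scalar_part (N z) = cnj (\<theta> z)"
    unfolding scalar_part_def HN.ip_cnj[OF theta_mem HN.kernel_mem[OF z]]
    unfolding HN.reproducing[OF theta_mem z] using z by (simp add: \<theta>V_def restr_def)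
  ultimately have "cnj (\<theta> z) = (\<Sum>j\<in>UNIV. cnj (\<alpha> j z) * cnj (\<psi> j z))"
    using nz by (simp add: c_def \<psi>_def restr_def)
  then have "cnj (\<theta> z) = cnj (\<Sum>j\<in>UNIV. \<alpha> j z * \<psi> j z)" by simp
  then show ?thesis by (simp only: complex_cnj_cancel_iff)
qed

text \<open>
  Contractivity of both maps shows that
  \<open>E z w = 1 - cnj (\<psi> z) * \<psi> w - (1 - herm w z) * \<langle>u\<^sub>z, u\<^sub>w\<rangle>\<close> is positive, where \<open>u\<close> are the states. Multiplying by
  the Drury-Arveson kernel keeps it positive and cancels the factor in front of the Gram matrix.
\<close>

lemma pick_bound_psi: "pick_bound (ball 0 1) da_kernel (\<psi> j) 1"
proof -
  define G where "G z w = ip HL (state j z) (state j w)" for z w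
  define E where "E z w = (1 - cnj (\<psi> j z) * \<psi> j w) - (1 - herm w z) * G z w" for z w
  have u: "state j z \<in> fns HL" if "z \<in> ball 0 1" for z using that by (intro state) auto
  have psd_G: "psd (ball 0 1) G" unfolding G_def[abs_def] by (rule HL.psd_Gram) (rule u)
  have "psd (ball 0 1) E"
    unfolding psd_def
  proof (intro conjI ballI allI impI)
    show "E v w = cnj (E w v)" if "w \<in> ball 0 1" "v \<in> ball 0 1" for w v
      using psd_cnj[OF psd_G that] by (simp add: E_def herm_cnj mult.commute)
    fix S :: "(complex ^ 'n) set" and t assume S: "finite S" "S \<subseteq> ball 0 1"
    have uS: "state j z \<in> fns HL" if "z \<in> S" for z using u S that by blast
    define g where "g = (\<lambda>x. \<Sum>z\<in>S. t z * feedback z (basis_vec j) (state j z) x)"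
    define T where "T = (\<Sum>z\<in>S. t z)"
    define U where "U i = (\<lambda>x. \<Sum>z\<in>S. (t z * cnj (z $ i)) * state j z x)" for i
    have U: "U i \<in> fns HL" for i unfolding U_def by (rule HL.sum_mem) (rule uS)
    have g: "g \<in> fns HN" unfolding g_def by (intro HN.sum_mem feedback_mem uS)
    have g_eq: "g = restr V (\<lambda>x. (\<Sum>i\<in>UNIV. (if i = j then T else 0) * \<alpha> i x) + (\<Sum>i\<in>UNIV. x $ i * U i x))"
    proof
      fix x
      have "(\<Sum>z\<in>S. t z * (herm x z * state j z x)) = (\<Sum>i\<in>UNIV. x $ i * U i x)"
        unfolding herm_def U_def sum_distrib_left sum_distrib_right by (subst sum.swap) (simp add: mult_ac)
      moreover have "(\<Sum>i\<in>UNIV. basis_vec j i * \<alpha> i x) = \<alpha> j x"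
        by (simp add: basis_vec_def if_distrib[of "\<lambda>y. y * _"] cong: if_cong)
      moreover have "(\<Sum>i\<in>UNIV. (if i = j then T else 0) * \<alpha> i x) = T * \<alpha> j x"
        by (simp add: if_distrib[of "\<lambda>y. y * _"] cong: if_cong)
      ultimately show "g x = restr V (\<lambda>x. (\<Sum>i\<in>UNIV. (if i = j then T else 0) * \<alpha> i x) + (\<Sum>i\<in>UNIV. x $ i * U i x)) x"
        by (simp add: g_def feedback_def restr_def distrib_left sum.distrib T_def sum_distrib_right)
    qed
    have "(nrm HN g)\<^sup>2 \<le> (\<Sum>i\<in>UNIV. (cmod (if i = j then T else 0))\<^sup>2) + (\<Sum>i\<in>UNIV. (nrm HL (U i))\<^sup>2)"
      unfolding g_eq by (rule sum_kernel_member(2)[OF is_rkhs_L is_rkhs_N N_eq2 U])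
    also have "(\<Sum>i\<in>UNIV. (cmod (if i = j then T else 0))\<^sup>2) = (cmod T)\<^sup>2"
      by (simp add: if_distrib[of "\<lambda>y. (cmod y)\<^sup>2"] cong: if_cong)
    finally have upper: "(nrm HN g)\<^sup>2 \<le> (cmod T)\<^sup>2 + (\<Sum>i\<in>UNIV. (nrm HL (U i))\<^sup>2)" .
    have scalar_g: "scalar_part g = (\<Sum>z\<in>S. t z * cnj (\<psi> j z))"
    proof -
      have "scalar_part g = (\<Sum>z\<in>S. t z * scalar_part (feedback z (basis_vec j) (state j z)))"
        unfolding g_def by (rule scalar_part_sum) (intro feedback_mem uS)
      also have "\<dots> = (\<Sum>z\<in>S. t z * cnj (\<psi> j z))"
        using S by (intro sum.cong) (auto simp: \<psi>_def restr_def)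
      finally show ?thesis .
    qed
    have kernel_g: "kernel_part g = (\<lambda>x. \<Sum>z\<in>S. t z * state j z x)"
    proof -
      have "kernel_part (feedback z (basis_vec j) (state j z)) = state j z" if "z \<in> S" for z
        using S that by (intro state) auto
      then show ?thesis unfolding g_def by (subst kernel_part_sum) (auto simp: feedback_mem uS)
    qed
    have q1: "quad (\<lambda>z w. 1) S t = of_real ((cmod T)\<^sup>2)"
      unfolding complex_norm_square T_def by (simp add: quad_def sum_product)
    have q2: "quad (\<lambda>z w. cnj (\<psi> j z) * \<psi> j w) S t = of_real ((cmod (scalar_part g))\<^sup>2)"
      unfolding complex_norm_square scalar_g by (simp add: quad_def sum_product mult_ac)
    have q3: "quad G S t = of_real ((nrm HL (kernel_part g))\<^sup>2)"
      unfolding G_def[abs_def] kernel_g by (rule HL.quad_Gram) (rule uS)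
    have q4: "quad (\<lambda>z w. herm w z * G z w) S t = of_real (\<Sum>i\<in>UNIV. (nrm HL (U i))\<^sup>2)"
    proof -
      have "quad (\<lambda>z w. herm w z * G z w) S t = (\<Sum>i\<in>UNIV. quad (\<lambda>z w. cnj (z $ i) * (w $ i) * G z w) S t)"
        unfolding quad_sum[symmetric] herm_mult
        by (intro quad_cong sum.cong refl) (simp add: mult_ac)
      also have "\<dots> = (\<Sum>i\<in>UNIV. of_real ((nrm HL (U i))\<^sup>2))"
        unfolding quad_twist G_def[abs_def]
        by (intro sum.cong refl, subst HL.quad_Gram) (auto simp: uS U_def mult_ac)
      finally show ?thesis by simp
    qed
    have "quad E S t = quad (\<lambda>z w. 1) S t - quad (\<lambda>z w. cnj (\<psi> j z) * \<psi> j w) S t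
        - quad G S t + quad (\<lambda>z w. herm w z * G z w) S t"
      unfolding quad_def sum_subtractf[symmetric] sum.distrib[symmetric]
      by (intro sum.cong refl) (simp add: E_def algebra_simps)
    then have "Re (quad E S t) = (cmod T)\<^sup>2 - (cmod (scalar_part g))\<^sup>2 - (nrm HL (kernel_part g))\<^sup>2 + (\<Sum>i\<in>UNIV. (nrm HL (U i))\<^sup>2)"
      unfolding q1 q2 q3 q4 by (simp del: of_real_power of_real_sum)
    then show "0 \<le> Re (quad E S t)" using upper split_bound[OF g] by linarith
  qed
  from psd_divide_one_minus_herm[OF this, of "\<lambda>x. x"]
  have "psd (ball 0 1) (\<lambda>z w. E z w / (1 - herm w z))" by simp
  from psd_add[OF this psd_G] have "psd (ball 0 1) (\<lambda>z w. E z w / (1 - herm w z) + G z w)" .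
  moreover have "E z w / (1 - herm w z) + G z w = da_kernel z w - cnj (\<psi> j z) * \<psi> j w * da_kernel z w"
    if "z \<in> ball 0 1" "w \<in> ball 0 1" for z w
  proof -
    have "1 - herm w z \<noteq> 0" using that by (intro one_minus_herm_nonzero) auto
    then show ?thesis using that by (simp add: E_def da_kernel_eq field_simps)
  qed
  ultimately have psd: "psd (ball 0 1) (\<lambda>z w. da_kernel z w - cnj (\<psi> j z) * \<psi> j w * da_kernel z w)"
    using psd_cong[of "ball 0 1" "\<lambda>z w. E z w / (1 - herm w z) + G z w"] by (metis (no_types, lifting))
  show ?thesis
    unfolding pick_bound_def
  proof (intro allI impI)
    fix S :: "(complex ^ 'n) set" and c assume S: "finite S" "S \<subseteq> ball 0 1"
    have "quad (\<lambda>z w. da_kernel z w - cnj (\<psi> j z) * \<psi> j w * da_kernel z w) S c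
        = quad da_kernel S c - quad da_kernel S (\<lambda>w. cnj (\<psi> j w) * c w)"
      unfolding quad_twist[symmetric] quad_def sum_subtractf[symmetric]
      by (intro sum.cong refl) (simp add: algebra_simps)
    with psd_quad_ge_0[OF psd S, of c]
    show "Re (quad da_kernel S (\<lambda>w. cnj (\<psi> j w) * c w)) \<le> 1\<^sup>2 * Re (quad da_kernel S c)" by simp
  qed
qed

end

theorem Leech_factorization:
  fixes \<alpha> :: "'j::finite \<Rightarrow> complex ^ 'n \<Rightarrow> complex"
  assumes "V \<subseteq> ball 0 1"
    and "psd V (\<lambda>w z. ((\<Sum>j\<in>UNIV. \<alpha> j z * cnj (\<alpha> j w)) - \<theta> z * cnj (\<theta> w)) / (1 - herm z w))"
  shows "\<exists>\<psi>. (\<forall>j. fun_on (ball 0 1) (\<psi> j) \<and> pick_bound (ball 0 1) da_kernel (\<psi> j) 1) \<and>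
     (\<forall>z\<in>V. \<theta> z = (\<Sum>j\<in>UNIV. \<alpha> j z * \<psi> j z))"
proof -
  interpret Leech V \<alpha> \<theta> by unfold_locales fact+
  have "fun_on (ball 0 1) (\<psi> j)" for j by (simp add: \<psi>_def fun_on_def restr_def)
  then show ?thesis using pick_bound_psi factorization by blast
qed

section \<open>Drury-Arveson multipliers: extension and factorization\<close>

lemma is_rkhs_drury_arveson: "is_rkhs (ball 0 1) da_kernel (drury_arveson :: (complex ^ 'n) fun_space)"
  unfolding drury_arveson_def by (rule is_rkhs_rkhs[OF psd_kernel_da])

interpretation da: rkhs_space "ball 0 1" "da_kernel :: complex ^ 'n \<Rightarrow> _" drury_arveson
  by unfold_locales (rule is_rkhs_drury_arveson)

lemmas da_mult_add = da.Mult_add[folded da_mult_def]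
lemmas da_mult_scale = da.Mult_scale[folded da_mult_def]
lemmas da_mult_mult = da.Mult_mult[folded da_mult_def]
lemmas da_mult_one = da.Mult_one[folded da_mult_def]
lemmas da_mult_iff = da.Mult_iff[folded da_mult_def]

lemma da_mult_fun_on: "\<phi> \<in> da_mult \<Longrightarrow> z \<notin> ball 0 1 \<Longrightarrow> \<phi> z = 0"
  by (simp add: da_mult_iff fun_on_def)

lemma da_mult_sum:
  assumes "\<And>i. i \<in> I \<Longrightarrow> F i \<in> da_mult"
  shows "(\<lambda>x. \<Sum>i\<in>I. F i x) \<in> da_mult"
proof -
  have "(\<lambda>x. 0) \<in> da_mult" using da_mult_scale[OF da_mult_one, of 0] by simp
  then show ?thesis
    using assms by (induction I rule: infinite_finite_induct) (auto intro: da_mult_add)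
qed

lemma pick_bound_iff_psd:
  assumes K: "psd X K"
  shows "pick_bound X K \<phi> M \<longleftrightarrow> psd X (\<lambda>w z. (of_real (M\<^sup>2) - cnj (\<phi> w) * \<phi> z) * K w z)"
proof -
  have quad: "quad (\<lambda>w z. (of_real (M\<^sup>2) - cnj (\<phi> w) * \<phi> z) * K w z) S c
      = of_real (M\<^sup>2) * quad K S c - quad K S (\<lambda>w. cnj (\<phi> w) * c w)" for S c
    unfolding quad_twist[symmetric] quad_def sum_distrib_left sum_subtractf[symmetric]
    by (intro sum.cong refl) (simp add: algebra_simps)
  have "(of_real (M\<^sup>2) - cnj (\<phi> v) * \<phi> w) * K v w = cnj ((of_real (M\<^sup>2) - cnj (\<phi> w) * \<phi> v) * K w v)"
    if "w \<in> X" "v \<in> X" for w v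
    unfolding complex_cnj_mult psd_cnj[OF K that] by simp
  then show ?thesis
    unfolding psd_def pick_bound_def quad by (simp del: of_real_power)
qed

lemma psd_da_kernel: "psd (ball 0 1) (da_kernel :: complex ^ 'n \<Rightarrow> _)"
  using psd_kernel.psd[OF psd_kernel_da] .

lemma pick_bound_subset: "pick_bound X K \<phi> M \<Longrightarrow> Y \<subseteq> X \<Longrightarrow> pick_bound Y K \<phi> M"
  unfolding pick_bound_def by (meson order_trans)

lemma psd_subset: "psd X K \<Longrightarrow> Y \<subseteq> X \<Longrightarrow> psd Y K"
  unfolding psd_def by (meson order_trans subsetD)

lemma da_mult_scale_unit:
  assumes "fun_on (ball 0 1) \<phi>" "pick_bound (ball 0 1) da_kernel \<phi> 1"
  shows "\<phi> \<in> da_mult"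
  unfolding da_mult_iff using assms by (intro conjI exI[of _ 1]) auto

text \<open>
  The Nevanlinna-Pick property is the Leech factorization through one constant function.
\<close>

theorem Pick_extension:
  assumes V: "V \<subseteq> ball 0 1" and pb: "pick_bound V da_kernel \<phi> M"
  shows "\<exists>\<Psi>\<in>da_mult. \<forall>z\<in>V. \<phi> z = \<Psi> z"
proof -
  have "psd V (\<lambda>w z. (of_real (M\<^sup>2) - cnj (\<phi> w) * \<phi> z) * da_kernel w z)"
    using pb pick_bound_iff_psd[OF psd_subset[OF psd_da_kernel V]] by blast
  moreover have "(of_real (M\<^sup>2) - cnj (\<phi> w) * \<phi> z) * da_kernel w z
      = ((\<Sum>j\<in>(UNIV :: unit set). of_real M * cnj (of_real M)) - \<phi> z * cnj (\<phi> w)) / (1 - herm z w)"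
    if "w \<in> V" "z \<in> V" for w z
    using that V by (auto simp: da_kernel_eq power2_eq_square mult.commute)
  ultimately have "psd V (\<lambda>w z. ((\<Sum>j\<in>(UNIV :: unit set). of_real M * cnj (of_real M)) - \<phi> z * cnj (\<phi> w)) / (1 - herm z w))"
    using psd_cong[of V "\<lambda>w z. (of_real (M\<^sup>2) - cnj (\<phi> w) * \<phi> z) * da_kernel w z"] by (metis (no_types, lifting))
  from Leech_factorization[of V "\<lambda>_ _. of_real M", OF V this]
  obtain \<psi> :: "unit \<Rightarrow> _" where \<psi>: "fun_on (ball 0 1) (\<psi> ())" "pick_bound (ball 0 1) da_kernel (\<psi> ()) 1"
    and "\<forall>z\<in>V. \<phi> z = (\<Sum>j\<in>UNIV. of_real M * \<psi> j z)" by blast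
  then have eq: "\<phi> z = of_real M * \<psi> () z" if "z \<in> V" for z using that by (simp add: UNIV_unit)
  show ?thesis
    by (rule bexI[OF _ da_mult_scale[OF da_mult_scale_unit[OF \<psi>], of "of_real M"]]) (simp add: eq)
qed

text \<open>
  The right-hand kernel is the Gram matrix of the kernel functions of \<open>G\<close>, projected to the orthogonal
  complement of the one at \<open>l\<close>.
\<close>

lemma psd_schur_complement:
  assumes G: "psd X G" and l: "l \<in> X" "G l l \<noteq> 0"
  shows "psd X (\<lambda>w z. G w z - G w l * G l z / G l l)"
proof -
  define K where "K w = restr X (G w)" for w
  have K: "is_rkhs X K (rkhs X K)"
    unfolding K_def[abs_def] by (intro is_rkhs_rkhs psd_kernel_restr G)
  interpret rkhs_space X K "rkhs X K" by unfold_locales (rule K)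
  have K_eq: "K w z = G w z" if "z \<in> X" for w z using that by (simp add: K_def restr_def)
  have ipK: "ip (rkhs X K) (K w) (K z) = G w z" if "w \<in> X" "z \<in> X" for w z
    using reproducing[OF kernel_mem[OF that(1)] that(2)] that by (simp add: K_eq)
  define h where "h w = (\<lambda>x. K w x - (G w l / G l l) * K l x)" for w
  have "psd X (\<lambda>w z. ip (rkhs X K) (h w) (h z))"
    unfolding h_def by (intro psd_Gram diff_mem scale_mem kernel_mem l)
  moreover have "ip (rkhs X K) (h w) (h z) = G w z - G w l * G l z / G l l" if "w \<in> X" "z \<in> X" for w z
  proof -
    have hw: "h w \<in> fns (rkhs X K)" and hz: "h z \<in> fns (rkhs X K)"
      unfolding h_def using that l by (intro diff_mem scale_mem kernel_mem; simp)+
    have repr: "ip (rkhs X K) (h w) (K x) = G w x - G w l * G l x / G l l" if "x \<in> X" for x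
      using reproducing[OF hw that] that by (simp add: h_def K_eq)
    have "ip (rkhs X K) (h w) (h z) = cnj (ip (rkhs X K) (h z) (h w))" by (rule ip_cnj[OF hz hw])
    also have "ip (rkhs X K) (h z) (h w) = ip (rkhs X K) (K z) (h w) - (G z l / G l l) * ip (rkhs X K) (K l) (h w)"
      unfolding h_def[of z] using that l hw
      by (simp only: ip_diff_left[OF kernel_mem scale_mem[OF kernel_mem] hw] ip_scale_left[OF kernel_mem hw])
    also have "cnj \<dots> = ip (rkhs X K) (h w) (K z) - cnj (G z l / G l l) * ip (rkhs X K) (h w) (K l)"
      using that l hw by (simp add: ip_cnj[of "K z" "h w"] ip_cnj[of "K l" "h w"] kernel_mem)
    finally show ?thesis using that l by (simp add: repr)
  qed
  ultimately show ?thesis using psd_cong by (metis (no_types, lifting))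
qed

lemma herm_diff_left: "herm (x - y) z = herm x z - herm y z"
  by (simp add: herm_def left_diff_distrib sum_subtractf)

lemma herm_diff_right: "herm z (x - y) = herm z x - herm z y"
  by (simp add: herm_def right_diff_distrib sum_subtractf)

text \<open>
  The Cauchy-Schwarz inequality for the vector \<open>\<Sum>z\<in>S. cnj (c z) z\<close> and \<open>a\<close>.
\<close>

lemma psd_herm_gap:
  fixes a :: "complex ^ 'n"
  shows "psd X (\<lambda>w z. of_real ((norm a)\<^sup>2) * herm z w - herm z a * herm a w)"
  unfolding psd_def
proof (intro conjI ballI allI impI)
  show "of_real ((norm a)\<^sup>2) * herm w v - herm w a * herm a v
      = cnj (of_real ((norm a)\<^sup>2) * herm v w - herm v a * herm a w)" for w v :: "complex ^ 'n"
    by (simp add: herm_cnj mult.commute)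
  fix S :: "(complex ^ 'n) set" and c
  define y :: "complex ^ 'n" where "y = (\<chi> i. \<Sum>z\<in>S. cnj (c z) * z $ i)"
  have y_left: "herm y b = (\<Sum>z\<in>S. cnj (c z) * herm z b)" for b
    unfolding herm_def y_def by (simp add: sum_distrib_right sum_distrib_left mult.assoc) (rule sum.swap)
  have y_right: "herm b y = (\<Sum>w\<in>S. c w * herm b w)" for b
    using arg_cong[OF y_left[of b], of cnj] by (simp add: herm_cnj)
  have "quad (\<lambda>w z. of_real ((norm a)\<^sup>2) * herm z w - herm z a * herm a w) S c
      = (\<Sum>w\<in>S. \<Sum>z\<in>S. of_real ((norm a)\<^sup>2) * (c w * (cnj (c z) * herm z w)))
        - (\<Sum>w\<in>S. \<Sum>z\<in>S. (c w * herm a w) * (cnj (c z) * herm z a))"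
    unfolding quad_def sum_subtractf[symmetric]
    by (intro sum.cong refl) (simp add: algebra_simps)
  also have "\<dots> = of_real ((norm a)\<^sup>2) * (\<Sum>w\<in>S. c w * (\<Sum>z\<in>S. cnj (c z) * herm z w))
        - (\<Sum>w\<in>S. c w * herm a w) * (\<Sum>z\<in>S. cnj (c z) * herm z a)"
    by (subst sum_product) (simp only: sum_distrib_left)
  also have "(\<Sum>w\<in>S. c w * (\<Sum>z\<in>S. cnj (c z) * herm z w)) = herm y y"
    by (simp add: y_right y_left[symmetric])
  also have "(\<Sum>w\<in>S. c w * herm a w) * (\<Sum>z\<in>S. cnj (c z) * herm z a) = herm y a * cnj (herm y a)"
    by (simp add: y_right[symmetric] y_left[symmetric] herm_cnj)
  finally have "quad (\<lambda>w z. of_real ((norm a)\<^sup>2) * herm z w - herm z a * herm a w) S c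
      = of_real ((norm a)\<^sup>2 * (norm y)\<^sup>2 - (cmod (herm y a))\<^sup>2)"
    unfolding complex_norm_square[symmetric] herm_self by (simp only: of_real_mult of_real_diff)
  moreover have "(cmod (herm y a))\<^sup>2 \<le> (norm y * norm a)\<^sup>2" by (intro power_mono cmod_herm_le) simp
  ultimately show "0 \<le> Re (quad (\<lambda>w z. of_real ((norm a)\<^sup>2) * herm z w - herm z a * herm a w) S c)"
    by (simp add: power_mult_distrib mult.commute del: of_real_mult of_real_diff of_real_power)
qed

text \<open>
  Linear functionals have multiplier norm equal to their norm, as the row of coordinates is a
  contraction.
\<close>

lemma pick_bound_herm: "pick_bound (ball 0 1) da_kernel (\<lambda>z. herm z a) (norm a)"
proof -
  let ?Q = "\<lambda>w z. of_real ((norm a)\<^sup>2) * herm z w - herm z a * herm a w"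
  have "psd (ball 0 1) (\<lambda>w z. of_real (norm a) * cnj (of_real (norm a)) + ?Q w z / (1 - herm z w))"
    by (intro psd_add psd_rank_one[of "ball 0 1" "\<lambda>_. of_real (norm a)"]
        psd_divide_one_minus_herm[where b = "\<lambda>x. x"] psd_herm_gap) simp
  moreover have "of_real (norm a) * cnj (of_real (norm a)) + ?Q w z / (1 - herm z w)
      = (of_real ((norm a)\<^sup>2) - cnj (herm w a) * herm z a) * da_kernel w z"
    if "w \<in> ball 0 1" "z \<in> ball 0 1" for w z
  proof -
    have "1 - herm z w \<noteq> 0" using that by (intro one_minus_herm_nonzero) auto
    then show ?thesis using that by (simp add: da_kernel_eq herm_cnj field_simps power2_eq_square)
  qed
  ultimately show ?thesis
    unfolding pick_bound_iff_psd[OF psd_da_kernel]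
    using psd_cong[of "ball 0 1" "\<lambda>w z. of_real (norm a) * cnj (of_real (norm a)) + ?Q w z / (1 - herm z w)"]
    by (metis (no_types, lifting))
qed

lemma pick_bound_restr: "pick_bound X K (restr X \<phi>) M \<longleftrightarrow> pick_bound X K \<phi> M"
proof -
  have "quad K S (\<lambda>w. cnj (restr X \<phi> w) * c w) = quad K S (\<lambda>w. cnj (\<phi> w) * c w)" if "S \<subseteq> X" for S c
    unfolding quad_def using that by (intro sum.cong refl) (auto simp: restr_def subset_iff)
  then show ?thesis by (simp add: pick_bound_def)
qed

lemma restr_da_multI:
  assumes "pick_bound (ball 0 1) da_kernel \<phi> M" "M \<ge> 0"
  shows "restr (ball 0 1) \<phi> \<in> da_mult"
  using assms by (auto simp: da_mult_iff pick_bound_restr) (simp add: fun_on_def restr_def)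

definition coord :: "'n \<Rightarrow> complex ^ 'n \<Rightarrow> complex" where
  "coord j = restr (ball 0 1) (\<lambda>z. z $ j)"

lemma coord_da_mult: "coord (j :: 'n::finite) \<in> da_mult"
proof -
  have "herm z (axis j 1) = z $ j" for z :: "complex ^ 'n"
    by (simp add: herm_def axis_def if_distrib[of cnj] if_distrib[of "\<lambda>y. _ * y"] cong: if_cong)
  then show ?thesis
    unfolding coord_def using restr_da_multI[OF pick_bound_herm[of "axis j 1"]] by simp
qed

text \<open>
  The Neumann series for \<open>1 - \<langle>\<cdot>, a\<rangle>\<close>, replaced by the remark that the adjoint of multiplication by this
  function is bounded below by \<open>1 - |a|\<close> on combinations of kernel functions.
\<close>

lemma da_kernel_da_mult:
  fixes a :: "complex ^ 'n"
  assumes a: "norm a < 1"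
  shows "da_kernel a \<in> da_mult"
proof -
  define r where "r = norm a"
  have r: "0 \<le> r" "r < 1" using a by (auto simp: r_def)
  let ?n = "\<lambda>S c. nrm drury_arveson (comb (da_kernel :: complex ^ 'n \<Rightarrow> _) S c)"
  have "pick_bound (ball 0 1) da_kernel (\<lambda>z. 1 / (1 - herm z a)) (1 / (1 - r))"
    unfolding da.pick_bound_iff[OF zero_le_divide_1_iff[THEN iffD2, OF less_imp_le, OF diff_gt_0_iff_gt[THEN iffD2, OF r(2)]]]
  proof (intro allI impI)
    fix S :: "(complex ^ 'n) set" and c assume S: "finite S" "S \<subseteq> ball 0 1"
    define d where "d w = cnj (1 / (1 - herm w a)) * c w" for w
    define e where "e w = cnj (herm w a) * d w" for w
    have "c w = d w - e w" if "w \<in> S" for w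
    proof -
      have "norm w < 1" using that S by auto
      then have "1 - herm w a \<noteq> 0" using a by (intro one_minus_herm_nonzero) auto
      then have "1 - cnj (herm w a) \<noteq> 0" by (metis complex_cnj_diff complex_cnj_one complex_cnj_zero_iff)
      then have "c w = (1 - cnj (herm w a)) * d w" by (simp add: d_def)
      also have "\<dots> = d w - e w" by (simp add: e_def left_diff_distrib)
      finally show ?thesis .
    qed
    then have "comb da_kernel S c = (\<lambda>x. comb da_kernel S d x - comb da_kernel S e x)"
      by (simp add: comb_def fun_eq_iff left_diff_distrib sum_subtractf)
    then have "?n S d - ?n S e \<le> ?n S c"
      using da.nrm_abs_diff[OF da.comb_mem[OF S(2)] da.comb_mem[OF S(2)], of d e] by simp
    moreover have "?n S e \<le> r * ?n S d"
      using pick_bound_herm[of a] S unfolding e_def r_def da.pick_bound_iff[OF norm_ge_zero] by blast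
    ultimately have "?n S d * (1 - r) \<le> ?n S c" by (simp add: algebra_simps)
    then have "?n S d \<le> 1 / (1 - r) * ?n S c" using r by (simp add: pos_le_divide_eq)
    then show "?n S (\<lambda>w. cnj (1 / (1 - herm w a)) * c w) \<le> 1 / (1 - r) * ?n S c"
      by (simp only: d_def[abs_def])
  qed
  then have "restr (ball 0 1) (\<lambda>z. 1 / (1 - herm z a)) \<in> da_mult"
    by (rule restr_da_multI) (use r in simp)
  then show ?thesis by (simp add: da_kernel_def)
qed

text \<open>
  The fraction in front of \<open>1 / (1 - herm z w)\<close> is \<open>\<langle>\<phi>\<^sub>l z, \<phi>\<^sub>l w\<rangle>\<close> for the automorphism \<open>\<phi>\<^sub>l\<close> of the ball that
  exchanges \<open>l\<close> and \<open>0\<close>. In this form it is visibly a sum of \<open>n + 1\<close> products of functions in the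
  ideal generated by the \<open>z\<^sub>j - l\<^sub>j\<close>.
\<close>

lemma ball_automorphism_identity:
  fixes l :: "complex ^ 'n"
  assumes l: "norm l < 1" and z: "norm z < 1" and w: "norm w < 1"
  shows "(of_real (1 - (norm l)\<^sup>2) * herm (z - l) (w - l) + herm (z - l) l * herm l (w - l))
         / ((1 - herm z l) * (1 - herm l w)) / (1 - herm z w)
       = 1 / (1 - herm z w) - (1 - herm l l) / ((1 - herm z l) * (1 - herm l w))"
proof -
  have nz: "1 - herm z l \<noteq> 0" "1 - herm l w \<noteq> 0" "1 - herm z w \<noteq> 0"
    by (rule one_minus_herm_nonzero; simp add: assms less_imp_le)+
  define zl lw zw ll where "zl = herm z l" and "lw = herm l w" and "zw = herm z w" and "ll = herm l l"
  have "of_real (1 - (norm l)\<^sup>2) = 1 - ll" by (simp add: ll_def herm_self)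
  then have num: "of_real (1 - (norm l)\<^sup>2) * herm (z - l) (w - l) + herm (z - l) l * herm l (w - l)
      = (1 - zl) * (1 - lw) - (1 - ll) * (1 - zw)"
    unfolding herm_diff_left herm_diff_right zl_def[symmetric] lw_def[symmetric] zw_def[symmetric] ll_def[symmetric]
    by (simp add: algebra_simps)
  show ?thesis
    unfolding num unfolding zl_def[symmetric] lw_def[symmetric] zw_def[symmetric] ll_def[symmetric]
    using nz[folded zl_def lw_def zw_def] by (simp add: diff_divide_distrib)
qed

text \<open>
  Let \<open>\<theta> = \<phi> - \<phi> l\<close> have multiplier norm at most \<open>M\<close>. As \<open>\<theta>\<close> vanishes at \<open>l\<close>, the Schur complement at \<open>l\<close>
  of the positive kernel \<open>(M\<^sup>2 - \<theta> \<theta>\<^sup>*) K\<close> is \<open>M\<^sup>2 (K - k\<^sub>l k\<^sub>l\<^sup>* / k\<^sub>l(l)) - \<theta> \<theta>\<^sup>* K\<close>, and by the preceding identity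
  this is the kernel of Leech's theorem for \<open>n + 1\<close> functions in the ideal of the \<open>z\<^sub>j - l\<^sub>j\<close>, which are
  indexed by the type \<open>'n option\<close>.
\<close>

theorem Gleason_factorization:
  fixes l :: "complex ^ 'n"
  assumes \<phi>: "\<phi> \<in> da_mult" and l: "norm l < 1"
  shows "\<exists>\<psi>. (\<forall>j. \<psi> j \<in> da_mult) \<and> (\<forall>z\<in>ball 0 1. \<phi> z - \<phi> l = (\<Sum>j\<in>UNIV. (z $ j - l $ j) * \<psi> j z))"
proof -
  define \<theta> where "\<theta> z = \<phi> z + (- \<phi> l) * restr (ball 0 1) (\<lambda>z. 1) z" for z
  have "\<theta> \<in> da_mult"
    unfolding \<theta>_def by (intro da_mult_add[OF \<phi>] da_mult_scale da_mult_one)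
  then obtain M where M: "M \<ge> 0" "pick_bound (ball 0 1) da_kernel \<theta> M" by (auto simp: da_mult_iff)
  have \<theta>l: "\<theta> l = 0" using l by (simp add: \<theta>_def restr_def)
  \<comment> \<open>The \<open>\<alpha>\<close> below are, up to the factor \<open>M\<close>, the functions in \<open>ball_automorphism_identity\<close>.\<close>
  define s where "s = sqrt (1 - (norm l)\<^sup>2)"
  have "(norm l)\<^sup>2 \<le> 1" using l by (simp add: power_le_one)
  then have s2: "complex_of_real s * complex_of_real s = of_real (1 - (norm l)\<^sup>2)"
    unfolding of_real_mult[symmetric] s_def by simp
  define \<alpha> :: "'n option \<Rightarrow> complex ^ 'n \<Rightarrow> complex" where
    "\<alpha> o' z = of_real M * (case o' of None \<Rightarrow> herm (z - l) l | Some j \<Rightarrow> of_real s * (z $ j - l $ j)) / (1 - herm z l)"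
    for o' z
  have option_sum: "(\<Sum>j\<in>UNIV. h j) = h None + (\<Sum>j\<in>UNIV. h (Some j))" for h :: "'n option \<Rightarrow> complex"
    by (simp add: UNIV_option_conv sum.reindex)
  have "psd (ball 0 1) (\<lambda>w z. ((\<Sum>j\<in>UNIV. \<alpha> j z * cnj (\<alpha> j w)) - \<theta> z * cnj (\<theta> w)) / (1 - herm z w))"
  proof (cases "M = 0")
    \<comment> \<open>The Schur complement needs \<open>G l l \<noteq> 0\<close>.\<close>
    case True
    have "psd (ball 0 1) (\<lambda>w z. (of_real (M\<^sup>2) - cnj (\<theta> w) * \<theta> z) * da_kernel w z)"
      using M(2) unfolding pick_bound_iff_psd[OF psd_da_kernel] .
    then show ?thesis
      by (subst psd_cong) (auto simp: True \<alpha>_def da_kernel_eq mult.commute)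
  next
    case False
    define G where "G w z = (of_real (M\<^sup>2) - cnj (\<theta> w) * \<theta> z) * da_kernel w z" for w z
    have G: "psd (ball 0 1) G"
      using M(2) unfolding pick_bound_iff_psd[OF psd_da_kernel] G_def[abs_def] .
    have nz: "1 - herm l l \<noteq> 0" using l by (intro one_minus_herm_nonzero) auto
    have "psd (ball 0 1) (\<lambda>w z. G w z - G w l * G l z / G l l)"
      by (rule psd_schur_complement[OF G]) (use l nz False in \<open>auto simp: G_def \<theta>l da_kernel_eq\<close>)
    moreover have "((\<Sum>j\<in>UNIV. \<alpha> j z * cnj (\<alpha> j w)) - \<theta> z * cnj (\<theta> w)) / (1 - herm z w) = G w z - G w l * G l z / G l l"
      if "w \<in> ball 0 1" "z \<in> ball 0 1" for w z
    proof -
      have z: "norm z < 1" and w: "norm w < 1" using that by auto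
      let ?D = "(1 - herm z l) * (1 - herm l w)"
      have "(\<Sum>j\<in>UNIV. \<alpha> j z * cnj (\<alpha> j w)) = of_real (M\<^sup>2) *
          ((of_real (1 - (norm l)\<^sup>2) * herm (z - l) (w - l) + herm (z - l) l * herm l (w - l)) / ?D)"
      proof -
        have "\<alpha> None z * cnj (\<alpha> None w) = of_real (M\<^sup>2) * (herm (z - l) l * herm l (w - l)) / ?D"
          by (simp add: \<alpha>_def herm_cnj power2_eq_square mult_ac)
        moreover have "\<alpha> (Some j) z * cnj (\<alpha> (Some j) w)
            = of_real (M\<^sup>2) * (of_real (1 - (norm l)\<^sup>2) * ((z $ j - l $ j) * cnj (w $ j - l $ j))) / ?D" for j
          unfolding s2[symmetric] by (simp add: \<alpha>_def herm_cnj power2_eq_square mult_ac)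
        moreover have "herm (z - l) (w - l) = (\<Sum>j\<in>UNIV. (z $ j - l $ j) * cnj (w $ j - l $ j))"
          by (simp add: herm_def)
        ultimately show ?thesis
          unfolding option_sum
          by (simp add: sum_distrib_left sum_divide_distrib add_divide_distrib distrib_left del: complex_cnj_diff of_real_diff of_real_power)
      qed
      then have "(\<Sum>j\<in>UNIV. \<alpha> j z * cnj (\<alpha> j w)) / (1 - herm z w)
          = of_real (M\<^sup>2) * (1 / (1 - herm z w) - (1 - herm l l) / ?D)"
        unfolding ball_automorphism_identity[OF l z w, symmetric] by simp
      moreover have "G w l * G l z / G l l = of_real (M\<^sup>2) * ((1 - herm l l) / ?D)"
      proof -
        have "G w l = of_real (M\<^sup>2) / (1 - herm l w)" "G l z = of_real (M\<^sup>2) / (1 - herm z l)"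
            "G l l = of_real (M\<^sup>2) / (1 - herm l l)"
          using l z by (simp_all add: G_def \<theta>l da_kernel_eq)
        then show ?thesis using nz False by (simp add: power2_eq_square mult.commute)
      qed
      moreover have "G w z = of_real (M\<^sup>2) * (1 / (1 - herm z w)) - \<theta> z * cnj (\<theta> w) / (1 - herm z w)"
        using z by (simp add: G_def da_kernel_eq diff_divide_distrib mult.commute)
      ultimately show ?thesis
        by (simp only: diff_divide_distrib right_diff_distrib) (simp only: diff_diff_eq add.commute)
    qed
    ultimately show ?thesis
      using psd_cong[of "ball 0 1" "\<lambda>w z. G w z - G w l * G l z / G l l"] by (metis (no_types, lifting))
  qed
  from Leech_factorization[OF subset_refl this] obtain \<psi> where
    \<psi>: "\<And>j. fun_on (ball 0 1) (\<psi> j)" "\<And>j. pick_bound (ball 0 1) da_kernel (\<psi> j) 1"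
    and eq: "\<And>z. z \<in> ball 0 1 \<Longrightarrow> \<theta> z = (\<Sum>j\<in>UNIV. \<alpha> j z * \<psi> j z)" by blast
  note \<psi>_mult = da_mult_scale_unit[OF \<psi>]
  define \<chi>' where "\<chi>' j z = (of_real M * of_real s * \<psi> (Some j) z + of_real M * cnj (l $ j) * \<psi> None z) * da_kernel l z" for j z
  have "\<chi>' j \<in> da_mult" for j
    unfolding \<chi>'_def[abs_def] by (intro da_mult_mult da_mult_add da_mult_scale \<psi>_mult da_kernel_da_mult l)
  moreover have "\<phi> z - \<phi> l = (\<Sum>j\<in>UNIV. (z $ j - l $ j) * \<chi>' j z)" if z: "z \<in> ball 0 1" for z
  proof -
    have "\<phi> z - \<phi> l = \<theta> z" using z by (simp add: \<theta>_def restr_def)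
    also have "\<dots> = \<alpha> None z * \<psi> None z + (\<Sum>j\<in>UNIV. \<alpha> (Some j) z * \<psi> (Some j) z)"
      unfolding eq[OF z] option_sum ..
    also have "\<alpha> None z * \<psi> None z = (\<Sum>j\<in>UNIV. (z $ j - l $ j) * (of_real M * cnj (l $ j) * \<psi> None z * da_kernel l z))"
      using z by (simp add: \<alpha>_def herm_def[of "z - l"] da_kernel_eq sum_distrib_left sum_distrib_right sum_divide_distrib mult_ac)
    also have "(\<Sum>j\<in>UNIV. \<alpha> (Some j) z * \<psi> (Some j) z)
        = (\<Sum>j\<in>UNIV. (z $ j - l $ j) * (of_real M * of_real s * \<psi> (Some j) z * da_kernel l z))"
      using z by (intro sum.cong refl) (simp add: \<alpha>_def da_kernel_eq)
    finally show ?thesis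
      unfolding \<chi>'_def by (simp add: sum.distrib[symmetric] algebra_simps)
  qed
  ultimately show ?thesis by blast
qed

section \<open>Characters of the Drury-Arveson multiplier algebra\<close>

locale da_character =
  fixes \<rho> :: "(complex ^ 'n \<Rightarrow> complex) \<Rightarrow> complex"
  assumes add: "\<And>\<phi> \<psi>. \<phi> \<in> da_mult \<Longrightarrow> \<psi> \<in> da_mult \<Longrightarrow> \<rho> (\<lambda>x. \<phi> x + \<psi> x) = \<rho> \<phi> + \<rho> \<psi>"
    and mult: "\<And>\<phi> \<psi>. \<phi> \<in> da_mult \<Longrightarrow> \<psi> \<in> da_mult \<Longrightarrow> \<rho> (\<lambda>x. \<phi> x * \<psi> x) = \<rho> \<phi> * \<rho> \<psi>"
    and scale: "\<And>c \<phi>. \<phi> \<in> da_mult \<Longrightarrow> \<rho> (\<lambda>x. c * \<phi> x) = c * \<rho> \<phi>"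
    and one: "\<rho> (restr (ball 0 1) (\<lambda>x. 1)) = 1"
begin

definition point :: "complex ^ 'n" where
  "point = (\<chi> j. \<rho> (coord j))"

lemma sum:
  assumes "finite I" "\<And>i. i \<in> I \<Longrightarrow> F i \<in> da_mult"
  shows "\<rho> (\<lambda>x. \<Sum>i\<in>I. F i x) = (\<Sum>i\<in>I. \<rho> (F i))"
  using assms
proof (induction I)
  case empty
  then show ?case using scale[OF da_mult_one, of 0] by simp
next
  case (insert i I)
  then show ?case by (simp add: add da_mult_sum)
qed

text \<open>
  Otherwise \<open>1 - \<langle>\<cdot>, a\<rangle>\<close> with \<open>a = point / |point|\<^sup>2\<close> would be an invertible multiplier that the character
  sends to \<open>0\<close>.
\<close>

lemma norm_point_le_1: "norm point \<le> 1"
proof (rule ccontr)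
  assume "\<not> norm point \<le> 1"
  then have p: "norm point > 1" by simp
  define a where "a = (1 / (norm point)\<^sup>2) *\<^sub>R point"
  have "norm a = 1 / norm point" using p by (simp add: a_def power2_eq_square)
  also have "\<dots> < 1" using p by (subst divide_less_eq_1_pos) auto
  finally have a: "norm a < 1" .
  define F where "F z = restr (ball 0 1) (\<lambda>x. 1) z + (- 1) * (\<Sum>j\<in>UNIV. cnj (a $ j) * coord j z)" for z
  have F: "F \<in> da_mult" unfolding F_def[abs_def]
    by (intro da_mult_add da_mult_scale da_mult_sum da_mult_one coord_da_mult)
  have F_eq: "F z = 1 - herm z a" if "z \<in> ball 0 1" for z
    using that by (simp add: F_def herm_def coord_def restr_def mult.commute)
  have "(\<lambda>z. F z * da_kernel a z) = restr (ball 0 1) (\<lambda>x. 1)"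
  proof
    fix z
    show "F z * da_kernel a z = restr (ball 0 1) (\<lambda>x. 1) z"
    proof (cases "z \<in> ball 0 1")
      case True
      then have "1 - herm z a \<noteq> 0" using a by (intro one_minus_herm_nonzero) auto
      then show ?thesis using True by (simp add: F_eq da_kernel_eq restr_def)
    qed (simp add: da_kernel_def restr_def)
  qed
  then have "\<rho> F * \<rho> (da_kernel a) = 1"
    using mult[OF F da_kernel_da_mult[OF a]] one by simp
  moreover have "\<rho> F = 1 - herm point a"
  proof -
    have "\<rho> F = 1 + (- 1) * (\<Sum>j\<in>UNIV. cnj (a $ j) * \<rho> (coord j))"
      unfolding F_def[abs_def]
      by (subst add, rule da_mult_one, intro da_mult_scale da_mult_sum coord_da_mult)
        (simp only: one scale da_mult_sum da_mult_scale coord_da_mult sum finite)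
    then show ?thesis by (simp add: herm_def point_def mult.commute)
  qed
  moreover have "herm point a = 1"
  proof -
    have "herm point a = of_real (1 / (norm point)\<^sup>2) * herm point point"
      unfolding herm_def a_def vector_scaleR_component
      by (simp add: scaleR_conv_of_real sum_distrib_left mult_ac)
    then show ?thesis using p by (auto simp: herm_self)
  qed
  ultimately show False by simp
qed

text \<open>
  Apply the character to the Gleason factorization at its own point.
\<close>

theorem eval:
  assumes p: "norm point < 1" and \<phi>: "\<phi> \<in> da_mult"
  shows "\<rho> \<phi> = \<phi> point"
proof -
  obtain \<psi> where \<psi>: "\<And>j. \<psi> j \<in> da_mult"
    and eq: "\<And>z. z \<in> ball 0 1 \<Longrightarrow> \<phi> z - \<phi> point = (\<Sum>j\<in>UNIV. (z $ j - point $ j) * \<psi> j z)"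
    using Gleason_factorization[OF \<phi> p] by blast
  define one' where "one' = restr (ball 0 1 :: (complex ^ 'n) set) (\<lambda>x. 1)"
  define q where "q j z = coord j z + (- point $ j) * one' z" for j z
  have one': "one' \<in> da_mult" unfolding one'_def by (rule da_mult_one)
  have q: "q j \<in> da_mult" for j
    unfolding q_def[abs_def] by (intro da_mult_add da_mult_scale coord_da_mult one')
  have \<rho>q: "\<rho> (q j) = 0" for j
  proof -
    have "\<rho> (q j) = \<rho> (coord j) + (- point $ j) * \<rho> one'"
      unfolding q_def[abs_def] by (simp only: add coord_da_mult da_mult_scale one' scale)
    then show ?thesis by (simp add: one one'_def point_def)
  qed
  have "\<phi> = (\<lambda>z. \<phi> point * one' z + (\<Sum>j\<in>UNIV. q j z * \<psi> j z))"
  proof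
    fix z
    show "\<phi> z = \<phi> point * one' z + (\<Sum>j\<in>UNIV. q j z * \<psi> j z)"
    proof (cases "z \<in> ball 0 1")
      case True
      then show ?thesis using eq[OF True] by (simp add: one'_def q_def coord_def restr_def algebra_simps)
    next
      case False
      then show ?thesis using da_mult_fun_on[OF \<phi> False] da_mult_fun_on[OF \<psi> False] by (simp add: one'_def restr_def)
    qed
  qed
  then have "\<rho> \<phi> = \<rho> (\<lambda>z. \<phi> point * one' z + (\<Sum>j\<in>UNIV. q j z * \<psi> j z))" by simp
  also have "\<dots> = \<phi> point * \<rho> one' + (\<Sum>j\<in>UNIV. \<rho> (q j) * \<rho> (\<psi> j))"
    by (subst add, rule da_mult_scale[OF one'], rule da_mult_sum, rule da_mult_mult[OF q \<psi>])
      (simp only: scale one' sum finite da_mult_mult q \<psi> mult)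
  finally show ?thesis by (simp add: \<rho>q one'_def one)
qed

end

section \<open>Multiplier algebras of varieties\<close>

lemma kernel_span_eq: "kernel_span V = combs V da_kernel"
  by (auto simp: kernel_span_def combs_def comb_def)

definition restr_kernel :: "(complex ^ 'n) set \<Rightarrow> complex ^ 'n \<Rightarrow> complex ^ 'n \<Rightarrow> complex" where
  "restr_kernel V w = restr V (da_kernel w)"

lemma quad_restr_kernel: "S \<subseteq> V \<Longrightarrow> quad (restr_kernel V) S c = quad da_kernel S c"
  by (rule quad_cong) (auto simp: restr_kernel_def restr_def)

lemma pick_bound_restr_kernel: "pick_bound V (restr_kernel V) \<phi> M \<longleftrightarrow> pick_bound V da_kernel \<phi> M"
  unfolding pick_bound_def by (simp add: quad_restr_kernel cong: imp_cong)

locale subset_of_ball =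
  fixes V :: "(complex ^ 'n) set"
  assumes V: "V \<subseteq> ball 0 1"
begin

abbreviation "J \<equiv> rkhs V (restr_kernel V)"

sublocale J: rkhs_space V "restr_kernel V" J
  unfolding restr_kernel_def[abs_def]
  by unfold_locales (intro is_rkhs_rkhs psd_kernel_restr psd_subset[OF psd_da_kernel V])

lemma combs_in_da: "s \<in> combs V da_kernel \<Longrightarrow> s \<in> fns drury_arveson"
  using V by (auto simp: combs_def intro!: da.comb_mem)

lemma restr_comb: "restr V (comb da_kernel S c) = comb (restr_kernel V) S c"
  by (auto simp: restr_def comb_def restr_kernel_def fun_eq_iff)

lemma restr_combs:
  assumes "s \<in> combs V da_kernel"
  shows "restr V s \<in> combs V (restr_kernel V)" "nrm J (restr V s) = nrm drury_arveson s"
proof -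
  obtain S c where s: "s = comb da_kernel S c" and S: "finite S" "S \<subseteq> V"
    using assms by (auto simp: combs_def)
  have SB: "S \<subseteq> ball 0 1" using S V by blast
  show "restr V s \<in> combs V (restr_kernel V)" unfolding s restr_comb by (rule combsI[OF S])
  show "nrm J (restr V s) = nrm drury_arveson s"
    unfolding s restr_comb nrm_def J.ip_comb_comb[OF S(2)] da.ip_comb_comb[OF SB] quad_restr_kernel[OF S(2)] ..
qed

lemma restr_combs_diff:
  assumes "s \<in> combs V da_kernel" "t \<in> combs V da_kernel"
  shows "nrm J (\<lambda>z. restr V s z - restr V t z) = nrm drury_arveson (\<lambda>z. s z - t z)"
proof -
  have "(\<lambda>z. restr V s z - restr V t z) = restr V (\<lambda>z. s z - t z)" by (simp add: restr_def fun_eq_iff)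
  then show ?thesis using restr_combs(2)[OF combs_diff[OF assms]] by simp
qed

lemma eq_restrI:
  assumes "k \<in> fns J" "\<forall>z\<in>V. k z = h z"
  shows "restr V h = k"
  using assms J.fns_fun_on[OF assms(1)] by (auto simp: restr_def fun_on_def fun_eq_iff)

text \<open>
  Restriction to \<open>V\<close> is isometric on combinations of kernel functions at points of \<open>V\<close>, hence on their
  closed span, whose image is the space of the restricted kernel.
\<close>

lemma closed_kernel_span_restr:
  assumes h: "h \<in> closed_kernel_span V"
  shows "restr V h \<in> fns J" "nrm J (restr V h) = nrm drury_arveson h"
proof -
  have hda: "h \<in> fns drury_arveson" using h by (simp add: closed_kernel_span_def)
  have "\<exists>k\<in>combs V da_kernel. nrm drury_arveson (\<lambda>z. h z - k z) < 1 / real (Suc n)" for n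
    using h unfolding closed_kernel_span_def kernel_span_eq by simp
  then obtain s where s: "\<And>n. s n \<in> combs V da_kernel"
    and s_less: "\<And>n. nrm drury_arveson (\<lambda>z. h z - s n z) < 1 / real (Suc n)" by metis
  note sda = combs_in_da[OF s]
  have lim: "(\<lambda>n. nrm drury_arveson (\<lambda>z. s n z - h z)) \<longlonglongrightarrow> 0"
  proof (rule Lim_null_comparison[OF _ LIMSEQ_Suc[OF lim_1_over_n]])
    show "\<forall>\<^sub>F n in sequentially. norm (nrm drury_arveson (\<lambda>z. s n z - h z)) \<le> 1 / real (Suc n)"
      using s_less da.nrm_ge_0[OF da.diff_mem[OF sda hda]]
      by (intro always_eventually allI) (simp add: da.nrm_minus_commute[OF hda sda] less_imp_le)
  qed
  obtain k where k: "k \<in> fns J" "nrm J k = nrm drury_arveson h" "\<forall>z\<in>V. k z = h z"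
    using isometric_limit[OF da.is_rkhs J.is_rkhs sda J.combs_mem[OF restr_combs(1)[OF s]] hda lim
        restr_combs_diff[OF s s] restr_combs(2)[OF s], of V] by (auto simp: restr_def)
  then show "restr V h \<in> fns J" "nrm J (restr V h) = nrm drury_arveson h"
    using eq_restrI[OF k(1,3)] by simp_all
qed

lemma closed_kernel_span_onto:
  assumes k: "k \<in> fns J"
  shows "\<exists>h\<in>closed_kernel_span V. restr V h = k"
proof -
  obtain r where r: "\<And>n::nat. r n \<in> combs V (restr_kernel V)" and lim: "(\<lambda>n. nrm J (\<lambda>x. r n x - k x)) \<longlonglongrightarrow> 0"
    using J.combs_dense[OF k] by blast
  have "\<exists>t\<in>combs V da_kernel. restr V t = r n" for n
    using r[of n] by (fastforce simp: combs_def restr_comb[symmetric])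
  then obtain s where s: "\<And>n. s n \<in> combs V da_kernel" and rs: "\<And>n. r n = restr V (s n)" by metis
  note sda = combs_in_da[OF s]
  obtain h where h: "h \<in> fns drury_arveson" and limda: "(\<lambda>n. nrm drury_arveson (\<lambda>z. s n z - h z)) \<longlonglongrightarrow> 0"
    and hk: "\<forall>z\<in>V. h z = k z"
    using isometric_limit[OF J.is_rkhs da.is_rkhs J.combs_mem[OF restr_combs(1)[OF s]] sda k
        lim[unfolded rs] restr_combs_diff[OF s s, symmetric] restr_combs(2)[OF s, symmetric], of V]
    by (auto simp: restr_def)
  have "h \<in> closed_kernel_span V"
    unfolding closed_kernel_span_def kernel_span_eq
  proof (intro CollectI conjI h allI impI)
    fix e :: real assume "e > 0"
    from LIMSEQ_D[OF limda this] obtain n where "norm (nrm drury_arveson (\<lambda>z. s n z - h z) - 0) < e" by blast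
    then have "nrm drury_arveson (\<lambda>z. h z - s n z) < e" by (simp add: da.nrm_minus_commute[OF h sda])
    then show "\<exists>k\<in>combs V da_kernel. nrm drury_arveson (\<lambda>z. h z - k z) < e" using s by blast
  qed
  then show ?thesis using eq_restrI[OF k, of h] hk by (intro bexI[of _ h]) simp_all
qed

lemma closed_kernel_span_diff:
  assumes "h \<in> closed_kernel_span V" "k \<in> closed_kernel_span V"
  shows "(\<lambda>z. h z - k z) \<in> closed_kernel_span V"
  unfolding closed_kernel_span_def kernel_span_eq
proof (intro CollectI conjI allI impI)
  have h: "h \<in> fns drury_arveson" and k: "k \<in> fns drury_arveson"
    using assms by (auto simp: closed_kernel_span_def)
  then show "(\<lambda>z. h z - k z) \<in> fns drury_arveson" by (rule da.diff_mem)
  fix e :: real assume "e > 0"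
  then have "e / 2 > 0" by simp
  then obtain s t where s: "s \<in> combs V da_kernel" "nrm drury_arveson (\<lambda>z. h z - s z) < e / 2"
    and t: "t \<in> combs V da_kernel" "nrm drury_arveson (\<lambda>z. k z - t z) < e / 2"
    using assms unfolding closed_kernel_span_def kernel_span_eq by blast
  note s' = combs_in_da[OF s(1)] and t' = combs_in_da[OF t(1)]
  have "nrm drury_arveson (\<lambda>z. (h z - s z) + (t z - k z))
      \<le> nrm drury_arveson (\<lambda>z. h z - s z) + nrm drury_arveson (\<lambda>z. t z - k z)"
    by (intro da.nrm_triangle da.diff_mem h k s' t')
  then have "nrm drury_arveson (\<lambda>z. (h z - k z) - (s z - t z)) < e"
    using s(2) t(2) da.nrm_minus_commute[OF k t'] by (simp add: algebra_simps)
  then show "\<exists>q\<in>combs V da_kernel. nrm drury_arveson (\<lambda>z. (h z - k z) - q z) < e"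
    by (rule bexI[where x = "\<lambda>z. s z - t z"]) (rule combs_diff[OF s(1) t(1)])
qed

lemma inj_on_restr: "inj_on (restr V) (closed_kernel_span V)"
proof (rule inj_onI)
  fix h k assume hk: "h \<in> closed_kernel_span V" "k \<in> closed_kernel_span V" and eq: "restr V h = restr V k"
  note d = closed_kernel_span_diff[OF hk]
  have "restr V (\<lambda>z. h z - k z) = (\<lambda>z. 0)"
    using eq by (simp add: restr_def fun_eq_iff) (metis (no_types, lifting))
  then have "nrm drury_arveson (\<lambda>z. h z - k z) = 0"
    using closed_kernel_span_restr(2)[OF d] J.nrm_zero by simp
  then have "(\<lambda>z. h z - k z) = (\<lambda>z. 0)"
    using da.nrm_eq_0D d by (auto simp: closed_kernel_span_def)
  then show "h = k" by (simp add: fun_eq_iff)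
qed

lemma fns_H_var: "fns (H_var V) = fns J"
  using closed_kernel_span_restr(1) closed_kernel_span_onto by (fastforce simp: H_var_def Let_def)

lemma nrm_H_var:
  assumes "h \<in> fns J"
  shows "nrm (H_var V) h = nrm J h"
proof -
  obtain k where k: "k \<in> closed_kernel_span V" "h = restr V k" using closed_kernel_span_onto[OF assms] by blast
  have "nrm (H_var V) h = nrm drury_arveson k"
    by (simp add: nrm_def H_var_def Let_def k the_inv_into_f_f[OF inj_on_restr])
  then show ?thesis using closed_kernel_span_restr(2)[OF k(1)] k(2) by simp
qed

lemma mult_norm_H_var:
  assumes "\<phi> \<in> Mult V J"
  shows "mult_norm (H_var V) \<phi> = mult_norm J \<phi>"
proof -
  have "(\<lambda>x. \<phi> x * h x) \<in> fns J" if "h \<in> fns J" for h using assms that by (simp add: Mult_def)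
  then have "{nrm (H_var V) (\<lambda>x. \<phi> x * h x) | h. h \<in> fns (H_var V) \<and> nrm (H_var V) h \<le> 1}
      = {nrm J (\<lambda>x. \<phi> x * h x) | h. h \<in> fns J \<and> nrm J h \<le> 1}"
    unfolding fns_H_var using nrm_H_var by (intro Collect_cong ex_cong1) auto
  then show ?thesis by (simp add: mult_norm_def)
qed

text \<open>
  Restricting a multiplier cannot increase its bound; that every multiplier on \<open>V\<close> arises in this way
  is the Pick property.
\<close>

lemma M_var_eq: "M_var V = Mult V J"
proof (intro equalityI subsetI)
  fix \<phi> assume "\<phi> \<in> M_var V"
  then obtain \<Psi> where \<Psi>: "\<Psi> \<in> da_mult" and \<phi>: "\<phi> = restr V \<Psi>" by (auto simp: M_var_def)
  then obtain M where "M \<ge> 0" "pick_bound (ball 0 1) da_kernel \<Psi> M" by (auto simp: da_mult_iff)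
  then have "pick_bound V (restr_kernel V) \<phi> M"
    unfolding \<phi> pick_bound_restr_kernel pick_bound_restr using V by (blast intro: pick_bound_subset)
  then show "\<phi> \<in> Mult V J" unfolding J.Mult_iff using \<open>M \<ge> 0\<close> by (auto simp: \<phi> fun_on_def restr_def)
next
  fix \<phi> assume "\<phi> \<in> Mult V J"
  then obtain M where M: "fun_on V \<phi>" "pick_bound V da_kernel \<phi> M"
    by (auto simp: J.Mult_iff pick_bound_restr_kernel)
  obtain \<Psi> where \<Psi>: "\<Psi> \<in> da_mult" "\<forall>z\<in>V. \<phi> z = \<Psi> z" using Pick_extension[OF V M(2)] by blast
  then have "\<phi> = restr V \<Psi>" using M(1) by (auto simp: fun_on_def restr_def fun_eq_iff)
  then show "\<phi> \<in> M_var V" using \<Psi>(1) by (simp add: M_var_def)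
qed

lemma M_var_norm_le_iff:
  assumes "\<phi> \<in> M_var V" "M \<ge> 0"
  shows "M_var_norm V \<phi> \<le> M \<longleftrightarrow> pick_bound V da_kernel \<phi> M"
  using J.mult_norm_le_iff[of \<phi> M] assms
  by (simp add: M_var_eq M_var_norm_def mult_norm_H_var pick_bound_restr_kernel)

lemma M_var_norm_ge_0: "\<phi> \<in> M_var V \<Longrightarrow> M_var_norm V \<phi> \<ge> 0"
  using J.mult_norm_ge_0[of \<phi>] by (simp add: M_var_eq M_var_norm_def mult_norm_H_var)

end

section \<open>Embedded discs\<close>

abbreviation \<D> :: "complex set" where "\<D> \<equiv> ball 0 1"

text \<open>
  The kernel of the space on the disc obtained by transporting the one of the image of \<open>f\<close>.
\<close>

definition disc_kernel :: "(complex \<Rightarrow> complex ^ 'n) \<Rightarrow> complex \<Rightarrow> complex \<Rightarrow> complex" where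
  "disc_kernel f w = restr \<D> (\<lambda>z. da_kernel (f w) (f z))"

locale embedded_disc =
  fixes f :: "complex \<Rightarrow> complex ^ 'n"
  assumes inj: "inj_on f \<D>" and image: "f ` \<D> \<subseteq> ball 0 1"
begin

sublocale subset_of_ball "f ` \<D>" by unfold_locales (rule image)

lemma f_norm: "z \<in> \<D> \<Longrightarrow> norm (f z) < 1"
  using subsetD[OF image imageI, of z] by simp

lemma push_f: "z \<in> \<D> \<Longrightarrow> push f \<phi> (f z) = \<phi> z"
  using inj by (auto simp: push_def restr_def the_inv_into_f_f)

lemma quad_reindex:
  assumes "S \<subseteq> \<D>"
  shows "quad da_kernel (f ` S) c = quad (disc_kernel f) S (\<lambda>z. c (f z))"
proof -
  have "inj_on f S" using inj assms by (rule inj_on_subset)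
  then show ?thesis
    unfolding quad_def using assms
    by (auto simp: sum.reindex disc_kernel_def restr_def intro!: sum.cong)
qed

text \<open>
  Both sides quantify over the same finite configurations, since \<open>f\<close> is injective.
\<close>

lemma pick_bound_push: "pick_bound (f ` \<D>) da_kernel (push f \<phi>) M \<longleftrightarrow> pick_bound \<D> (disc_kernel f) \<phi> M"
proof -
  have eq: "quad da_kernel (f ` S) (\<lambda>w. cnj (push f \<phi> w) * c w)
      = quad (disc_kernel f) S (\<lambda>z. cnj (\<phi> z) * c (f z))" if "S \<subseteq> \<D>" for S c
    unfolding quad_reindex[OF that] unfolding quad_def
  proof (intro sum.cong refl)
    fix w v assume "w \<in> S" "v \<in> S"
    with that have "w \<in> \<D>" "v \<in> \<D>" by blast+
    then show "cnj (push f \<phi> (f w)) * c (f w) * cnj (cnj (push f \<phi> (f v)) * c (f v)) * disc_kernel f w v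
        = cnj (\<phi> w) * c (f w) * cnj (cnj (\<phi> v) * c (f v)) * disc_kernel f w v"
      by (simp only: push_f)
  qed
  show ?thesis
  proof
    assume pb: "pick_bound (f ` \<D>) da_kernel (push f \<phi>) M"
    show "pick_bound \<D> (disc_kernel f) \<phi> M"
      unfolding pick_bound_def
    proof (intro allI impI)
      fix S and c :: "complex \<Rightarrow> complex" assume S: "finite S" "S \<subseteq> \<D>"
      define d where "d w = c (the_inv_into \<D> f w)" for w
      have d: "d (f z) = c z" if "z \<in> S" for z
        using that S(2) by (auto simp: d_def the_inv_into_f_f[OF inj])
      have "quad (disc_kernel f) S (\<lambda>z. cnj (\<phi> z) * c z) = quad (disc_kernel f) S (\<lambda>z. cnj (\<phi> z) * d (f z))"
        "quad (disc_kernel f) S c = quad (disc_kernel f) S (\<lambda>z. d (f z))"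
        unfolding quad_def by (intro sum.cong refl; simp add: d)+
      moreover have "Re (quad da_kernel (f ` S) (\<lambda>w. cnj (push f \<phi> w) * d w)) \<le> M\<^sup>2 * Re (quad da_kernel (f ` S) d)"
        using pb S unfolding pick_bound_def by (meson finite_imageI image_mono)
      ultimately show "Re (quad (disc_kernel f) S (\<lambda>w. cnj (\<phi> w) * c w)) \<le> M\<^sup>2 * Re (quad (disc_kernel f) S c)"
        by (simp add: eq[OF S(2)] quad_reindex[OF S(2)])
    qed
  next
    assume pb: "pick_bound \<D> (disc_kernel f) \<phi> M"
    show "pick_bound (f ` \<D>) da_kernel (push f \<phi>) M"
      unfolding pick_bound_def
    proof (intro allI impI)
      fix T c assume T: "finite T" "T \<subseteq> f ` \<D>"
      then obtain S where S: "S \<subseteq> \<D>" "finite S" "T = f ` S" by (meson finite_subset_image)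
      show "Re (quad da_kernel T (\<lambda>w. cnj (push f \<phi> w) * c w)) \<le> M\<^sup>2 * Re (quad da_kernel T c)"
        using pb[unfolded pick_bound_def, rule_format, OF S(2,1), of "\<lambda>z. c (f z)"]
        unfolding S(3) eq[OF S(1)] quad_reindex[OF S(1)] .
    qed
  qed
qed

lemma psd_kernel_disc: "psd_kernel \<D> (disc_kernel f)"
  unfolding disc_kernel_def[abs_def]
proof (rule psd_kernel_restr)
  have "psd \<D> (\<lambda>w z. 1 / (1 - herm (f z) (f w)))"
    by (rule psd_divide_one_minus_herm[OF psd_one f_norm])
  then show "psd \<D> (\<lambda>w z. da_kernel (f w) (f z))"
    by (subst psd_cong) (auto simp: da_kernel_eq f_norm)
qed

sublocale D: rkhs_space \<D> "disc_kernel f" "rkhs \<D> (disc_kernel f)"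
  by unfold_locales (rule is_rkhs_rkhs[OF psd_kernel_disc])

lemma disc_kernel_nonzero: "z \<in> \<D> \<Longrightarrow> disc_kernel f z z \<noteq> 0"
  using one_minus_herm_nonzero[OF f_norm, of z "f z"] f_norm[of z]
  by (auto simp: disc_kernel_def restr_def da_kernel_eq)

lemma push_fun_on: "fun_on (f ` \<D>) (push f \<phi>)"
  by (simp add: push_def fun_on_def restr_def)

lemma M_emb_eq: "M_emb f = Mult \<D> (rkhs \<D> (disc_kernel f))"
  unfolding M_emb_def M_var_eq set_eq_iff J.Mult_iff D.Mult_iff pick_bound_restr_kernel pick_bound_push
  by (simp add: push_fun_on)

lemma M_emb_norm_eq:
  assumes \<phi>: "\<phi> \<in> M_emb f"
  shows "M_emb_norm f \<phi> = mult_norm (rkhs \<D> (disc_kernel f)) \<phi>"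
proof -
  have p: "push f \<phi> \<in> M_var (f ` \<D>)" using \<phi> by (simp add: M_emb_def)
  have iff: "M_emb_norm f \<phi> \<le> M \<longleftrightarrow> mult_norm (rkhs \<D> (disc_kernel f)) \<phi> \<le> M" if "M \<ge> 0" for M
    using M_var_norm_le_iff[OF p that] D.mult_norm_le_iff[of \<phi> M] that \<phi>
    by (simp add: M_emb_eq M_emb_norm_def pick_bound_push)
  have "M_emb_norm f \<phi> \<ge> 0" using M_var_norm_ge_0[OF p] by (simp add: M_emb_norm_def)
  moreover have "mult_norm (rkhs \<D> (disc_kernel f)) \<phi> \<ge> 0" using D.mult_norm_ge_0 \<phi> by (simp add: M_emb_eq)
  ultimately show ?thesis using iff by (meson antisym order_refl)
qed

lemma M_emb_iff: "\<phi> \<in> M_emb f \<longleftrightarrow> fun_on \<D> \<phi> \<and> (\<exists>\<Psi>\<in>da_mult. \<forall>z\<in>\<D>. \<phi> z = \<Psi> (f z))"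
proof -
  have "push f \<phi> \<in> M_var (f ` \<D>) \<longleftrightarrow> (\<exists>\<Psi>\<in>da_mult. \<forall>z\<in>\<D>. \<phi> z = \<Psi> (f z))"
  proof
    assume "push f \<phi> \<in> M_var (f ` \<D>)"
    then obtain \<Psi> where \<Psi>: "\<Psi> \<in> da_mult" "push f \<phi> = restr (f ` \<D>) \<Psi>" by (auto simp: M_var_def)
    have "\<phi> z = \<Psi> (f z)" if "z \<in> \<D>" for z
      using push_f[OF that, of \<phi>] that unfolding \<Psi>(2) by (simp add: restr_def)
    with \<Psi>(1) show "\<exists>\<Psi>\<in>da_mult. \<forall>z\<in>\<D>. \<phi> z = \<Psi> (f z)" by blast
  next
    assume "\<exists>\<Psi>\<in>da_mult. \<forall>z\<in>\<D>. \<phi> z = \<Psi> (f z)"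
    then obtain \<Psi> where \<Psi>: "\<Psi> \<in> da_mult" "\<And>z. z \<in> \<D> \<Longrightarrow> \<phi> z = \<Psi> (f z)" by blast
    have "push f \<phi> = restr (f ` \<D>) \<Psi>"
    proof
      fix x
      show "push f \<phi> x = restr (f ` \<D>) \<Psi> x"
      proof (cases "x \<in> f ` \<D>")
        case True
        then obtain z where "z \<in> \<D>" "x = f z" by blast
        then show ?thesis using push_f[of z \<phi>] \<Psi>(2)[of z] by (simp add: restr_def)
      qed (simp add: push_def restr_def)
    qed
    with \<Psi>(1) show "push f \<phi> \<in> M_var (f ` \<D>)" by (simp add: M_var_def)
  qed
  then show ?thesis by (simp add: M_emb_def)
qed

definition pull :: "(complex ^ 'n \<Rightarrow> complex) \<Rightarrow> complex \<Rightarrow> complex" where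
  "pull \<Psi> = restr \<D> (\<lambda>z. \<Psi> (f z))"

lemma pull_eq: "z \<in> \<D> \<Longrightarrow> pull \<Psi> z = \<Psi> (f z)"
  by (simp add: pull_def restr_def)

lemma pull_mem: "\<Psi> \<in> da_mult \<Longrightarrow> pull \<Psi> \<in> M_emb f"
  unfolding M_emb_iff by (intro conjI bexI[of _ \<Psi>]) (auto simp: pull_def fun_on_def restr_def)

lemma M_emb_pull:
  assumes "\<phi> \<in> M_emb f"
  obtains \<Psi> where "\<Psi> \<in> da_mult" "\<phi> = pull \<Psi>"
proof -
  obtain \<Psi> where "\<Psi> \<in> da_mult" "\<forall>z\<in>\<D>. \<phi> z = \<Psi> (f z)" using assms by (auto simp: M_emb_iff)
  moreover from this(2) have "\<phi> = pull \<Psi>"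
    using assms by (auto simp: M_emb_iff fun_on_def pull_def restr_def fun_eq_iff)
  ultimately show ?thesis using that by blast
qed

lemma M_emb_eqI:
  assumes "\<phi> \<in> M_emb f" "fun_on \<D> \<psi>" "\<And>z. z \<in> \<D> \<Longrightarrow> \<phi> z = \<psi> z"
  shows "\<phi> = \<psi>"
proof
  fix x
  show "\<phi> x = \<psi> x"
    using assms by (cases "x \<in> \<D>") (simp_all add: M_emb_iff fun_on_def)
qed

end

section \<open>Holomorphy\<close>

text \<open>
  Combinations of kernel functions are rational, and norm convergence is locally uniform because
  \<open>\<parallel>da_kernel w\<parallel>\<^sup>2 = 1 / (1 - |w|\<^sup>2)\<close>.
\<close>

lemma da_fns_holomorphic:
  fixes g :: "complex \<Rightarrow> complex ^ 'n"
  assumes h: "h \<in> fns drury_arveson"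
    and hol: "\<And>i. (\<lambda>z. g z $ i) holomorphic_on \<D>" and image: "g ` \<D> \<subseteq> ball 0 1"
  shows "(\<lambda>z. h (g z)) holomorphic_on \<D>"
proof -
  have gn: "norm (g z) < 1" if "z \<in> \<D>" for z using subsetD[OF image imageI[OF that]] by simp
  obtain s where s: "\<And>n::nat. s n \<in> combs (ball 0 1) da_kernel"
    and lim: "(\<lambda>n. nrm drury_arveson (\<lambda>x. s n x - h x)) \<longlonglongrightarrow> 0"
    using da.combs_dense[OF h] by blast
  note sda = da.combs_mem[OF s]
  have hol_kernel: "(\<lambda>z. da_kernel w (g z)) holomorphic_on \<D>" if "w \<in> ball 0 1" for w
  proof (rule holomorphic_transform)
    show "(\<lambda>z. 1 / (1 - herm (g z) w)) holomorphic_on \<D>"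
      unfolding herm_def
    proof (intro holomorphic_intros hol)
      show "1 - (\<Sum>j\<in>UNIV. g z $ j * cnj (w $ j)) \<noteq> 0" if "z \<in> \<D>" for z
        using one_minus_herm_nonzero[OF gn[OF that], of w] \<open>w \<in> ball 0 1\<close> by (simp add: herm_def)
    qed
    show "1 / (1 - herm (g z) w) = da_kernel w (g z)" if "z \<in> \<D>" for z
      using gn[OF that] by (simp add: da_kernel_eq)
  qed
  have hol_s: "(\<lambda>z. s n (g z)) holomorphic_on \<D>" for n
  proof -
    obtain S c where S: "S \<subseteq> ball 0 1" and sn: "s n = comb da_kernel S c" using s[of n] by (auto simp: combs_def)
    show ?thesis unfolding sn comb_def using S by (intro holomorphic_intros hol_kernel) auto
  qed
  have cont_g: "continuous_on \<D> g"
  proof -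
    have "continuous_on \<D> (\<lambda>z. \<chi> i. g z $ i)"
      by (intro continuous_on_vec_lambda holomorphic_on_imp_continuous_on hol)
    then show ?thesis by simp
  qed
  show ?thesis
  proof (rule holomorphic_uniform_sequence[of _ "\<lambda>n z. s n (g z)"])
    fix x assume "x \<in> \<D>"
    then obtain d where d: "d > 0" "cball x d \<subseteq> \<D>" using open_contains_cball open_ball by meson
    have "compact ((\<lambda>z. norm (g z)) ` cball x d)"
      using cont_g d(2) by (intro compact_continuous_image continuous_on_norm) (auto intro: continuous_on_subset)
    moreover have "(\<lambda>z. norm (g z)) ` cball x d \<noteq> {}" using d(1) by simp
    ultimately obtain z0 where z0: "z0 \<in> cball x d" and max: "\<And>z. z \<in> cball x d \<Longrightarrow> norm (g z) \<le> norm (g z0)"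
      using compact_attains_sup[of "(\<lambda>z. norm (g z)) ` cball x d"] by auto
    define r where "r = norm (g z0)"
    have r: "0 \<le> r" "r < 1" using gn[of z0] z0 d(2) by (auto simp: r_def)
    have r2: "1 - r\<^sup>2 > 0" using r by (simp add: power_less_one_iff abs_square_less_1)
    define C where "C = sqrt (1 / (1 - r\<^sup>2))"
    have C: "nrm drury_arveson (da_kernel (g z)) \<le> C" if "z \<in> cball x d" for z
    proof -
      have gz: "norm (g z) < 1" using gn d(2) that by blast
      then have mem: "g z \<in> ball 0 1" by simp
      have le: "(norm (g z))\<^sup>2 \<le> r\<^sup>2" using max[OF that] by (intro power_mono) (auto simp: r_def)
      have "ip drury_arveson (da_kernel (g z)) (da_kernel (g z)) = 1 / (1 - herm (g z) (g z))"
        using da.reproducing[OF da.kernel_mem[OF mem] mem] gz by (simp add: da_kernel_eq)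
      also have "\<dots> = of_real (1 / (1 - (norm (g z))\<^sup>2))" by (simp add: herm_self)
      finally have "nrm drury_arveson (da_kernel (g z)) = sqrt (1 / (1 - (norm (g z))\<^sup>2))"
        by (simp add: nrm_def del: of_real_divide of_real_power)
      also have "\<dots> \<le> C" unfolding C_def using le r2 by (intro real_sqrt_le_mono divide_left_mono) auto
      finally show ?thesis .
    qed
    have "uniform_limit (cball x d) (\<lambda>n z. s n (g z)) (\<lambda>z. h (g z)) sequentially"
    proof (rule uniform_limitI)
      fix e :: real assume e: "e > 0"
      have "(\<lambda>n. nrm drury_arveson (\<lambda>x. s n x - h x) * C) \<longlonglongrightarrow> 0" using tendsto_mult_left_zero[OF lim] .
      from order_tendstoD(2)[OF this e]
      show "\<forall>\<^sub>F n in sequentially. \<forall>z\<in>cball x d. dist (s n (g z)) (h (g z)) < e"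
      proof eventually_elim
        case (elim n)
        show ?case
        proof
          fix z assume z: "z \<in> cball x d"
          then have mem: "g z \<in> ball 0 1" using gn d(2) by auto
          have "cmod (s n (g z) - h (g z)) \<le> nrm drury_arveson (\<lambda>x. s n x - h x) * nrm drury_arveson (da_kernel (g z))"
            by (rule da.eval_bound[OF da.diff_mem[OF sda h] mem])
          also have "\<dots> \<le> nrm drury_arveson (\<lambda>x. s n x - h x) * C"
            by (intro mult_left_mono C z da.nrm_ge_0 da.diff_mem sda h)
          finally show "dist (s n (g z)) (h (g z)) < e" using elim by (simp add: dist_norm)
        qed
      qed
    qed
    with d show "\<exists>d>0. cball x d \<subseteq> \<D> \<and> uniform_limit (cball x d) (\<lambda>n z. s n (g z)) (\<lambda>z. h (g z)) sequentially"
      by blast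
  qed (auto simp: hol_s)
qed

lemma da_mult_holomorphic:
  fixes g :: "complex \<Rightarrow> complex ^ 'n"
  assumes \<Psi>: "\<Psi> \<in> da_mult"
    and hol: "\<And>i. (\<lambda>z. g z $ i) holomorphic_on \<D>" and image: "g ` \<D> \<subseteq> ball 0 1"
  shows "(\<lambda>z. \<Psi> (g z)) holomorphic_on \<D>"
proof (rule da_fns_holomorphic[OF _ hol image])
  have "da_kernel 0 \<in> fns drury_arveson" by (rule da.kernel_mem) simp
  moreover have "\<forall>h\<in>fns drury_arveson. (\<lambda>z. \<Psi> z * h z) \<in> fns drury_arveson"
    using \<Psi> by (simp add: da_mult_def Mult_def)
  ultimately have "(\<lambda>z. \<Psi> z * da_kernel 0 z) \<in> fns drury_arveson" by blast
  moreover have "(\<lambda>z. \<Psi> z * da_kernel 0 z) = \<Psi>"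
  proof
    fix z
    show "\<Psi> z * da_kernel 0 z = \<Psi> z"
    proof (cases "z \<in> ball 0 1")
      case True
      then show ?thesis by (simp add: da_kernel_eq herm_def)
    next
      case False
      then show ?thesis using da_mult_fun_on[OF \<Psi> False] by simp
    qed
  qed
  ultimately show "\<Psi> \<in> fns drury_arveson" by simp
qed

lemma disc_embeddingD:
  fixes f :: "complex \<Rightarrow> complex ^ 'n"
  assumes "disc_embedding f V"
  shows "embedded_disc f" "V = f ` \<D>" "\<And>i. (\<lambda>z. f z $ i) holomorphic_on \<D>"
    "\<And>z. z \<in> \<D> \<Longrightarrow> \<exists>i. deriv (\<lambda>z. f z $ i) z \<noteq> 0"
    "\<exists>F. continuous_on (cball 0 1) F \<and> (\<forall>z\<in>\<D>. F z = f z) \<and> (\<forall>x\<in>cball 0 1. norm (F x) = 1 \<longleftrightarrow> norm x = 1)"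
  using assms by (auto simp: disc_embedding_def embedded_disc_def vec_eq_iff)

text \<open>
  Points of the closed disc away from \<open>a\<close> have images away from \<open>f a\<close>: inside the disc by injectivity,
  on the circle because the images lie on the sphere. Compactness makes this quantitative.
\<close>

lemma embedding_inverse_continuous:
  fixes f :: "complex \<Rightarrow> complex ^ 'n"
  assumes f: "disc_embedding f V" and a: "a \<in> \<D>" and e: "e > 0"
  shows "\<exists>\<delta>>0. \<forall>b\<in>\<D>. dist (f a) (f b) < \<delta> \<longrightarrow> dist a b < e"
proof -
  interpret embedded_disc f by (rule disc_embeddingD(1)[OF f])
  obtain F where F: "continuous_on (cball 0 1) F" "\<And>z. z \<in> \<D> \<Longrightarrow> F z = f z"
    "\<And>x. x \<in> cball 0 1 \<Longrightarrow> norm (F x) = 1 \<longleftrightarrow> norm x = 1"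
    using disc_embeddingD(5)[OF f] by blast
  define C where "C = F ` (cball 0 1 - ball a e)"
  have "compact C"
    unfolding C_def by (intro compact_continuous_image compact_diff) (auto intro: continuous_on_subset[OF F(1)])
  moreover have "f a \<notin> C"
  proof
    assume "f a \<in> C"
    then obtain x where x: "x \<in> cball 0 1" "x \<notin> ball a e" "f a = F x" by (auto simp: C_def)
    show False
    proof (cases "norm x = 1")
      case True
      then show False using F(3)[OF x(1)] f_norm[OF a] x(3) by simp
    next
      case False
      then have "x \<in> \<D>" using x(1) by auto
      then have "x = a" using inj_onD[OF inj _ _ a] F(2) x(3) by metis
      then show False using x(2) e by simp
    qed
  qed
  ultimately obtain \<delta> where \<delta>: "\<delta> > 0" "\<And>y. y \<in> C \<Longrightarrow> \<delta> \<le> dist (f a) y"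
    using separate_point_closed[of C "f a"] compact_imp_closed by blast
  have "dist a b < e" if b: "b \<in> \<D>" "dist (f a) (f b) < \<delta>" for b
  proof (rule ccontr)
    assume "\<not> dist a b < e"
    then have "F b \<in> C" using b(1) by (auto simp: C_def)
    then show False using \<delta>(2)[of "f b"] b F(2)[OF b(1)] by simp
  qed
  with \<delta>(1) show ?thesis by blast
qed

text \<open>
  Near each point some component of \<open>f\<close> has a holomorphic local inverse, and continuity of the inverse
  of \<open>f\<close> keeps \<open>\<mu>\<close> in its domain.
\<close>

lemma holomorphic_lift:
  fixes f :: "complex \<Rightarrow> complex ^ 'n"
  assumes f: "disc_embedding f V"
    and hol: "\<And>i. (\<lambda>z. f (\<mu> z) $ i) holomorphic_on \<D>" and \<mu>: "\<mu> ` \<D> \<subseteq> \<D>"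
  shows "\<mu> holomorphic_on \<D>"
  unfolding holomorphic_on_def
proof
  fix z0 assume z0: "z0 \<in> \<D>"
  define a where "a = \<mu> z0"
  have a: "a \<in> \<D>" unfolding a_def by (rule subsetD[OF \<mu> imageI[OF z0]])
  obtain j where j: "deriv (\<lambda>z. f z $ j) a \<noteq> 0" using disc_embeddingD(4)[OF f a] by blast
  obtain r where r: "r > 0" "ball a r \<subseteq> \<D>" "inj_on (\<lambda>z. f z $ j) (ball a r)"
    using has_complex_derivative_locally_invertible[OF disc_embeddingD(3)[OF f] a open_ball j] by metis
  have hol_r: "(\<lambda>z. f z $ j) holomorphic_on ball a r"
    using disc_embeddingD(3)[OF f] r(2) by (rule holomorphic_on_subset)
  obtain q where q: "q holomorphic_on (\<lambda>z. f z $ j) ` ball a r" "\<And>z. z \<in> ball a r \<Longrightarrow> q (f z $ j) = z"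
    using holomorphic_has_inverse[OF hol_r open_ball r(3)] by metis
  obtain \<delta> where \<delta>: "\<delta> > 0" "\<And>b. b \<in> \<D> \<Longrightarrow> dist (f a) (f b) < \<delta> \<Longrightarrow> dist a b < r"
    using embedding_inverse_continuous[OF f a r(1)] by blast
  have "continuous_on \<D> (\<lambda>z. \<chi> i. f (\<mu> z) $ i)"
    by (intro continuous_on_vec_lambda holomorphic_on_imp_continuous_on hol)
  then have "continuous_on \<D> (\<lambda>z. f (\<mu> z))" by simp
  then have "isCont (\<lambda>z. f (\<mu> z)) z0" using z0 open_ball by (simp add: continuous_on_eq_continuous_at)
  then obtain d where d: "d > 0" "\<And>z. dist z z0 < d \<Longrightarrow> dist (f (\<mu> z)) (f a) < \<delta>"
    using \<delta>(1) unfolding continuous_at_eps_delta a_def by blast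
  obtain d' where d': "d' > 0" "ball z0 d' \<subseteq> \<D>" using z0 open_ball by (meson open_contains_ball)
  define U where "U = ball z0 (min d d')"
  have U\<D>: "U \<subseteq> \<D>" using d'(2) by (auto simp: U_def)
  have \<mu>U: "\<mu> z \<in> ball a r" if "z \<in> U" for z
  proof -
    have "dist (f a) (f (\<mu> z)) < \<delta>" using d(2)[of z] that by (simp add: U_def dist_commute)
    moreover have "\<mu> z \<in> \<D>" using \<mu> U\<D> that by blast
    ultimately show ?thesis using \<delta>(2) by simp
  qed
  have "(q \<circ> (\<lambda>z. f (\<mu> z) $ j)) holomorphic_on U"
    by (rule holomorphic_on_compose_gen[OF holomorphic_on_subset[OF hol U\<D>] q(1)]) (use \<mu>U in auto)
  then have "\<mu> holomorphic_on U"
    by (rule holomorphic_transform) (use \<mu>U q(2) in auto)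
  moreover have "open U" "z0 \<in> U" using d(1) d'(1) by (auto simp: U_def)
  ultimately have "\<mu> field_differentiable at z0" by (rule holomorphic_on_imp_differentiable_at)
  then show "\<mu> field_differentiable at z0 within \<D>" by (rule field_differentiable_at_within)
qed

section \<open>Algebra isomorphisms\<close>

definition algebra_iso :: "('a \<Rightarrow> complex) set \<Rightarrow> ('b \<Rightarrow> complex) set \<Rightarrow> (('a \<Rightarrow> complex) \<Rightarrow> 'b \<Rightarrow> complex) \<Rightarrow> bool" where
  "algebra_iso A B \<Phi> \<longleftrightarrow> bij_betw \<Phi> A B \<and>
     (\<forall>\<phi>\<in>A. \<forall>\<psi>\<in>A. \<Phi> (\<lambda>x. \<phi> x + \<psi> x) = (\<lambda>y. \<Phi> \<phi> y + \<Phi> \<psi> y)) \<and>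
     (\<forall>c. \<forall>\<phi>\<in>A. \<Phi> (\<lambda>x. c * \<phi> x) = (\<lambda>y. c * \<Phi> \<phi> y)) \<and>
     (\<forall>\<phi>\<in>A. \<forall>\<psi>\<in>A. \<Phi> (\<lambda>x. \<phi> x * \<psi> x) = (\<lambda>y. \<Phi> \<phi> y * \<Phi> \<psi> y))"

lemma algebra_isomorphic_iff: "algebra_isomorphic A B \<longleftrightarrow> (\<exists>\<Phi>. algebra_iso A B \<Phi>)"
  by (simp add: algebra_isomorphic_def algebra_iso_def)

lemma algebra_iso_inverse:
  assumes \<Phi>: "algebra_iso A B \<Phi>"
    and closed: "\<And>\<phi> \<psi>. \<phi> \<in> A \<Longrightarrow> \<psi> \<in> A \<Longrightarrow> (\<lambda>x. \<phi> x + \<psi> x) \<in> A"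
      "\<And>\<phi> \<psi>. \<phi> \<in> A \<Longrightarrow> \<psi> \<in> A \<Longrightarrow> (\<lambda>x. \<phi> x * \<psi> x) \<in> A" "\<And>c \<phi>. \<phi> \<in> A \<Longrightarrow> (\<lambda>x. c * \<phi> x) \<in> A"
  shows "algebra_iso B A (the_inv_into A \<Phi>)"
proof -
  have bij: "bij_betw \<Phi> A B" using \<Phi> by (simp add: algebra_iso_def)
  define \<Xi> where "\<Xi> = the_inv_into A \<Phi>"
  have \<Xi>: "\<Xi> \<psi> \<in> A" "\<Phi> (\<Xi> \<psi>) = \<psi>" if "\<psi> \<in> B" for \<psi>
    using bij that the_inv_into_into[of \<Phi> A \<psi> A] f_the_inv_into_f[of \<Phi> A \<psi>]
    unfolding \<Xi>_def bij_betw_def by simp_all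
  have \<Xi>\<Phi>: "\<Xi> (\<Phi> \<phi>) = \<phi>" if "\<phi> \<in> A" for \<phi>
    using bij that unfolding \<Xi>_def bij_betw_def by (auto intro: the_inv_into_f_f)
  have add: "\<Xi> (\<lambda>x. \<phi> x + \<psi> x) = (\<lambda>y. \<Xi> \<phi> y + \<Xi> \<psi> y)" if "\<phi> \<in> B" "\<psi> \<in> B" for \<phi> \<psi>
  proof -
    have "\<Phi> (\<lambda>y. \<Xi> \<phi> y + \<Xi> \<psi> y) = (\<lambda>x. \<phi> x + \<psi> x)"
      using \<Phi> \<Xi> that unfolding algebra_iso_def by simp
    with \<Xi>\<Phi>[OF closed(1)[OF \<Xi>(1) \<Xi>(1)]] that show ?thesis by metis
  qed
  have mult: "\<Xi> (\<lambda>x. \<phi> x * \<psi> x) = (\<lambda>y. \<Xi> \<phi> y * \<Xi> \<psi> y)" if "\<phi> \<in> B" "\<psi> \<in> B" for \<phi> \<psi>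
  proof -
    have "\<Phi> (\<lambda>y. \<Xi> \<phi> y * \<Xi> \<psi> y) = (\<lambda>x. \<phi> x * \<psi> x)"
      using \<Phi> \<Xi> that unfolding algebra_iso_def by simp
    with \<Xi>\<Phi>[OF closed(2)[OF \<Xi>(1) \<Xi>(1)]] that show ?thesis by metis
  qed
  have scale: "\<Xi> (\<lambda>x. c * \<phi> x) = (\<lambda>y. c * \<Xi> \<phi> y)" if "\<phi> \<in> B" for c \<phi>
  proof -
    have "\<Phi> (\<lambda>y. c * \<Xi> \<phi> y) = (\<lambda>x. c * \<phi> x)"
      using \<Phi> \<Xi> that unfolding algebra_iso_def by simp
    with \<Xi>\<Phi>[OF closed(3)[OF \<Xi>(1)]] that show ?thesis by metis
  qed
  show ?thesis
    unfolding algebra_iso_def \<Xi>_def[symmetric]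
    using add mult scale bij_betw_the_inv_into[OF bij] by (simp add: \<Xi>_def)
qed

lemma herm_eq_1_imp_eq:
  assumes "norm x \<le> 1" "norm y = 1" "herm x y = 1"
  shows "x = y"
proof -
  have "herm (x - y) (x - y) = herm x x - 1 - cnj 1 + herm y y"
    unfolding herm_diff_left herm_diff_right using assms(3) herm_cnj[of x y] by simp
  then have "of_real ((norm (x - y))\<^sup>2) = (of_real ((norm x)\<^sup>2 - 1) :: complex)"
    using assms(2) by (simp add: herm_self)
  then have "(norm (x - y))\<^sup>2 = (norm x)\<^sup>2 - 1" by (simp only: of_real_eq_iff)
  moreover have "(norm x)\<^sup>2 \<le> 1" using assms(1) by (simp add: power_le_one)
  ultimately show ?thesis using zero_le_power2[of "norm (x - y)"] by simp
qed

text \<open>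
  The map \<open>h\<close> from the disc to the ball is read off from the characters \<open>\<Psi> \<mapsto> \<Phi> (pull \<Psi>) z\<close>. It stays off
  the sphere by the maximum principle and lies in \<open>V\<close> because the equations of \<open>V\<close> are multipliers.
\<close>

lemma isomorphism_is_composition:
  fixes f :: "complex \<Rightarrow> complex ^ 'n" and g :: "complex \<Rightarrow> complex ^ 'm"
  assumes V: "variety V" and f: "disc_embedding f V" and g: "disc_embedding g W"
    and \<Phi>: "algebra_iso (M_emb f) (M_emb g) \<Phi>"
  shows "\<exists>\<mu>. \<mu> holomorphic_on \<D> \<and> \<mu> ` \<D> \<subseteq> \<D> \<and> (\<forall>\<phi>\<in>M_emb f. \<forall>z\<in>\<D>. \<Phi> \<phi> z = \<phi> (\<mu> z))"
proof -
  interpret f: embedded_disc f by (rule disc_embeddingD(1)[OF f])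
  interpret g: embedded_disc g by (rule disc_embeddingD(1)[OF g])
  have bij: "bij_betw \<Phi> (M_emb f) (M_emb g)"
    and add: "\<And>\<phi> \<psi>. \<phi> \<in> M_emb f \<Longrightarrow> \<psi> \<in> M_emb f \<Longrightarrow> \<Phi> (\<lambda>x. \<phi> x + \<psi> x) = (\<lambda>y. \<Phi> \<phi> y + \<Phi> \<psi> y)"
    and scale: "\<And>c \<phi>. \<phi> \<in> M_emb f \<Longrightarrow> \<Phi> (\<lambda>x. c * \<phi> x) = (\<lambda>y. c * \<Phi> \<phi> y)"
    and mult: "\<And>\<phi> \<psi>. \<phi> \<in> M_emb f \<Longrightarrow> \<psi> \<in> M_emb f \<Longrightarrow> \<Phi> (\<lambda>x. \<phi> x * \<psi> x) = (\<lambda>y. \<Phi> \<phi> y * \<Phi> \<psi> y)"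
    using \<Phi> unfolding algebra_iso_def by blast+
  have \<Phi>_mem: "\<Phi> \<phi> \<in> M_emb g" if "\<phi> \<in> M_emb f" for \<phi> using bij that by (auto simp: bij_betw_def)
  define one where "one = restr \<D> (\<lambda>x. 1)"
  have onef: "one \<in> M_emb f" unfolding one_def f.M_emb_eq by (rule f.D.Mult_one)
  have oneg: "one \<in> M_emb g" unfolding one_def g.M_emb_eq by (rule g.D.Mult_one)
  have pull_one: "f.pull (restr (ball 0 1) (\<lambda>x. 1)) = one"
    using f.f_norm by (auto simp: f.pull_def one_def restr_def fun_eq_iff)
  \<comment> \<open>The image of the unit is a unit of the image, which is all of \<open>M_emb g\<close>.\<close>
  have \<Phi>_one: "\<Phi> one z = 1" if z: "z \<in> \<D>" for z
  proof -
    have "one \<in> \<Phi> ` M_emb f" using bij oneg by (simp add: bij_betw_def)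
    then obtain \<phi> where \<phi>: "\<phi> \<in> M_emb f" "\<Phi> \<phi> = one" by (metis imageE)
    have "(\<lambda>x. one x * \<phi> x) = \<phi>"
      using \<phi>(1) by (auto simp: f.M_emb_iff fun_on_def one_def restr_def fun_eq_iff)
    then have "(\<lambda>y. \<Phi> one y * one y) = one" using mult[OF onef \<phi>(1)] \<phi>(2) by simp
    from fun_cong[OF this, of z] show ?thesis using z by (simp add: one_def restr_def)
  qed
  define \<rho> where "\<rho> z \<Psi> = \<Phi> (f.pull \<Psi>) z" for z \<Psi>
  have char: "da_character (\<rho> z)" if z: "z \<in> \<D>" for z
  proof
    show "\<rho> z (\<lambda>x. \<phi> x + \<psi> x) = \<rho> z \<phi> + \<rho> z \<psi>" if "\<phi> \<in> da_mult" "\<psi> \<in> da_mult" for \<phi> \<psi>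
    proof -
      have "f.pull (\<lambda>x. \<phi> x + \<psi> x) = (\<lambda>x. f.pull \<phi> x + f.pull \<psi> x)" by (simp add: f.pull_def restr_def fun_eq_iff)
      then show ?thesis using add[OF f.pull_mem f.pull_mem] that by (simp add: \<rho>_def)
    qed
    show "\<rho> z (\<lambda>x. \<phi> x * \<psi> x) = \<rho> z \<phi> * \<rho> z \<psi>" if "\<phi> \<in> da_mult" "\<psi> \<in> da_mult" for \<phi> \<psi>
    proof -
      have "f.pull (\<lambda>x. \<phi> x * \<psi> x) = (\<lambda>x. f.pull \<phi> x * f.pull \<psi> x)" by (simp add: f.pull_def restr_def fun_eq_iff)
      then show ?thesis using mult[OF f.pull_mem f.pull_mem] that by (simp add: \<rho>_def)
    qed
    show "\<rho> z (\<lambda>x. c * \<phi> x) = c * \<rho> z \<phi>" if "\<phi> \<in> da_mult" for c \<phi>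
    proof -
      have "f.pull (\<lambda>x. c * \<phi> x) = (\<lambda>x. c * f.pull \<phi> x)" by (simp add: f.pull_def restr_def fun_eq_iff)
      then show ?thesis using scale[OF f.pull_mem] that by (simp add: \<rho>_def)
    qed
    show "\<rho> z (restr (ball 0 1) (\<lambda>x. 1)) = 1" using \<Phi>_one[OF z] by (simp add: \<rho>_def pull_one)
  qed
  define h where "h z = da_character.point (\<rho> z)" for z
  have h_comp: "h z $ j = \<Phi> (f.pull (coord j)) z" if "z \<in> \<D>" for z j
    using da_character.point_def[OF char[OF that]] by (simp add: h_def \<rho>_def)
  have h_hol: "(\<lambda>z. h z $ j) holomorphic_on \<D>" for j
  proof -
    obtain \<Psi> where \<Psi>: "\<Psi> \<in> da_mult" "\<Phi> (f.pull (coord j)) = g.pull \<Psi>"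
      using g.M_emb_pull[OF \<Phi>_mem[OF f.pull_mem[OF coord_da_mult]]] .
    show ?thesis
    proof (rule holomorphic_transform[OF da_mult_holomorphic[OF \<Psi>(1) disc_embeddingD(3)[OF g] g.image]])
      show "\<Psi> (g z) = h z $ j" if "z \<in> \<D>" for z
        using that by (simp add: h_comp \<Psi>(2) g.pull_eq)
    qed
  qed
  have h_le: "norm (h z) \<le> 1" if "z \<in> \<D>" for z
    unfolding h_def by (rule da_character.norm_point_le_1[OF char[OF that]])
  have h_less: "norm (h z0) < 1" if z0: "z0 \<in> \<D>" for z0
  proof (rule ccontr)
    assume "\<not> norm (h z0) < 1"
    then have n1: "norm (h z0) = 1" using h_le[OF z0] by simp
    define \<zeta> where "\<zeta> = h z0"
    have \<zeta>: "herm \<zeta> \<zeta> = 1" "norm \<zeta> = 1" using n1 by (simp_all add: \<zeta>_def herm_self)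
    have "(\<lambda>z. herm (h z) \<zeta>) constant_on \<D>"
    proof (rule maximum_modulus_principle[OF _ open_ball _ open_ball subset_refl z0])
      show "(\<lambda>z. herm (h z) \<zeta>) holomorphic_on \<D>"
        unfolding herm_def by (intro holomorphic_intros h_hol)
      show "norm (herm (h z) \<zeta>) \<le> norm (herm (h z0) \<zeta>)" if "z \<in> \<D>" for z
        using cmod_herm_le[of "h z" \<zeta>] h_le[OF that] \<zeta> by (simp add: \<zeta>_def)
    qed simp
    then obtain k where k: "\<And>z. z \<in> \<D> \<Longrightarrow> herm (h z) \<zeta> = k" by (auto simp: constant_on_def)
    have "k = 1" using k[OF z0] \<zeta> by (simp add: \<zeta>_def)
    then have h_const: "h z = \<zeta>" if "z \<in> \<D>" for z
      using herm_eq_1_imp_eq[OF h_le[OF that] \<zeta>(2)] k[OF that] by simp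
    have "f z $ j = \<zeta> $ j" if z: "z \<in> \<D>" for z j
    proof -
      have "\<Phi> (f.pull (coord j)) = \<Phi> (\<lambda>x. \<zeta> $ j * one x)"
        unfolding scale[OF onef]
      proof (rule g.M_emb_eqI[OF \<Phi>_mem[OF f.pull_mem[OF coord_da_mult]]])
        show "fun_on \<D> (\<lambda>y. \<zeta> $ j * \<Phi> one y)"
          using \<Phi>_mem[OF onef] by (simp add: g.M_emb_iff fun_on_def)
        show "\<Phi> (f.pull (coord j)) y = \<zeta> $ j * \<Phi> one y" if "y \<in> \<D>" for y
          using h_comp[OF that, of j] h_const[OF that] \<Phi>_one[OF that] by simp
      qed
      moreover have "(\<lambda>x. \<zeta> $ j * one x) \<in> M_emb f"
        using onef unfolding f.M_emb_eq by (rule f.D.Mult_scale)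
      ultimately have "f.pull (coord j) = (\<lambda>x. \<zeta> $ j * one x)"
        using bij f.pull_mem[OF coord_da_mult] by (auto simp: bij_betw_def inj_on_def)
      from fun_cong[OF this, of z] show ?thesis
        using z f.f_norm[OF z] by (simp add: f.pull_eq coord_def one_def restr_def)
    qed
    then have "f 0 = f (1/2)" by (simp add: vec_eq_iff)
    with inj_onD[OF f.inj this] show False by simp
  qed
  have eval: "\<Phi> (f.pull \<Psi>) z = \<Psi> (h z)" if "\<Psi> \<in> da_mult" "z \<in> \<D>" for \<Psi> z
    using da_character.eval[OF char[OF that(2)] _ that(1)] h_less[OF that(2)] by (simp add: h_def \<rho>_def)
  have hV: "h z \<in> f ` \<D>" if z: "z \<in> \<D>" for z
  proof -
    obtain E where E: "E \<subseteq> da_mult" "V = {z \<in> ball 0 1. \<forall>\<phi>\<in>E. \<phi> z = 0}" using V by (auto simp: variety_def)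
    have "\<phi> (h z) = 0" if "\<phi> \<in> E" for \<phi>
    proof -
      have "f.pull \<phi> = (\<lambda>x. 0 * one x)"
        using that E(2) disc_embeddingD(2)[OF f] by (auto simp: f.pull_def restr_def fun_eq_iff)
      then have "\<Phi> (f.pull \<phi>) z = 0" using scale[OF onef, of 0] by simp
      then show ?thesis using eval[OF _ z] that E(1) by auto
    qed
    then have "h z \<in> V" using h_less[OF z] E(2) by simp
    then show ?thesis using disc_embeddingD(2)[OF f] by simp
  qed
  define \<mu> where "\<mu> z = the_inv_into \<D> f (h z)" for z
  have \<mu>: "\<mu> z \<in> \<D>" "f (\<mu> z) = h z" if "z \<in> \<D>" for z
    using the_inv_into_into[OF f.inj hV[OF that] subset_refl] f_the_inv_into_f[OF f.inj hV[OF that]]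
    by (simp_all add: \<mu>_def)
  have "\<mu> holomorphic_on \<D>"
  proof (rule holomorphic_lift[OF f])
    show "(\<lambda>z. f (\<mu> z) $ i) holomorphic_on \<D>" for i
      by (rule holomorphic_transform[OF h_hol]) (simp add: \<mu>)
  qed (use \<mu> in auto)
  moreover have "\<Phi> \<phi> z = \<phi> (\<mu> z)" if \<phi>: "\<phi> \<in> M_emb f" and z: "z \<in> \<D>" for \<phi> z
  proof -
    obtain \<Psi> where \<Psi>: "\<Psi> \<in> da_mult" "\<phi> = f.pull \<Psi>" using f.M_emb_pull[OF \<phi>] .
    show ?thesis using eval[OF \<Psi>(1) z] \<mu>[OF z] by (simp add: \<Psi>(2) f.pull_eq)
  qed
  ultimately show ?thesis using \<mu>(1) by blast
qed

lemma M_emb_separates: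
  assumes f: "embedded_disc f" and ab: "a \<in> \<D>" "b \<in> \<D>"
    and eq: "\<And>\<phi>. \<phi> \<in> M_emb f \<Longrightarrow> \<phi> a = \<phi> b"
  shows "a = b"
proof -
  interpret embedded_disc f by fact
  have "f a $ j = f b $ j" for j
    using eq[OF pull_mem[OF coord_da_mult[of j]]] f_norm[OF ab(1)] f_norm[OF ab(2)] ab
    by (simp add: pull_eq coord_def restr_def)
  then show ?thesis using inj_onD[OF inj _ ab] by (simp add: vec_eq_iff)
qed

lemma equivalent_normsI:
  assumes 1: "\<forall>x\<in>A. N2 x \<le> C * N1 x" "C \<ge> 0" and 2: "\<forall>x\<in>A. N1 x \<le> D * N2 x" "D \<ge> 0"
    and pos: "\<forall>x\<in>A. N1 x \<ge> 0" "\<forall>x\<in>A. N2 x \<ge> 0"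
  shows "equivalent_norms A N1 N2"
  unfolding equivalent_norms_def
proof (rule exI[of _ "1 / (D + 1)"], rule conjI, goal_cases)
  case 2
  show ?case
  proof (rule exI[of _ "C + 1"], intro conjI ballI)
    fix x assume x: "x \<in> A"
    have "N1 x \<le> (D + 1) * N2 x" using assms(3) pos x by (fastforce simp: distrib_right)
    then show "1 / (D + 1) * N1 x \<le> N2 x" using assms(4) by (simp add: pos_divide_le_eq mult.commute)
    show "N2 x \<le> (C + 1) * N1 x" using assms(1) pos x by (fastforce simp: distrib_right)
  qed (use assms(2) in simp)
qed (use assms(4) in simp)

theorem theorem2:
  fixes V :: "(complex ^ 'n) set" and W :: "(complex ^ 'm) set"
    and f :: "complex \<Rightarrow> complex ^ 'n" and g :: "complex \<Rightarrow> complex ^ 'm"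
  assumes "attached_disc V" and "disc_embedding f V"
    and "attached_disc W" and "disc_embedding g W"
    and "algebra_isomorphic (M_emb f) (M_emb g)"
  shows "\<exists>\<mu>. disc_automorphism \<mu> \<and> M_emb f = M_emb (g \<circ> \<mu>) \<and>
           equivalent_norms (M_emb f) (M_emb_norm f) (M_emb_norm (g \<circ> \<mu>))"
proof -
  interpret f: embedded_disc f by (rule disc_embeddingD(1)[OF assms(2)])
  interpret g: embedded_disc g by (rule disc_embeddingD(1)[OF assms(4)])
  have var: "variety V" "variety W" using assms(1,3) by (auto simp: attached_disc_def)
  obtain \<Phi> where \<Phi>: "algebra_iso (M_emb f) (M_emb g) \<Phi>" using assms(5) by (auto simp: algebra_isomorphic_iff)
  define \<Xi> where "\<Xi> = the_inv_into (M_emb f) \<Phi>"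
  have \<Xi>: "algebra_iso (M_emb g) (M_emb f) \<Xi>"
    unfolding \<Xi>_def using \<Phi> unfolding f.M_emb_eq
    by (rule algebra_iso_inverse) (rule f.D.Mult_add f.D.Mult_mult f.D.Mult_scale; assumption)+
  have bij: "bij_betw \<Phi> (M_emb f) (M_emb g)" using \<Phi> by (simp add: algebra_iso_def)
  have \<Phi>_mem: "\<Phi> \<phi> \<in> M_emb g" "\<Xi> (\<Phi> \<phi>) = \<phi>" if "\<phi> \<in> M_emb f" for \<phi>
    using bij that by (auto simp: \<Xi>_def bij_betw_def the_inv_into_f_f)
  have \<Xi>_mem: "\<Xi> \<psi> \<in> M_emb f" "\<Phi> (\<Xi> \<psi>) = \<psi>" if "\<psi> \<in> M_emb g" for \<psi>
    using bij that the_inv_into_into[of \<Phi> "M_emb f" \<psi> "M_emb f"] f_the_inv_into_f[of \<Phi> "M_emb f" \<psi>]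
    unfolding \<Xi>_def bij_betw_def by simp_all
  obtain \<nu> where \<nu>: "\<nu> holomorphic_on \<D>" "\<nu> ` \<D> \<subseteq> \<D>"
    and \<Phi>_eq: "\<And>\<phi> z. \<phi> \<in> M_emb f \<Longrightarrow> z \<in> \<D> \<Longrightarrow> \<Phi> \<phi> z = \<phi> (\<nu> z)"
    using isomorphism_is_composition[OF var(1) assms(2,4) \<Phi>] by blast
  obtain \<mu> where \<mu>: "\<mu> holomorphic_on \<D>" "\<mu> ` \<D> \<subseteq> \<D>"
    and \<Xi>_eq: "\<And>\<psi> z. \<psi> \<in> M_emb g \<Longrightarrow> z \<in> \<D> \<Longrightarrow> \<Xi> \<psi> z = \<psi> (\<mu> z)"
    using isomorphism_is_composition[OF var(2) assms(4,2) \<Xi>] by blast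
  have \<nu>\<mu>: "\<nu> (\<mu> z) = z" if z: "z \<in> \<D>" for z
  proof (rule M_emb_separates[OF f.embedded_disc_axioms _ z])
    have \<mu>z: "\<mu> z \<in> \<D>" using \<mu>(2) z by blast
    then show "\<nu> (\<mu> z) \<in> \<D>" using \<nu>(2) by blast
    show "\<phi> (\<nu> (\<mu> z)) = \<phi> z" if "\<phi> \<in> M_emb f" for \<phi>
      using \<Phi>_eq[OF that \<mu>z] \<Xi>_eq[OF \<Phi>_mem(1)[OF that] z] \<Phi>_mem(2)[OF that] by simp
  qed
  have \<mu>\<nu>: "\<mu> (\<nu> z) = z" if z: "z \<in> \<D>" for z
  proof (rule M_emb_separates[OF g.embedded_disc_axioms _ z])
    have \<nu>z: "\<nu> z \<in> \<D>" using \<nu>(2) z by blast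
    then show "\<mu> (\<nu> z) \<in> \<D>" using \<mu>(2) by blast
    show "\<psi> (\<mu> (\<nu> z)) = \<psi> z" if "\<psi> \<in> M_emb g" for \<psi>
      using \<Xi>_eq[OF that \<nu>z] \<Phi>_eq[OF \<Xi>_mem(1)[OF that] z] \<Xi>_mem(2)[OF that] by simp
  qed
  have "disc_automorphism \<mu>"
    unfolding disc_automorphism_def using \<mu> \<nu> \<nu>\<mu> \<mu>\<nu> by blast
  interpret gm: embedded_disc "g \<circ> \<mu>"
  proof
    have "inj_on \<mu> \<D>" by (rule inj_on_inverseI[of _ \<nu>]) (rule \<nu>\<mu>)
    then show "inj_on (g \<circ> \<mu>) \<D>"
      using inj_on_subset[OF g.inj \<mu>(2)] by (rule comp_inj_on)
    show "(g \<circ> \<mu>) ` \<D> \<subseteq> ball 0 1" using \<mu>(2) g.image by (auto simp: image_comp[symmetric])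
  qed
  have eq: "M_emb f = M_emb (g \<circ> \<mu>)"
  proof (intro equalityI subsetI)
    fix \<phi> assume \<phi>: "\<phi> \<in> M_emb f"
    obtain \<Psi> where \<Psi>: "\<Psi> \<in> da_mult" "\<Phi> \<phi> = g.pull \<Psi>" using g.M_emb_pull[OF \<Phi>_mem(1)[OF \<phi>]] .
    have "\<phi> z = \<Psi> ((g \<circ> \<mu>) z)" if z: "z \<in> \<D>" for z
    proof -
      have "\<mu> z \<in> \<D>" using \<mu>(2) z by blast
      then show ?thesis
        using \<Xi>_eq[OF \<Phi>_mem(1)[OF \<phi>] z] \<Phi>_mem(2)[OF \<phi>] by (simp add: \<Psi>(2) g.pull_eq)
    qed
    moreover have "fun_on \<D> \<phi>" using \<phi> by (simp add: f.M_emb_iff)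
    ultimately show "\<phi> \<in> M_emb (g \<circ> \<mu>)" unfolding gm.M_emb_iff using \<Psi>(1) by blast
  next
    fix \<phi> assume "\<phi> \<in> M_emb (g \<circ> \<mu>)"
    then obtain \<Psi> where \<phi>: "fun_on \<D> \<phi>" and \<Psi>: "\<Psi> \<in> da_mult" "\<And>z. z \<in> \<D> \<Longrightarrow> \<phi> z = \<Psi> (g (\<mu> z))"
      by (auto simp: gm.M_emb_iff)
    note p = g.pull_mem[OF \<Psi>(1)]
    have "\<Xi> (g.pull \<Psi>) = \<phi>"
    proof (rule f.M_emb_eqI[OF \<Xi>_mem(1)[OF p] \<phi>])
      fix z assume z: "z \<in> \<D>"
      then have "\<mu> z \<in> \<D>" using \<mu>(2) by blast
      then show "\<Xi> (g.pull \<Psi>) z = \<phi> z" using \<Xi>_eq[OF p z] \<Psi>(2)[OF z] by (simp add: g.pull_eq)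
    qed
    then show "\<phi> \<in> M_emb f" using \<Xi>_mem(1)[OF p] by simp
  qed
  have Mult_eq: "Mult \<D> (rkhs \<D> (disc_kernel f)) = Mult \<D> (rkhs \<D> (disc_kernel (g \<circ> \<mu>)))"
    using eq unfolding f.M_emb_eq gm.M_emb_eq .
  obtain C where C: "C \<ge> 0" "\<forall>\<phi>\<in>M_emb f. mult_norm (rkhs \<D> (disc_kernel (g \<circ> \<mu>))) \<phi>
      \<le> C * mult_norm (rkhs \<D> (disc_kernel f)) \<phi>"
    using mult_norm_dominated[OF f.D.is_rkhs gm.D.is_rkhs Mult_eq f.disc_kernel_nonzero]
    unfolding f.M_emb_eq by blast
  obtain D where D: "D \<ge> 0" "\<forall>\<phi>\<in>M_emb f. mult_norm (rkhs \<D> (disc_kernel f)) \<phi>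
      \<le> D * mult_norm (rkhs \<D> (disc_kernel (g \<circ> \<mu>))) \<phi>"
    using mult_norm_dominated[OF gm.D.is_rkhs f.D.is_rkhs Mult_eq[symmetric] gm.disc_kernel_nonzero]
    unfolding f.M_emb_eq Mult_eq by blast
  have N1: "M_emb_norm f \<phi> = mult_norm (rkhs \<D> (disc_kernel f)) \<phi>" if "\<phi> \<in> M_emb f" for \<phi>
    by (rule f.M_emb_norm_eq[OF that])
  have N2: "M_emb_norm (g \<circ> \<mu>) \<phi> = mult_norm (rkhs \<D> (disc_kernel (g \<circ> \<mu>))) \<phi>" if "\<phi> \<in> M_emb f" for \<phi>
    using that unfolding eq by (rule gm.M_emb_norm_eq)
  have "equivalent_norms (M_emb f) (M_emb_norm f) (M_emb_norm (g \<circ> \<mu>))"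
  proof (rule equivalent_normsI[OF _ C(1) _ D(1)])
    show "\<forall>\<phi>\<in>M_emb f. M_emb_norm f \<phi> \<ge> 0"
      using f.D.mult_norm_ge_0 by (simp add: N1 f.M_emb_eq)
    show "\<forall>\<phi>\<in>M_emb f. M_emb_norm (g \<circ> \<mu>) \<phi> \<ge> 0"
      using gm.D.mult_norm_ge_0 by (simp add: N2 f.M_emb_eq Mult_eq)
  qed (use C(2) D(2) in \<open>simp_all add: N1 N2\<close>)
  with \<open>disc_automorphism \<mu>\<close> eq show ?thesis by blast
qed

end
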